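(* Assume $c_{nl}^l<c_{bg}^u<c_{nl}^u$ and $\gamma_{nl}(0)>c_{bg}^u$, let $s_0>0$ be the smallest $s$ with $\gamma_{nl}(s)=c_{bg}^u$, let $0<s_M<s_0$ and $\gamma_l=\min_{s\in[0,s_M]}\gamma_{nl}(s)$. Let $A\subset\Omega$ be measurable (the anomalous region), with material property $\gamma_A(x,s)=\gamma_{nl}(s)$ for $x\in A$ and $\gamma_A(x,s)=\gamma_{bg}(x)$ for $x\in\Omega\setminus A$. Let $T\subset\Omega$ be measurable (the region of a test anomaly), with material property $\gamma_T(x,s)=\gamma_{nl}(s)$ for $x\in T$ and $\gamma_T(x,s)=\min(\gamma_{bg}(x),\gamma_{nl}(s))$ for $x\in\Omega\setminus T$. Let $F\subset\Omega$ be measurable and such that (i) $A\subseteq F$ and (ii) $T\not\subseteq F$. Let $\Lambda_F^u$ and $\Lambda_T^l$ be the (linear) Dirichlet-to-Neumann operators of the linear material properties $$\gamma_F^u(x)=\begin{cases} c_{nl}^u & \text{in } F\\ \gamma_{bg}(x) & \text{in } \Omega\setminus F,\end{cases}\qquad \gamma_T^l(x)=\begin{cases} \gamma_l & \text{in } T\\ \gamma_{bg}(x) & \text{in } \Omega\setminus T.\end{cases}$$ If $\Lambda_F^u-\Lambda_T^l$ has negative eigenvalues, then for every nonzero element $f$ of the span of the eigenfunctions corresponding to the negative eigenvalues of $\Lambda_F^u-\Lambda_T^l$ there exists a constant $\lambda_f^0>0$ such that $$\langle\overline{\Lambda}_A(\lambda f)-\overline{\Lambda}_T(\lambda f),\lambda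 f\rangle<0\qquad\text{for all } 0<\lambda<\lambda_f^0,$$ where $\overline\Lambda_A$ and $\overline\Lambda_T$ are the average Dirichlet-to-Neumann operators of $\gamma_A$ and $\gamma_T$.
   Context: Setting. $\Omega\subset\mathbb{R}^n$, $n\ge 2$, is an open bounded connected domain with Lipschitz boundary. $X_\diamond(\partial\Omega)=\{g\in H^{1/2}(\partial\Omega):\int_{\partial\Omega}g=0\}$, $X_\diamond'(\partial\Omega)$ is its dual, and $\langle\cdot,\cdot\rangle$ is the duality pairing extending the $L^2(\partial\Omega)$ inner product. Material properties. The linear background $\gamma_{bg}\in L^\infty(\Omega)$ satisfies $c_{bg}^l\le\gamma_{bg}(x)\le c_{bg}^u$ a.e., with positive constants $c_{bg}^l,c_{bg}^u$. The nonlinear material property $\gamma_{nl}:[0,+\infty)\to\mathbb{R}$ (spatially uniform) satisfies: (H1) $\gamma_{nl}$ is continuous; (H2) $s\mapsto\gamma_{nl}(s)s$ is strictly increasing on $[0,+\infty)$; (H3) there are positive constants $c_{nl}^l<c_{nl}^u$ with $c_{nl}^l\le\gamma_{nl}(s)\le c_{nl}^u$ for all $s\ge0$; (H4) there is $\kappa>0$ with $(\gamma_{nl}(|\mathbf s_2|)\mathbf s_2-\gamma_{nl}(|\mathbf s_1|)\mathbf s_1)\cdot(\mathbf s_2-\mathbf s_1)\ge\kappa|\mathbf s_2-\mathbf s_1|^2$ for all $\mathbf s_1,\mathbf s_2\in\mathbb{R}^n$. Dirichlet-to-Neumann (DtN) operators. For a material property $\gamma(x,s)$ and $f\in X_\diamond(\partial\Omega)$,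 let $u\in H^1(\Omega)$ be the unique weak solution of $\nabla\cdot(\gamma(x,|\nabla u|)\nabla u)=0$ in $\Omega$, $u=f$ on $\partial\Omega$. The DtN operator $\Lambda:X_\diamond(\partial\Omega)\to X_\diamond'(\partial\Omega)$ is $\Lambda(f)=\gamma\,\partial_n u|_{\partial\Omega}$, i.e. $\langle\Lambda(f),\varphi\rangle=\int_\Omega\gamma(x,|\nabla u|)\nabla u\cdot\nabla\tilde\varphi\,dx$ for any $\tilde\varphi\in H^1(\Omega)$ with trace $\varphi\in X_\diamond(\partial\Omega)$. The average DtN operator $\overline\Lambda$ is defined by $\langle\overline\Lambda(f),\varphi\rangle=\int_0^1\langle\Lambda(\alpha f),\varphi\rangle\,d\alpha$ for all $\varphi\in X_\diamond(\partial\Omega)$. Sub/superscripts on $\Lambda,\overline\Lambda$ match those of the corresponding $\gamma$. Eigenvalues. A real number $\delta$ is an eigenvalue of a linear operator $L:X_\diamond(\partial\Omega)\to X_\diamond'(\partial\Omega)$ with eigenfunction $\varphi\in X_\diamond(\partial\Omega)\setminus\{0\}$ if $\langle L\varphi,\psi\rangle=\delta\int_{\partial\Omega}\varphi\psi$ for all $\psi\in X_\diamond(\partial\Omega)$. "Span" means the set of finite linear combinations. *)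

theory Defs
  imports "HOL-Analysis.Analysis"
begin

section \<open>Smooth functions and the \<open>L\<^sup>2\<close> spaces\<close>

definition gradient :: "('a::euclidean_space \<Rightarrow> real) \<Rightarrow> 'a \<Rightarrow> 'a" where
  "gradient f x = (\<Sum>b\<in>Basis. frechet_derivative f (at x) b *\<^sub>R b)"

fun Ck :: "nat \<Rightarrow> ('a::euclidean_space \<Rightarrow> real) \<Rightarrow> bool" where
  "Ck 0 f \<longleftrightarrow> continuous_on UNIV f"
| "Ck (Suc k) f \<longleftrightarrow>
     (\<forall>x. f differentiable (at x)) \<and> (\<forall>b\<in>Basis. Ck k (\<lambda>x. frechet_derivative f (at x) b))"

definition smooth :: "('a::euclidean_space \<Rightarrow> real) \<Rightarrow> bool" where
  "smooth f \<longleftrightarrow> (\<forall>k. Ck k f)"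

definition test_function :: "'a::euclidean_space set \<Rightarrow> ('a \<Rightarrow> real) \<Rightarrow> bool" where
  "test_function \<Omega> \<phi> \<longleftrightarrow>
     smooth \<phi> \<and> compact (closure {x. \<phi> x \<noteq> 0}) \<and> closure {x. \<phi> x \<noteq> 0} \<subseteq> \<Omega>"

text \<open>
  Elements of function spaces are represented by functions; two functions that agree almost
  everywhere represent the same element.
\<close>

definition L2 :: "'a measure \<Rightarrow> ('a \<Rightarrow> 'b::euclidean_space) set" where
  "L2 M = {f \<in> borel_measurable M. integrable M (\<lambda>x. (norm (f x))\<^sup>2)}"

definition L2_limit ::
  "'a measure \<Rightarrow> (nat \<Rightarrow> 'a \<Rightarrow> 'b::euclidean_space) \<Rightarrow> ('a \<Rightarrow> 'b) \<Rightarrow> bool" where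
  "L2_limit M w u \<longleftrightarrow> (\<lambda>k. \<integral>\<^sup>+x. ennreal ((norm (w k x - u x))\<^sup>2) \<partial>M) \<longlonglongrightarrow> 0"


section \<open>The domain and its boundary\<close>

text \<open>
  Near every boundary point, \<open>\<Omega>\<close> is the part above the graph of a Lipschitz function \<open>h\<close>,
  defined on the hyperplane orthogonal to a unit vector \<open>e\<close>.
\<close>

definition lipschitz_boundary :: "'a::euclidean_space set \<Rightarrow> bool" where
  "lipschitz_boundary \<Omega> \<longleftrightarrow>
     (\<forall>p\<in>frontier \<Omega>. \<exists>e r C h. norm e = 1 \<and> 0 < r \<and> C-lipschitz_on {y. y \<bullet> e = 0} h \<and>
        \<Omega> \<inter> ball p r = {x \<in> ball p r. h (x - (x \<bullet> e) *\<^sub>R e) < x \<bullet> e})"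

text \<open>
  The \<open>k\<close>-dimensional Hausdorff measure (for \<open>k \<ge> 1\<close>), normalised so that it agrees with Lebesgue
  measure on \<open>k\<close>-dimensional planes. Boundedness is required of the covering sets because
  \<^const>\<open>diameter\<close> is only meaningful for bounded sets. The outer measure is countably additive on
  the Borel sets, so \<^const>\<open>measure_of\<close> does not collapse to the null measure.
\<close>

definition hausdorff_content :: "nat \<Rightarrow> real \<Rightarrow> 'a::metric_space set \<Rightarrow> ennreal" where
  "hausdorff_content k \<delta> A =
     (INF U \<in> {U :: nat \<Rightarrow> 'a set. A \<subseteq> (\<Union>i. U i) \<and> (\<forall>i. bounded (U i) \<and> diameter (U i) \<le> \<delta>)}.
        \<Sum>i. ennreal (unit_ball_vol (real k) * (diameter (U i) / 2) ^ k))"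

definition hausdorff_outer :: "nat \<Rightarrow> 'a::metric_space set \<Rightarrow> ennreal" where
  "hausdorff_outer k A = (SUP \<delta>\<in>{0<..}. hausdorff_content k \<delta> A)"

definition hausdorff_measure :: "nat \<Rightarrow> 'a::metric_space measure" where
  "hausdorff_measure k = measure_of UNIV (sets borel) (hausdorff_outer k)"

definition surface_measure :: "'a::euclidean_space set \<Rightarrow> 'a measure" where
  "surface_measure \<Omega> = restrict_space (hausdorff_measure (DIM('a) - 1)) (frontier \<Omega>)"


section \<open>Sobolev spaces and traces\<close>

definition weak_gradient :: "'a::euclidean_space set \<Rightarrow> ('a \<Rightarrow> real) \<Rightarrow> ('a \<Rightarrow> 'a) \<Rightarrow> bool" where
  "weak_gradient \<Omega> u G \<longleftrightarrow>
     (\<forall>\<phi>. test_function \<Omega> \<phi> \<longrightarrow>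
        (LINT x|lebesgue_on \<Omega>. u x *\<^sub>R gradient \<phi> x) = - (LINT x|lebesgue_on \<Omega>. \<phi> x *\<^sub>R G x))"

text \<open>
  An element \<open>u\<close> of \<open>H\<^sup>1(\<Omega>)\<close> is carried along with its weak gradient \<open>G\<close>, which \<open>u\<close> determines
  almost everywhere: the set below consists of the pairs \<open>(u, \<nabla>u)\<close>.
\<close>

definition H1 :: "'a::euclidean_space set \<Rightarrow> (('a \<Rightarrow> real) \<times> ('a \<Rightarrow> 'a)) set" where
  "H1 \<Omega> = {(u, G). u \<in> L2 (lebesgue_on \<Omega>) \<and> G \<in> L2 (lebesgue_on \<Omega>) \<and> weak_gradient \<Omega> u G}"

text \<open>
  The trace is the continuous extension to \<open>H\<^sup>1(\<Omega>)\<close> of the restriction of smooth functions to the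
  boundary; it is given by its graph.
\<close>

definition has_trace ::
  "'a::euclidean_space set \<Rightarrow> ('a \<Rightarrow> real) \<Rightarrow> ('a \<Rightarrow> 'a) \<Rightarrow> ('a \<Rightarrow> real) \<Rightarrow> bool" where
  "has_trace \<Omega> u G g \<longleftrightarrow> (u, G) \<in> H1 \<Omega> \<and> g \<in> L2 (surface_measure \<Omega>) \<and>
     (\<exists>w. (\<forall>k. smooth (w k)) \<and>
          L2_limit (lebesgue_on \<Omega>) w u \<and>
          L2_limit (lebesgue_on \<Omega>) (\<lambda>k. gradient (w k)) G \<and>
          L2_limit (surface_measure \<Omega>) w g)"

text \<open>\<open>H\<^sup>1\<^sup>/\<^sup>2(\<partial>\<Omega>)\<close> is the trace space of \<open>H\<^sup>1(\<Omega>)\<close>.\<close>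

definition H_half :: "'a::euclidean_space set \<Rightarrow> ('a \<Rightarrow> real) set" where
  "H_half \<Omega> = {g. \<exists>u G. has_trace \<Omega> u G g}"

definition X_diamond :: "'a::euclidean_space set \<Rightarrow> ('a \<Rightarrow> real) set" where
  "X_diamond \<Omega> = {g \<in> H_half \<Omega>. (LINT x|surface_measure \<Omega>. g x) = 0}"

definition bdry_nonzero :: "'a::euclidean_space set \<Rightarrow> ('a \<Rightarrow> real) \<Rightarrow> bool" where
  "bdry_nonzero \<Omega> g \<longleftrightarrow> \<not> (AE x in surface_measure \<Omega>. g x = 0)"


section \<open>Dirichlet-to-Neumann operators\<close>

text \<open>A material property is a function \<open>\<gamma> x s\<close> of position and field strength.\<close>

definition weak_solution ::
  "'a::euclidean_space set \<Rightarrow> ('a \<Rightarrow> real \<Rightarrow> real) \<Rightarrow> ('a \<Rightarrow> real) \<Rightarrow>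
   ('a \<Rightarrow> real) \<Rightarrow> ('a \<Rightarrow> 'a) \<Rightarrow> bool" where
  "weak_solution \<Omega> \<gamma> f u G \<longleftrightarrow> has_trace \<Omega> u G f \<and>
     (\<forall>v W. has_trace \<Omega> v W (\<lambda>x. 0) \<longrightarrow>
        (LINT x|lebesgue_on \<Omega>. \<gamma> x (norm (G x)) * (G x \<bullet> W x)) = 0)"

text \<open>
  An operator from the space \<open>X\<^sub>\<diamond>\<close> to its dual is a function of two arguments: \<open>L f \<phi>\<close> is the
  duality pairing of \<open>L f\<close> with \<open>\<phi>\<close>. The value of the Dirichlet-to-Neumann operator does not
  depend on the representatives of the weak solution \<open>(u, G)\<close> nor on the extension \<open>(v, W)\<close>
  of \<open>\<phi>\<close>.
\<close>

definition DtN ::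
  "'a::euclidean_space set \<Rightarrow> ('a \<Rightarrow> real \<Rightarrow> real) \<Rightarrow> ('a \<Rightarrow> real) \<Rightarrow> ('a \<Rightarrow> real) \<Rightarrow> real" where
  "DtN \<Omega> \<gamma> f \<phi> =
     (THE r. \<forall>u G v W. weak_solution \<Omega> \<gamma> f u G \<and> has_trace \<Omega> v W \<phi> \<longrightarrow>
        r = (LINT x|lebesgue_on \<Omega>. \<gamma> x (norm (G x)) * (G x \<bullet> W x)))"

definition avg_DtN ::
  "'a::euclidean_space set \<Rightarrow> ('a \<Rightarrow> real \<Rightarrow> real) \<Rightarrow> ('a \<Rightarrow> real) \<Rightarrow> ('a \<Rightarrow> real) \<Rightarrow> real" where
  "avg_DtN \<Omega> \<gamma> f \<phi> = integral {0..1} (\<lambda>\<alpha>. DtN \<Omega> \<gamma> (\<lambda>x. \<alpha> * f x) \<phi>)"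

definition eigenfunction ::
  "'a::euclidean_space set \<Rightarrow> (('a \<Rightarrow> real) \<Rightarrow> ('a \<Rightarrow> real) \<Rightarrow> real) \<Rightarrow> real \<Rightarrow> ('a \<Rightarrow> real) \<Rightarrow> bool"
  where
  "eigenfunction \<Omega> L \<delta> \<phi> \<longleftrightarrow> \<phi> \<in> X_diamond \<Omega> \<and> bdry_nonzero \<Omega> \<phi> \<and>
     (\<forall>\<psi>\<in>X_diamond \<Omega>. L \<phi> \<psi> = \<delta> * (LINT x|surface_measure \<Omega>. \<phi> x * \<psi> x))"

definition eigenvalue ::
  "'a::euclidean_space set \<Rightarrow> (('a \<Rightarrow> real) \<Rightarrow> ('a \<Rightarrow> real) \<Rightarrow> real) \<Rightarrow> real \<Rightarrow> bool" where
  "eigenvalue \<Omega> L \<delta> \<longleftrightarrow> (\<exists>\<phi>. eigenfunction \<Omega> L \<delta> \<phi>)"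

definition fun_span :: "('a \<Rightarrow> real) set \<Rightarrow> ('a \<Rightarrow> real) set" where
  "fun_span B = {\<lambda>x. \<Sum>\<phi>\<in>S. c \<phi> * \<phi> x | S c. finite S \<and> S \<subseteq> B}"

end

theory Submission
  imports Defs
begin

text \<open>
  The average Dirichlet-to-Neumann form at \<open>(f, f)\<close> is the minimal energy \<open>E(f)\<close> among the extensions
  of \<open>f\<close>, because \<open>\<alpha> \<mapsto> E(\<alpha> f)\<close> is convex with subgradient \<open>\<langle>\<Lambda>(\<alpha> f), f\<rangle>\<close>. Since \<open>\<gamma>A \<le> \<gamma>Fu\<close>, the
  energy of \<open>\<gamma>A\<close> at \<open>t f\<close> is at most \<open>t\<^sup>2/2\<close> times the form of \<open>\<gamma>Fu\<close>. Since \<open>\<gamma>T \<ge> \<gamma>Tl\<close> for field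
  strengths up to \<open>sM\<close>, convexity bounds the energy of \<open>\<gamma>T\<close> at \<open>t f\<close> below by \<open>t\<^sup>2/2\<close> times the form
  of \<open>\<gamma>Tl\<close>, up to an error \<open>o(t\<^sup>2)\<close> from the set where the gradient of the linear solution exceeds
  \<open>sM / t\<close>. The difference of the two quadratic forms is negative on the span of the negative
  eigenfunctions, which are orthogonal for distinct eigenvalues.

  Weak solutions exist because strong convexity makes the gradients of a minimising sequence a
  Cauchy sequence; Friedrichs' inequality then controls the functions themselves. It follows by
  integrating along lines parallel to an axis up to the boundary, which needs no regularity of it.
\<close>

section \<open>Square integrable functions\<close>

definition L2sq :: "'a measure \<Rightarrow> ('a \<Rightarrow> 'b::euclidean_space) \<Rightarrow> ennreal" where
  "L2sq M f = (\<integral>\<^sup>+x. ennreal ((norm (f x))\<^sup>2) \<partial>M)"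

lemma L2_limit_L2sq: "L2_limit M w u \<longleftrightarrow> (\<lambda>k. L2sq M (\<lambda>x. w k x - u x)) \<longlonglongrightarrow> 0"
  by (simp add: L2_limit_def L2sq_def)

lemma L2_iff:
  "f \<in> L2 M \<longleftrightarrow> f \<in> borel_measurable M \<and> L2sq M f < \<infinity>"
  by (auto simp: L2_def L2sq_def integrable_iff_bounded)

lemma L2_measurable: "f \<in> L2 M \<Longrightarrow> f \<in> borel_measurable M"
  by (simp add: L2_def)

lemma L2_integrable: "f \<in> L2 M \<Longrightarrow> integrable M (\<lambda>x. (norm (f x))\<^sup>2)"
  by (simp add: L2_def)

lemma L2sq_eq: "f \<in> L2 M \<Longrightarrow> L2sq M f = ennreal (LINT x|M. (norm (f x))\<^sup>2)"
  unfolding L2sq_def by (intro nn_integral_eq_integral) (auto simp: L2_def)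

lemma norm_add_sq_le:
  fixes a b :: "'b::real_normed_vector"
  shows "(norm (a + b))\<^sup>2 \<le> 2 * (norm a)\<^sup>2 + 2 * (norm b)\<^sup>2"
proof -
  have "(norm (a + b))\<^sup>2 \<le> (norm a + norm b)\<^sup>2"
    by (intro power_mono norm_triangle_ineq) auto
  also have "\<dots> \<le> 2 * (norm a)\<^sup>2 + 2 * (norm b)\<^sup>2"
    using zero_le_power2[of "norm a - norm b"] by (simp add: power2_eq_square algebra_simps)
  finally show ?thesis .
qed

lemma L2sq_add_le:
  assumes [measurable]: "f \<in> borel_measurable M" "g \<in> borel_measurable M"
  shows "L2sq M (\<lambda>x. f x + g x) \<le> 2 * L2sq M f + 2 * L2sq M g"
proof -
  have "L2sq M (\<lambda>x. f x + g x) \<le>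
      (\<integral>\<^sup>+x. 2 * ennreal ((norm (f x))\<^sup>2) + 2 * ennreal ((norm (g x))\<^sup>2) \<partial>M)"
    unfolding L2sq_def
  proof (intro nn_integral_mono)
    fix x
    have "ennreal ((norm (f x + g x))\<^sup>2) \<le> ennreal (2 * (norm (f x))\<^sup>2 + 2 * (norm (g x))\<^sup>2)"
      by (intro ennreal_leI norm_add_sq_le)
    also have "\<dots> = 2 * ennreal ((norm (f x))\<^sup>2) + 2 * ennreal ((norm (g x))\<^sup>2)"
      by (simp add: ennreal_plus ennreal_mult)
    finally show "ennreal ((norm (f x + g x))\<^sup>2) \<le>
      2 * ennreal ((norm (f x))\<^sup>2) + 2 * ennreal ((norm (g x))\<^sup>2)" .
  qed
  also have "\<dots> = 2 * L2sq M f + 2 * L2sq M g"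
    unfolding L2sq_def by (subst nn_integral_add) (auto simp: nn_integral_cmult)
  finally show ?thesis .
qed

lemma L2sq_scaleR:
  assumes [measurable]: "f \<in> borel_measurable M"
  shows "L2sq M (\<lambda>x. a *\<^sub>R f x) = ennreal (a\<^sup>2) * L2sq M f"
  unfolding L2sq_def
  by (subst nn_integral_cmult[symmetric]) (auto simp: power_mult_distrib ennreal_mult)

lemma L2sq_minus_commute: "L2sq M (\<lambda>x. f x - g x) = L2sq M (\<lambda>x. g x - f x)"
  by (simp add: L2sq_def norm_minus_commute)

lemma L2sq_triangle:
  assumes "f \<in> borel_measurable M" "g \<in> borel_measurable M" "h \<in> borel_measurable M"
  shows "L2sq M (\<lambda>x. f x - h x) \<le> 2 * L2sq M (\<lambda>x. f x - g x) + 2 * L2sq M (\<lambda>x. g x - h x)"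
  using L2sq_add_le[of "\<lambda>x. f x - g x" M "\<lambda>x. g x - h x"] assms by simp

lemma L2_lincomb:
  assumes "f \<in> L2 M" "g \<in> L2 M"
  shows "(\<lambda>x. a *\<^sub>R f x + b *\<^sub>R g x) \<in> L2 M"
proof -
  have [measurable]: "f \<in> borel_measurable M" "g \<in> borel_measurable M"
    using assms by (auto simp: L2_measurable)
  have "L2sq M (\<lambda>x. a *\<^sub>R f x + b *\<^sub>R g x) \<le>
      2 * (ennreal (a\<^sup>2) * L2sq M f) + 2 * (ennreal (b\<^sup>2) * L2sq M g)"
    using L2sq_add_le[of "\<lambda>x. a *\<^sub>R f x" M "\<lambda>x. b *\<^sub>R g x"] by (simp add: L2sq_scaleR)
  also have "\<dots> < \<infinity>"
    using assms by (auto simp: L2_iff ennreal_mult_less_top)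
  finally show ?thesis by (simp add: L2_iff)
qed

lemma L2_scaleR: "f \<in> L2 M \<Longrightarrow> (\<lambda>x. a *\<^sub>R f x) \<in> L2 M"
  using L2_lincomb[of f M f a 0] by simp

lemma L2_diff: "f \<in> L2 M \<Longrightarrow> g \<in> L2 M \<Longrightarrow> (\<lambda>x. f x - g x) \<in> L2 M"
  using L2_lincomb[of f M g 1 "-1"] by simp

lemma mult_le_half_sq: "(r::real) * s \<le> (r\<^sup>2 + s\<^sup>2) / 2"
  using zero_le_power2[of "r - s"] by (simp add: power2_eq_square algebra_simps)

lemma L2_mult_integrable:
  assumes "f \<in> L2 M" "g \<in> L2 M"
  shows "integrable M (\<lambda>x. norm (f x) * norm (g x))"
proof (rule Bochner_Integration.integrable_bound)
  show "integrable M (\<lambda>x. ((norm (f x))\<^sup>2 + (norm (g x))\<^sup>2) / 2)"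
    using assms by (auto simp: L2_def)
  show "(\<lambda>x. norm (f x) * norm (g x)) \<in> borel_measurable M"
    using assms by (auto simp: L2_def)
  show "AE x in M. norm (norm (f x) * norm (g x)) \<le> norm (((norm (f x))\<^sup>2 + (norm (g x))\<^sup>2) / 2)"
    by (intro AE_I2) (use mult_le_half_sq in \<open>auto simp: abs_mult\<close>)
qed

lemma L2_inner_integrable:
  assumes "f \<in> L2 M" "g \<in> L2 M"
  shows "integrable M (\<lambda>x. f x \<bullet> g x)"
proof (rule Bochner_Integration.integrable_bound[OF L2_mult_integrable[OF assms]])
  show "(\<lambda>x. f x \<bullet> g x) \<in> borel_measurable M"
    using assms by (auto simp: L2_def)
qed (use Cauchy_Schwarz_ineq2 in auto)

lemma L2_real_mult_integrable:
  fixes f g :: "'a \<Rightarrow> real"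
  assumes "f \<in> L2 M" "g \<in> L2 M"
  shows "integrable M (\<lambda>x. f x * g x)"
  using L2_inner_integrable[OF assms] by simp

lemma L2_limit_integral:
  assumes "L2_limit M w u" "\<And>k. w k \<in> L2 M" "u \<in> L2 M"
  shows "(\<lambda>k. LINT x|M. (norm (w k x - u x))\<^sup>2) \<longlonglongrightarrow> 0"
proof -
  have "(\<lambda>k. ennreal (LINT x|M. (norm (w k x - u x))\<^sup>2)) \<longlonglongrightarrow> ennreal 0"
    using assms(1) L2sq_eq[OF L2_diff[OF assms(2,3)]] by (simp add: L2_limit_L2sq)
  then show ?thesis
    by (subst (asm) tendsto_ennreal_iff) auto
qed

context finite_measure
begin

lemma L2_bounded:
  assumes [measurable]: "f \<in> borel_measurable M" and "\<And>x. x \<in> space M \<Longrightarrow> norm (f x) \<le> B"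
  shows "f \<in> L2 M"
  unfolding L2_def
  by (auto intro!: integrable_const_bound[of _ "B\<^sup>2"] AE_I2 power_mono assms)

lemma L2_imp_integrable:
  assumes "f \<in> L2 M"
  shows "integrable M f"
proof (rule Bochner_Integration.integrable_bound)
  show "integrable M (\<lambda>x. 1 + (norm (f x))\<^sup>2)"
    using L2_integrable[OF assms] by auto
  have "r \<le> 1 + r\<^sup>2" for r :: real
    using zero_le_power2[of "r - 1 / 2"] by (simp add: power2_eq_square algebra_simps)
  then show "AE x in M. norm (f x) \<le> norm (1 + (norm (f x))\<^sup>2)"
    by (intro AE_I2) (auto intro: order_trans[OF _ abs_ge_self])
qed (use assms L2_measurable in auto)

text \<open>
  The bound \<open>|a| \<le> 2\<^sup>-\<^sup>j + 2\<^sup>j |a|\<^sup>2\<close> makes a rapidly convergent subsequence summable in \<open>L\<^sup>1\<close>, hence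
  convergent almost everywhere; Fatou's lemma identifies the limit in \<open>L\<^sup>2\<close>.
\<close>

lemma L2_complete:
  fixes f :: "nat \<Rightarrow> 'a \<Rightarrow> 'b::euclidean_space"
  assumes f: "\<And>k. f k \<in> L2 M"
    and Cauchy: "\<And>e::real. 0 < e \<Longrightarrow> \<exists>N. \<forall>k\<ge>N. \<forall>l\<ge>N. L2sq M (\<lambda>x. f k x - f l x) < ennreal e"
  shows "\<exists>g\<in>L2 M. L2_limit M f g"
proof -
  have [measurable]: "f k \<in> borel_measurable M" for k
    using f by (simp add: L2_measurable)
  have "\<forall>j. \<exists>N. \<forall>k\<ge>N. \<forall>l\<ge>N. L2sq M (\<lambda>x. f k x - f l x) < ennreal ((1/4)^j)"
    using Cauchy by simp
  then obtain N0 where N0: "\<And>j k l. N0 j \<le> k \<Longrightarrow> N0 j \<le> l \<Longrightarrow>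
      L2sq M (\<lambda>x. f k x - f l x) < ennreal ((1/4)^j)"
    by metis
  define N where "N j = (\<Sum>i\<le>j. N0 i) + j" for j
  have N0_le: "N0 j \<le> N j" for j
    unfolding N_def by (simp add: member_le_sum trans_le_add1)
  have N_mono: "N i \<le> N j" if "i \<le> j" for i j
    unfolding N_def using that by (intro add_mono sum_mono2) auto
  have j_le: "j \<le> N j" for j by (simp add: N_def)
  have N: "L2sq M (\<lambda>x. f k x - f l x) < ennreal ((1/4)^j)" if "N j \<le> k" "N j \<le> l" for j k l
    using that N0 N0_le order_trans by blast
  define h where "h j = f (N j)" for j
  have [measurable]: "h j \<in> borel_measurable M" for j by (simp add: h_def)
  have step: "(\<integral>\<^sup>+x. ennreal (norm (h (Suc j) x - h j x)) \<partial>M) \<le>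
      ennreal ((measure M (space M) + 1) * (1/2)^j)" for j
  proof -
    have pt: "r \<le> (1/2)^j + 2^j * r\<^sup>2" if "0 \<le> r" for r :: real
    proof (cases "r \<le> (1/2)^j")
      case False
      then have "1 * r \<le> (2^j * r) * r"
        using that by (intro mult_right_mono) (auto simp: field_simps)
      then show ?thesis by (simp add: power2_eq_square add_increasing)
    qed (simp add: add_increasing2)
    have "(\<integral>\<^sup>+x. ennreal (norm (h (Suc j) x - h j x)) \<partial>M) \<le>
        (\<integral>\<^sup>+x. ennreal ((1/2)^j) + ennreal (2^j) * ennreal ((norm (h (Suc j) x - h j x))\<^sup>2) \<partial>M)"
    proof (intro nn_integral_mono)
      fix x
      have "ennreal (norm (h (Suc j) x - h j x)) \<le>
          ennreal ((1/2)^j + 2^j * (norm (h (Suc j) x - h j x))\<^sup>2)"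
        by (intro ennreal_leI pt) auto
      then show "ennreal (norm (h (Suc j) x - h j x)) \<le>
          ennreal ((1/2)^j) + ennreal (2^j) * ennreal ((norm (h (Suc j) x - h j x))\<^sup>2)"
        by (simp add: ennreal_plus ennreal_mult)
    qed
    also have "\<dots> = ennreal ((1/2)^j) * emeasure M (space M) +
        ennreal (2^j) * L2sq M (\<lambda>x. h (Suc j) x - h j x)"
      unfolding L2sq_def by (subst nn_integral_add) (auto simp: nn_integral_cmult)
    also have "\<dots> \<le> ennreal ((1/2)^j) * ennreal (measure M (space M)) +
        ennreal (2^j) * ennreal ((1/4)^j)"
      using N[of j "N (Suc j)" "N j"] N_mono[of j "Suc j"]
      by (intro add_mono mult_left_mono) (auto simp: emeasure_eq_measure h_def)
    also have "\<dots> = ennreal ((1/2)^j * measure M (space M) + 2^j * (1/4)^j)"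
      by (simp add: ennreal_plus ennreal_mult)
    also have "(2::real)^j * (1/4)^j = (1/2)^j"
      by (simp flip: power_mult_distrib)
    finally show ?thesis by (simp add: algebra_simps)
  qed
  have "(\<integral>\<^sup>+x. (\<Sum>j. ennreal (norm (h (Suc j) x - h j x))) \<partial>M) =
      (\<Sum>j. \<integral>\<^sup>+x. ennreal (norm (h (Suc j) x - h j x)) \<partial>M)"
    by (intro nn_integral_suminf) auto
  also have "\<dots> \<le> (\<Sum>j. ennreal ((measure M (space M) + 1) * (1/2)^j))"
    by (intro suminf_le step) auto
  also have "\<dots> < \<infinity>"
    by (subst suminf_ennreal2) (auto intro!: summable_mult)
  finally have "AE x in M. (\<Sum>j. ennreal (norm (h (Suc j) x - h j x))) \<noteq> \<infinity>"
    by (intro nn_integral_noteq_infinite) auto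
  then have conv: "AE x in M. convergent (\<lambda>j. h j x)"
  proof eventually_elim
    case (elim x)
    then have "summable (\<lambda>j. norm (h (Suc j) x - h j x))"
      by (intro summable_suminf_not_top) auto
    then have "summable (\<lambda>j. h (Suc j) x - h j x)"
      by (rule summable_norm_cancel)
    then have "convergent (\<lambda>n. \<Sum>j<n. h (Suc j) x - h j x)"
      by (simp add: summable_iff_convergent)
    then have "convergent (\<lambda>n. h n x - h 0 x)"
      by (simp only: sum_lessThan_telescope[of "\<lambda>j. h j x"])
    then have "convergent (\<lambda>n. h n x - h 0 x + h 0 x)"
      by (rule convergent_add[OF _ convergent_const])
    then show ?case by simp
  qed
  define g where "g x = lim (\<lambda>j. h j x)" for x
  have [measurable]: "g \<in> borel_measurable M"
    unfolding g_def by (rule borel_measurable_lim_metric) simp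
  have near: "L2sq M (\<lambda>x. f k x - g x) \<le> ennreal ((1/4)^j)" if "N j \<le> k" for j k
  proof -
    have "AE x in M. ennreal ((norm (f k x - g x))\<^sup>2) =
        liminf (\<lambda>i. ennreal ((norm (f k x - h i x))\<^sup>2))"
      using conv
    proof eventually_elim
      case (elim x)
      then have "(\<lambda>i. h i x) \<longlonglongrightarrow> g x"
        by (simp add: g_def convergent_LIMSEQ_iff)
      then have "(\<lambda>i. ennreal ((norm (f k x - h i x))\<^sup>2)) \<longlonglongrightarrow> ennreal ((norm (f k x - g x))\<^sup>2)"
        by (intro tendsto_ennrealI tendsto_intros)
      from lim_imp_Liminf[OF sequentially_bot this] show ?case by simp
    qed
    then have "L2sq M (\<lambda>x. f k x - g x) =
        (\<integral>\<^sup>+x. liminf (\<lambda>i. ennreal ((norm (f k x - h i x))\<^sup>2)) \<partial>M)"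
      unfolding L2sq_def by (rule nn_integral_cong_AE)
    also have "\<dots> \<le> liminf (\<lambda>i. L2sq M (\<lambda>x. f k x - h i x))"
      unfolding L2sq_def by (rule nn_integral_liminf) simp
    also have "\<dots> \<le> limsup (\<lambda>i. L2sq M (\<lambda>x. f k x - h i x))"
      by (intro Liminf_le_Limsup) simp
    also have "\<dots> \<le> ennreal ((1/4)^j)"
    proof (rule Limsup_bounded, rule eventually_sequentiallyI)
      fix i assume "j \<le> i"
      then show "L2sq M (\<lambda>x. f k x - h i x) \<le> ennreal ((1/4)^j)"
        using N[of j k "N i"] that N_mono[of j i] by (simp add: h_def less_imp_le)
    qed
    finally show ?thesis .
  qed
  have "g \<in> L2 M"
  proof -
    have "L2sq M g \<le> 2 * L2sq M (f (N 0)) + 2 * L2sq M (\<lambda>x. g x - f (N 0) x)"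
      using L2sq_add_le[of "f (N 0)" M "\<lambda>x. g x - f (N 0) x"] by simp
    also have "\<dots> < \<infinity>"
      using near[of 0 "N 0"] f[of "N 0"]
      by (auto simp: L2_iff ennreal_mult_less_top L2sq_minus_commute[of M g] intro: le_less_trans)
    finally show ?thesis by (simp add: L2_iff)
  qed
  moreover have "L2_limit M f g"
    unfolding L2_limit_L2sq
  proof (rule order_tendstoI)
    fix e :: ennreal assume "0 < e"
    have "(\<lambda>j. ennreal ((1/4)^j)) \<longlonglongrightarrow> ennreal 0"
      by (intro tendsto_ennrealI LIMSEQ_power_zero) simp
    then have "\<forall>\<^sub>F j in sequentially. ennreal ((1/4)^j) < e"
      using \<open>0 < e\<close> by (intro order_tendstoD(2)) auto
    then obtain j where "ennreal ((1/4)^j) < e"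
      by (metis eventually_at_top_linorder order_refl)
    then show "\<forall>\<^sub>F k in sequentially. L2sq M (\<lambda>x. f k x - g x) < e"
      using near by (intro eventually_sequentiallyI[of "N j"]) (auto intro: le_less_trans)
  qed simp
  ultimately show ?thesis by blast
qed

end

section \<open>Smooth functions and the Sobolev space\<close>

lemma Ck_continuous: "Ck k f \<Longrightarrow> continuous_on UNIV f"
  by (cases k)
    (auto intro!: continuous_at_imp_continuous_on differentiable_imp_continuous_within)

lemma Ck_lincomb:
  "Ck k f \<Longrightarrow> Ck k g \<Longrightarrow> Ck k (\<lambda>x. a * f x + b * g x)"
proof (induction k arbitrary: f g)
  case (Suc k)
  have "frechet_derivative (\<lambda>x. a * f x + b * g x) (at x) v =
      a * frechet_derivative f (at x) v + b * frechet_derivative g (at x) v" for x v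
  proof -
    have "((\<lambda>x. a * f x + b * g x) has_derivative
        (\<lambda>v. a * frechet_derivative f (at x) v + b * frechet_derivative g (at x) v)) (at x)"
      using Suc.prems by (auto intro!: derivative_eq_intros simp: frechet_derivative_works)
    from frechet_derivative_at[OF this] show ?thesis by metis
  qed
  moreover have "(\<lambda>x. a * f x + b * g x) differentiable (at x)" for x
    using Suc.prems by (auto intro!: derivative_intros)
  ultimately show ?case using Suc by simp
qed (auto intro!: continuous_intros)

lemma smooth_differentiable: "smooth f \<Longrightarrow> f differentiable (at x)"
  unfolding smooth_def using Ck.simps(2) by blast

lemma smooth_continuous: "smooth f \<Longrightarrow> continuous_on UNIV f"
  unfolding smooth_def using Ck_continuous by blast

lemma smooth_measurable: "smooth f \<Longrightarrow> f \<in> borel_measurable borel"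
  by (intro borel_measurable_continuous_onI smooth_continuous)

lemma smooth_lincomb: "smooth f \<Longrightarrow> smooth g \<Longrightarrow> smooth (\<lambda>x. a * f x + b * g x)"
  by (simp add: smooth_def Ck_lincomb)

lemma smooth_gradient_continuous:
  assumes "smooth f"
  shows "continuous_on UNIV (gradient f)"
proof -
  have "Ck (Suc 0) f" using assms by (simp add: smooth_def)
  then show ?thesis
    unfolding gradient_def by (auto intro!: continuous_intros)
qed

lemma smooth_gradient_measurable:
  "smooth f \<Longrightarrow> gradient f \<in> borel_measurable borel"
  by (intro borel_measurable_continuous_onI smooth_gradient_continuous)

lemma smooth_has_derivative:
  assumes "smooth f"
  shows "(f has_derivative (\<lambda>v. gradient f x \<bullet> v)) (at x)"
proof -
  have d: "(f has_derivative frechet_derivative f (at x)) (at x)"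
    using smooth_differentiable[OF assms] by (simp add: frechet_derivative_works)
  have "frechet_derivative f (at x) v = gradient f x \<bullet> v" for v
  proof -
    have "frechet_derivative f (at x) v =
        (\<Sum>b\<in>Basis. (v \<bullet> b) *\<^sub>R frechet_derivative f (at x) b)"
      using Linear_Algebra.linear_componentwise[OF has_derivative_linear[OF d], of v 1]
      by simp
    then show ?thesis
      by (simp add: gradient_def inner_sum_left mult.commute inner_commute[of v])
  qed
  then show ?thesis using d by presburger
qed

lemma smooth_gradient_lincomb:
  assumes "smooth f" "smooth g"
  shows "gradient (\<lambda>x. a * f x + b * g x) x = a *\<^sub>R gradient f x + b *\<^sub>R gradient g x"
proof -
  have "((\<lambda>x. a * f x + b * g x) has_derivative
      (\<lambda>v. a * (gradient f x \<bullet> v) + b * (gradient g x \<bullet> v))) (at x)"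
    by (auto intro!: derivative_eq_intros smooth_has_derivative assms)
  from has_derivative_unique[OF this smooth_has_derivative[OF smooth_lincomb[OF assms]]]
  have "gradient (\<lambda>x. a * f x + b * g x) x \<bullet> v = (a *\<^sub>R gradient f x + b *\<^sub>R gradient g x) \<bullet> v" for v
    by (simp add: inner_add_left fun_eq_iff)
  then show ?thesis using vector_eq_rdot by blast
qed

lemma compact_support_bounded:
  fixes f :: "'a::euclidean_space \<Rightarrow> 'b::real_normed_vector"
  assumes "continuous_on UNIV f" "compact S" "\<And>x. x \<notin> S \<Longrightarrow> f x = 0"
  shows "\<exists>B. \<forall>x. norm (f x) \<le> B"
proof -
  have "bounded (f ` S)"
    using assms by (intro compact_imp_bounded compact_continuous_image) (auto intro: continuous_on_subset)
  then obtain B where "\<And>x. x \<in> S \<Longrightarrow> norm (f x) \<le> B"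
    by (auto simp: bounded_iff)
  then have "norm (f x) \<le> max B 0" for x
    by (cases "x \<in> S") (use assms(3) in force)+
  then show ?thesis by blast
qed

lemma test_function_bounded:
  assumes "test_function \<Omega> \<phi>"
  shows "\<exists>B. \<forall>x. norm (\<phi> x) \<le> B" "\<exists>B. \<forall>x. norm (gradient \<phi> x) \<le> B"
proof -
  let ?S = "closure {x. \<phi> x \<noteq> 0}"
  have S: "compact ?S" "smooth \<phi>" using assms by (auto simp: test_function_def)
  have out: "\<phi> x = 0" if "x \<notin> ?S" for x
    using that subsetD[OF closure_subset, of x "{x. \<phi> x \<noteq> 0}"] by blast
  show "\<exists>B. \<forall>x. norm (\<phi> x) \<le> B"
    by (rule compact_support_bounded[OF smooth_continuous[OF S(2)] S(1) out])
  have "gradient \<phi> x = 0" if "x \<notin> ?S" for x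
  proof -
    have "(\<phi> has_derivative (\<lambda>_. 0)) (at x)"
    proof (rule has_derivative_transform_within_open[where f = "\<lambda>_. 0" and s = "- ?S"])
      show "0 = \<phi> y" if "y \<in> - ?S" for y using out[of y] that by simp
    qed (use that in auto)
    from has_derivative_unique[OF this smooth_has_derivative[OF S(2)]]
    have "gradient \<phi> x \<bullet> gradient \<phi> x = 0" by (metis (full_types))
    then show ?thesis by simp
  qed
  then show "\<exists>B. \<forall>x. norm (gradient \<phi> x) \<le> B"
    by (intro compact_support_bounded[OF smooth_gradient_continuous[OF S(2)] S(1)])
qed

lemma finite_lebesgue_on:
  fixes \<Omega> :: "'a::euclidean_space set"
  assumes "open \<Omega>" "bounded \<Omega>"
  shows "finite_measure (lebesgue_on \<Omega>)"
  using assms by (intro finite_measure_lebesgue_on) (simp add: lmeasurable_open)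

lemma borel_measurable_lebesgue_on:
  "f \<in> borel_measurable borel \<Longrightarrow> f \<in> borel_measurable (lebesgue_on \<Omega>)"
  by (intro measurable_restrict_space1 measurable_completion) simp

lemma sets_hausdorff_measure: "sets (hausdorff_measure k) = sets borel"
  unfolding hausdorff_measure_def using sigma_algebra.sets_measure_of_eq[OF sets.sigma_algebra_axioms]
  by (metis sigma_algebra.sets_measure_of_eq sets.sigma_algebra_axioms space_borel)

lemma borel_measurable_surface_measure:
  "f \<in> borel_measurable borel \<Longrightarrow> f \<in> borel_measurable (surface_measure \<Omega>)"
  unfolding surface_measure_def
  by (intro measurable_restrict_space1) (simp add: measurable_cong_sets[OF sets_hausdorff_measure refl])

lemmas smooth_measurable_on =
  smooth_measurable[THEN borel_measurable_lebesgue_on]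
  smooth_measurable[THEN borel_measurable_surface_measure]
  smooth_gradient_measurable[THEN borel_measurable_lebesgue_on]

lemma L2_limit_lincomb:
  assumes "L2_limit M w u" "L2_limit M w' u'"
    and [measurable]: "\<And>k. w k \<in> borel_measurable M" "\<And>k. w' k \<in> borel_measurable M"
      "u \<in> borel_measurable M" "u' \<in> borel_measurable M"
  shows "L2_limit M (\<lambda>k x. a *\<^sub>R w k x + b *\<^sub>R w' k x) (\<lambda>x. a *\<^sub>R u x + b *\<^sub>R u' x)"
  unfolding L2_limit_L2sq
proof (rule tendsto_sandwich[where f = "\<lambda>_. 0"])
  let ?B = "\<lambda>k. 2 * (ennreal (a\<^sup>2) * L2sq M (\<lambda>x. w k x - u x)) +
      2 * (ennreal (b\<^sup>2) * L2sq M (\<lambda>x. w' k x - u' x))"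
  have "L2sq M (\<lambda>x. a *\<^sub>R w k x + b *\<^sub>R w' k x - (a *\<^sub>R u x + b *\<^sub>R u' x)) \<le> ?B k" for k
    using L2sq_add_le[of "\<lambda>x. a *\<^sub>R (w k x - u x)" M "\<lambda>x. b *\<^sub>R (w' k x - u' x)"]
    by (simp add: L2sq_scaleR) (simp add: algebra_simps)
  then show "\<forall>\<^sub>F k in sequentially.
      L2sq M (\<lambda>x. a *\<^sub>R w k x + b *\<^sub>R w' k x - (a *\<^sub>R u x + b *\<^sub>R u' x)) \<le> ?B k"
    by simp
  have "?B \<longlonglongrightarrow> 2 * (ennreal (a\<^sup>2) * 0) + 2 * (ennreal (b\<^sup>2) * 0)"
    using assms(1,2) unfolding L2_limit_L2sq
    by (intro tendsto_add ennreal_tendsto_cmult) auto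
  then show "?B \<longlonglongrightarrow> 0" by simp
qed auto

lemma weak_gradient_integrable:
  fixes \<Omega> :: "'a::euclidean_space set"
  assumes "open \<Omega>" "bounded \<Omega>" "u \<in> L2 (lebesgue_on \<Omega>)" "G \<in> L2 (lebesgue_on \<Omega>)"
    and \<phi>: "test_function \<Omega> \<phi>"
  shows "integrable (lebesgue_on \<Omega>) (\<lambda>x. u x *\<^sub>R gradient \<phi> x)"
    "integrable (lebesgue_on \<Omega>) (\<lambda>x. \<phi> x *\<^sub>R G x)"
proof -
  interpret finite_measure "lebesgue_on \<Omega>"
    using assms by (intro finite_lebesgue_on)
  have "smooth \<phi>"
    using \<phi> by (simp add: test_function_def)
  note [measurable] = smooth_measurable_on[OF this]
  have [measurable]: "u \<in> borel_measurable (lebesgue_on \<Omega>)"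
      "G \<in> borel_measurable (lebesgue_on \<Omega>)"
    using assms by (auto simp: test_function_def L2_measurable)
  obtain B B' where B: "\<And>x. norm (\<phi> x) \<le> B" and B': "\<And>x. norm (gradient \<phi> x) \<le> B'"
    using test_function_bounded[OF \<phi>] by blast
  show "integrable (lebesgue_on \<Omega>) (\<lambda>x. u x *\<^sub>R gradient \<phi> x)"
  proof (rule Bochner_Integration.integrable_bound)
    show "integrable (lebesgue_on \<Omega>) (\<lambda>x. B' * u x)"
      using L2_imp_integrable[OF assms(3)] by auto
    have "\<bar>u x\<bar> * norm (gradient \<phi> x) \<le> \<bar>B'\<bar> * \<bar>u x\<bar>" for x
      using mult_left_mono[OF order_trans[OF B'[of x] abs_ge_self], of "\<bar>u x\<bar>"] by (simp add: mult.commute)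
    then show "AE x in lebesgue_on \<Omega>. norm (u x *\<^sub>R gradient \<phi> x) \<le> norm (B' * u x)"
      by (simp add: abs_mult)
  qed measurable
  show "integrable (lebesgue_on \<Omega>) (\<lambda>x. \<phi> x *\<^sub>R G x)"
  proof (rule Bochner_Integration.integrable_bound)
    show "integrable (lebesgue_on \<Omega>) (\<lambda>x. B *\<^sub>R G x)"
      using L2_imp_integrable[OF assms(4)] by auto
    have "\<bar>\<phi> x\<bar> * norm (G x) \<le> \<bar>B\<bar> * norm (G x)" for x
      using mult_right_mono[OF order_trans[OF B[of x] abs_ge_self], of "norm (G x)"] by simp
    then show "AE x in lebesgue_on \<Omega>. norm (\<phi> x *\<^sub>R G x) \<le> norm (B *\<^sub>R G x)"
      by simp
  qed measurable
qed

lemma H1_lincomb: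
  fixes \<Omega> :: "'a::euclidean_space set"
  assumes \<Omega>: "open \<Omega>" "bounded \<Omega>" and u: "(u, G) \<in> H1 \<Omega>" and v: "(v, W) \<in> H1 \<Omega>"
  shows "(\<lambda>x. a * u x + b * v x, \<lambda>x. a *\<^sub>R G x + b *\<^sub>R W x) \<in> H1 \<Omega>"
proof -
  have L2: "u \<in> L2 (lebesgue_on \<Omega>)" "G \<in> L2 (lebesgue_on \<Omega>)"
      "v \<in> L2 (lebesgue_on \<Omega>)" "W \<in> L2 (lebesgue_on \<Omega>)"
    and wg: "weak_gradient \<Omega> u G" "weak_gradient \<Omega> v W"
    using u v by (auto simp: H1_def)
  have "weak_gradient \<Omega> (\<lambda>x. a * u x + b * v x) (\<lambda>x. a *\<^sub>R G x + b *\<^sub>R W x)"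
    unfolding weak_gradient_def
  proof (intro allI impI)
    fix \<phi> assume \<phi>: "test_function \<Omega> \<phi>"
    note i = weak_gradient_integrable[OF \<Omega> L2(1,2) \<phi>] weak_gradient_integrable[OF \<Omega> L2(3,4) \<phi>]
    have lin: "(a * u x + b * v x) *\<^sub>R gradient \<phi> x =
        a *\<^sub>R (u x *\<^sub>R gradient \<phi> x) + b *\<^sub>R (v x *\<^sub>R gradient \<phi> x)"
      "\<phi> x *\<^sub>R (a *\<^sub>R G x + b *\<^sub>R W x) = a *\<^sub>R (\<phi> x *\<^sub>R G x) + b *\<^sub>R (\<phi> x *\<^sub>R W x)" for x
      by (simp_all add: algebra_simps)
    have "(LINT x|lebesgue_on \<Omega>. (a * u x + b * v x) *\<^sub>R gradient \<phi> x) =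
        a *\<^sub>R (LINT x|lebesgue_on \<Omega>. u x *\<^sub>R gradient \<phi> x) +
        b *\<^sub>R (LINT x|lebesgue_on \<Omega>. v x *\<^sub>R gradient \<phi> x)"
      unfolding lin
      by (subst Bochner_Integration.integral_add)
        (auto intro!: integrable_scaleR_right i simp del: scaleR_scaleR)
    also have "\<dots> = - (a *\<^sub>R (LINT x|lebesgue_on \<Omega>. \<phi> x *\<^sub>R G x) +
        b *\<^sub>R (LINT x|lebesgue_on \<Omega>. \<phi> x *\<^sub>R W x))"
      using wg \<phi> by (simp add: weak_gradient_def)
    also have "a *\<^sub>R (LINT x|lebesgue_on \<Omega>. \<phi> x *\<^sub>R G x) +
        b *\<^sub>R (LINT x|lebesgue_on \<Omega>. \<phi> x *\<^sub>R W x) =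
        (LINT x|lebesgue_on \<Omega>. \<phi> x *\<^sub>R (a *\<^sub>R G x + b *\<^sub>R W x))"
      unfolding lin
      by (subst Bochner_Integration.integral_add)
        (auto intro!: integrable_scaleR_right i simp del: scaleR_scaleR)
    finally show "(LINT x|lebesgue_on \<Omega>. (a * u x + b * v x) *\<^sub>R gradient \<phi> x) =
        - (LINT x|lebesgue_on \<Omega>. \<phi> x *\<^sub>R (a *\<^sub>R G x + b *\<^sub>R W x))" .
  qed
  then show ?thesis
    using L2_lincomb[OF L2(1,3), of a b] L2_lincomb[OF L2(2,4), of a b] by (simp add: H1_def)
qed

lemma has_trace_H1: "has_trace \<Omega> u G g \<Longrightarrow> (u, G) \<in> H1 \<Omega>"
  by (simp add: has_trace_def)

lemma has_trace_L2:
  assumes "has_trace \<Omega> u G g"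
  shows "u \<in> L2 (lebesgue_on \<Omega>)" "G \<in> L2 (lebesgue_on \<Omega>)" "g \<in> L2 (surface_measure \<Omega>)"
  using assms by (auto simp: has_trace_def H1_def)

lemma has_trace_lincomb:
  fixes \<Omega> :: "'a::euclidean_space set"
  assumes \<Omega>: "open \<Omega>" "bounded \<Omega>" and u: "has_trace \<Omega> u G g" and v: "has_trace \<Omega> v W h"
  shows "has_trace \<Omega> (\<lambda>x. a * u x + b * v x) (\<lambda>x. a *\<^sub>R G x + b *\<^sub>R W x) (\<lambda>x. a * g x + b * h x)"
proof -
  let ?M = "lebesgue_on \<Omega>" and ?S = "surface_measure \<Omega>"
  note [measurable] = has_trace_L2[OF u, THEN L2_measurable] has_trace_L2[OF v, THEN L2_measurable]
  obtain w where sw: "\<And>k. smooth (w k)"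
    and w: "L2_limit ?M w u" "L2_limit ?M (\<lambda>k. gradient (w k)) G" "L2_limit ?S w g"
    using u by (auto simp: has_trace_def)
  obtain z where sz: "\<And>k. smooth (z k)"
    and z: "L2_limit ?M z v" "L2_limit ?M (\<lambda>k. gradient (z k)) W" "L2_limit ?S z h"
    using v by (auto simp: has_trace_def)
  note [measurable] = smooth_measurable_on[OF sw] smooth_measurable_on[OF sz]
  let ?y = "\<lambda>k x. a * w k x + b * z k x"
  have "L2_limit ?M ?y (\<lambda>x. a * u x + b * v x)"
    using L2_limit_lincomb[OF w(1) z(1), of a b] by simp
  moreover have "L2_limit ?S ?y (\<lambda>x. a * g x + b * h x)"
    using L2_limit_lincomb[OF w(3) z(3), of a b] by simp
  moreover have "gradient (?y k) = (\<lambda>x. a *\<^sub>R gradient (w k) x + b *\<^sub>R gradient (z k) x)" for k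
    using smooth_gradient_lincomb[OF sw sz] by (rule ext)
  then have "L2_limit ?M (\<lambda>k. gradient (?y k)) (\<lambda>x. a *\<^sub>R G x + b *\<^sub>R W x)"
    using L2_limit_lincomb[OF w(2) z(2), of a b]
    by simp
  moreover have "smooth (?y k)" for k
    by (intro smooth_lincomb sw sz)
  moreover have "(\<lambda>x. a * g x + b * h x) \<in> L2 ?S"
    using L2_lincomb[OF has_trace_L2(3)[OF u] has_trace_L2(3)[OF v], of a b] by simp
  ultimately show ?thesis
    unfolding has_trace_def
    using H1_lincomb[OF \<Omega> u[THEN has_trace_H1] v[THEN has_trace_H1], of a b]
    by (intro conjI exI[of _ ?y]) auto
qed

section \<open>Friedrichs' inequality\<close>

definition exit_time :: "'a::euclidean_space set \<Rightarrow> 'a \<Rightarrow> 'a \<Rightarrow> real" where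
  "exit_time \<Omega> e x = Inf {t. 0 \<le> t \<and> x + t *\<^sub>R e \<notin> \<Omega>}"

definition exit_point :: "'a::euclidean_space set \<Rightarrow> 'a \<Rightarrow> 'a \<Rightarrow> 'a" where
  "exit_point \<Omega> e x = x + exit_time \<Omega> e x *\<^sub>R e"

lemma nn_integral_lebesgue_on_borel:
  fixes f :: "'a::euclidean_space \<Rightarrow> ennreal"
  assumes "open \<Omega>" "f \<in> borel_measurable borel"
  shows "(\<integral>\<^sup>+x. f x \<partial>lebesgue_on \<Omega>) = (\<integral>\<^sup>+x. f x * indicator \<Omega> x \<partial>lborel)"
  using assms by (simp add: nn_integral_restrict_space nn_integral_completion)

lemma nn_integral_lborel_shift:
  fixes f :: "'a::euclidean_space \<Rightarrow> ennreal"
  assumes "f \<in> borel_measurable borel"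
  shows "(\<integral>\<^sup>+x. f (x + c) \<partial>lborel) = (\<integral>\<^sup>+x. f x \<partial>lborel)"
proof -
  have "(\<integral>\<^sup>+x. f x \<partial>lborel) = (\<integral>\<^sup>+x. f x \<partial>distr lborel borel ((+) c))"
    by (simp add: lborel_distr_plus)
  also have "\<dots> = (\<integral>\<^sup>+x. f (c + x) \<partial>lborel)"
    using assms by (intro nn_integral_distr) auto
  finally show ?thesis by (simp add: add.commute)
qed

lemma integral_square_le:
  fixes g :: "real \<Rightarrow> real"
  assumes "0 < r" "continuous_on {0..r} g"
  shows "(integral {0..r} g)\<^sup>2 \<le> r * integral {0..r} (\<lambda>t. (g t)\<^sup>2)"
proof -
  let ?I = "integral {0..r} g" and ?m = "integral {0..r} g / r"
  have int: "g integrable_on {0..r}" "(\<lambda>t. (g t)\<^sup>2) integrable_on {0..r}"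
    by (intro integrable_continuous_real continuous_intros assms)+
  have "((\<lambda>t. (g t)\<^sup>2 - 2 * ?m * g t + ?m\<^sup>2) has_integral
      (integral {0..r} (\<lambda>t. (g t)\<^sup>2) - 2 * ?m * ?I + (r - 0) *\<^sub>R ?m\<^sup>2)) {0..r}"
    using assms(1) int has_integral_const_real[of "?m\<^sup>2" 0 r]
    by (intro has_integral_add has_integral_diff has_integral_mult_right integrable_integral) auto
  moreover have "0 \<le> (g t)\<^sup>2 - 2 * ?m * g t + ?m\<^sup>2" for t
    using zero_le_power2[of "g t - ?m"] by (simp add: power2_eq_square algebra_simps)
  ultimately have "0 \<le> integral {0..r} (\<lambda>t. (g t)\<^sup>2) - 2 * ?m * ?I + (r - 0) *\<^sub>R ?m\<^sup>2"
    by (rule has_integral_nonneg)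
  also have "\<dots> = integral {0..r} (\<lambda>t. (g t)\<^sup>2) - ?I\<^sup>2 / r"
    using assms(1) by (simp add: field_simps power2_eq_square)
  finally show ?thesis
    using assms(1) by (simp add: field_simps)
qed

context
  fixes \<Omega> :: "'a::euclidean_space set" and e :: 'a and R :: real
  assumes op: "open \<Omega>" and e: "e \<in> Basis" and R: "0 < R"
    and inR: "\<And>x b. x \<in> \<Omega> \<Longrightarrow> b \<in> Basis \<Longrightarrow> \<bar>x \<bullet> b\<bar> \<le> R"
begin

lemma exit:
  assumes "x \<in> \<Omega>"
  shows "0 < exit_time \<Omega> e x" "exit_time \<Omega> e x \<le> 2 * R + 1" "exit_point \<Omega> e x \<in> frontier \<Omega>"
    "\<And>t. 0 \<le> t \<Longrightarrow> t < exit_time \<Omega> e x \<Longrightarrow> x + t *\<^sub>R e \<in> \<Omega>"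
    "exit_time \<Omega> e x \<le> c \<longleftrightarrow> (\<exists>t\<in>{0..c}. x + t *\<^sub>R e \<notin> \<Omega>)"
proof -
  let ?T = "{t. 0 \<le> t \<and> x + t *\<^sub>R e \<notin> \<Omega>}" and ?r = "exit_time \<Omega> e x"
  have "?T = {0..} \<inter> (\<lambda>t. x + t *\<^sub>R e) -` (- \<Omega>)" by auto
  moreover have "closed ((\<lambda>t. x + t *\<^sub>R e) -` (- \<Omega>))"
    using op by (intro closed_vimage continuous_intros) auto
  ultimately have cl: "closed ?T" by auto
  have "(x + (2 * R + 1) *\<^sub>R e) \<bullet> e > R"
    using inR[OF assms e] e by (simp add: inner_add_left)
  then have far: "2 * R + 1 \<in> ?T"
    using inR[of "x + (2 * R + 1) *\<^sub>R e" e] e R by force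
  have bdd: "bdd_below ?T" by (intro bdd_belowI[of _ 0]) auto
  have rT: "?r \<in> ?T"
    unfolding exit_time_def using far by (intro closed_contains_Inf[OF _ bdd cl]) auto
  show pos: "0 < ?r"
    using rT assms by (cases "?r = 0") auto
  show "?r \<le> 2 * R + 1"
    unfolding exit_time_def by (rule cInf_lower[OF far bdd])
  show before: "x + t *\<^sub>R e \<in> \<Omega>" if "0 \<le> t" "t < ?r" for t
    using that cInf_lower[OF _ bdd, of t] unfolding exit_time_def by force
  show "?r \<le> c \<longleftrightarrow> (\<exists>t\<in>{0..c}. x + t *\<^sub>R e \<notin> \<Omega>)"
    using rT before by force
  have "exit_point \<Omega> e x \<in> closure \<Omega>"
    unfolding closure_approachable
  proof (intro allI impI)
    fix d :: real assume "0 < d"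
    let ?t = "max 0 (?r - d / 2)"
    have "dist (x + ?t *\<^sub>R e) (exit_point \<Omega> e x) = \<bar>?t - ?r\<bar>"
      using e by (simp add: exit_point_def dist_norm flip: scaleR_diff_left)
    also have "\<dots> < d" using \<open>0 < d\<close> pos by (auto simp: max_def)
    finally show "\<exists>y\<in>\<Omega>. dist y (exit_point \<Omega> e x) < d"
      using before[of ?t] pos \<open>0 < d\<close> by auto
  qed
  then show "exit_point \<Omega> e x \<in> frontier \<Omega>"
    using rT op by (simp add: frontier_def interior_open exit_point_def)
qed

lemma exit_time_measurable: "exit_time \<Omega> e \<in> borel_measurable (restrict_space borel \<Omega>)"
  unfolding borel_measurable_iff_le
proof
  fix c
  have op': "\<Omega> \<in> sets borel" using op by simp
  have "closed (\<Union>y\<in>- \<Omega>. \<Union>z\<in>(\<lambda>t. t *\<^sub>R e) ` {0..c}. {y - z})"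
    using op by (intro closed_compact_differences compact_continuous_image continuous_intros) auto
  moreover have "{x \<in> \<Omega>. exit_time \<Omega> e x \<le> c} =
      \<Omega> \<inter> (\<Union>y\<in>- \<Omega>. \<Union>z\<in>(\<lambda>t. t *\<^sub>R e) ` {0..c}. {y - z})" (is "?L = ?R")
  proof (intro equalityI subsetI)
    fix x assume "x \<in> ?L"
    then obtain t where "t \<in> {0..c}" "x + t *\<^sub>R e \<notin> \<Omega>" "x \<in> \<Omega>"
      using exit(5) by auto
    then show "x \<in> ?R"
      by (auto intro!: bexI[of _ "x + t *\<^sub>R e"] bexI[of _ t])
  next
    fix x assume "x \<in> ?R"
    then show "x \<in> ?L" using exit(5)[of x c] by force
  qed
  ultimately show "{x \<in> space (restrict_space borel \<Omega>). exit_time \<Omega> e x \<le> c}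
      \<in> sets (restrict_space borel \<Omega>)"
    using op' by (auto simp: sets_restrict_space_iff space_restrict_space)
qed

lemma exit_point_measurable:
  "exit_point \<Omega> e \<in> restrict_space lborel \<Omega> \<rightarrow>\<^sub>M surface_measure \<Omega>"
proof -
  have "exit_point \<Omega> e \<in> restrict_space borel \<Omega> \<rightarrow>\<^sub>M borel"
    unfolding exit_point_def[abs_def]
    by (intro borel_measurable_add borel_measurable_scaleR exit_time_measurable
        borel_measurable_const measurable_restrict_space1) auto
  then have "exit_point \<Omega> e \<in> restrict_space lborel \<Omega> \<rightarrow>\<^sub>M hausdorff_measure (DIM('a) - 1)"
    by (subst measurable_cong_sets[OF _ sets_hausdorff_measure])
      (auto intro!: sets_restrict_space_cong)
  then show ?thesis
    unfolding surface_measure_def using exit(3)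
    by (intro measurable_restrict_space2) (auto simp: space_restrict_space)
qed

text \<open>
  The exit map moves points only in the direction \<open>e\<close>, so the points leaving through a set of
  diameter \<open>d\<close> lie in a box with all other sides \<open>2 d\<close>.
\<close>

lemma emeasure_exit_le:
  obtains c :: real where "0 < c"
    "\<And>B. {x \<in> \<Omega>. exit_point \<Omega> e x \<in> B} \<in> sets borel \<Longrightarrow>
      ennreal c * emeasure lborel {x \<in> \<Omega>. exit_point \<Omega> e x \<in> B} \<le> hausdorff_outer (DIM('a) - 1) B"
proof
  let ?k = "DIM('a) - 1"
  define c where "c = unit_ball_vol (real ?k) / 4 ^ ?k / (2 * R)"
  show "0 < c" using R by (simp add: c_def)
  fix B
  let ?P = "{x \<in> \<Omega>. exit_point \<Omega> e x \<in> B}"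
  assume P: "?P \<in> sets borel"
  have "ennreal c * emeasure lborel ?P \<le> (\<Sum>i. ennreal (unit_ball_vol (real ?k) * (diameter (U i) / 2) ^ ?k))"
    if U: "B \<subseteq> (\<Union>i. U i)" "\<And>i. bounded (U i)" for U :: "nat \<Rightarrow> 'a set"
  proof -
    define u where "u i = (SOME z. z \<in> U i)" for i
    have u: "u i \<in> U i" if "U i \<noteq> {}" for i
      using that unfolding u_def by (metis ex_in_conv someI)
    define lo where "lo i = (\<Sum>b\<in>Basis. (if b = e then - R else u i \<bullet> b - diameter (U i)) *\<^sub>R b)" for i
    define hi where "hi i = (\<Sum>b\<in>Basis. (if b = e then R else u i \<bullet> b + diameter (U i)) *\<^sub>R b)" for i
    define X where "X i = (if U i = {} then {} else cbox (lo i) (hi i))" for i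
    have d0: "0 \<le> diameter (U i)" for i using U(2) by (simp add: diameter_ge_0)
    have Xb: "X i \<in> sets lborel" for i by (simp add: X_def)
    have vol: "ennreal c * emeasure lborel (X i) \<le>
        ennreal (unit_ball_vol (real ?k) * (diameter (U i) / 2) ^ ?k)" for i
    proof (cases "U i = {}")
      case False
      have "emeasure lborel (cbox (lo i) (hi i)) = ennreal (\<Prod>b\<in>Basis. (hi i - lo i) \<bullet> b)"
        using R d0[of i] by (subst emeasure_lborel_cbox_eq) (simp add: lo_def hi_def)
      also have "(\<Prod>b\<in>Basis. (hi i - lo i) \<bullet> b) =
          (hi i - lo i) \<bullet> e * (\<Prod>b\<in>Basis - {e}. (hi i - lo i) \<bullet> b)"
        using e by (simp add: prod.remove)
      also have "(\<Prod>b\<in>Basis - {e}. (hi i - lo i) \<bullet> b) = (\<Prod>b\<in>Basis - {e}. 2 * diameter (U i))"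
        by (intro prod.cong) (auto simp: lo_def hi_def inner_diff_left)
      also have "\<dots> = (2 * diameter (U i)) ^ ?k"
        using e by (simp add: card_Diff_singleton)
      also have "(hi i - lo i) \<bullet> e = 2 * R"
        using e by (simp add: lo_def hi_def inner_diff_left)
      finally have "ennreal c * emeasure lborel (X i) =
          ennreal (c * (2 * R * (2 * diameter (U i)) ^ ?k))"
        using False R \<open>0 < c\<close> d0[of i] by (simp add: X_def ennreal_mult)
      also have "c * (2 * R * (2 * diameter (U i)) ^ ?k) =
          unit_ball_vol (real ?k) * ((2 * diameter (U i)) ^ ?k / 4 ^ ?k)"
        using R by (simp add: c_def)
      also have "(2 * diameter (U i)) ^ ?k / 4 ^ ?k = (diameter (U i) / 2) ^ ?k"
        unfolding power_divide[symmetric] by simp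
      finally show ?thesis by simp
    qed (simp add: X_def)
    have "?P \<subseteq> (\<Union>i. X i)"
    proof
      fix x assume x: "x \<in> ?P"
      then obtain i where i: "exit_point \<Omega> e x \<in> U i" using U by auto
      have "x \<in> cbox (lo i) (hi i)"
        unfolding mem_box
      proof
        fix b :: 'a assume b: "b \<in> Basis"
        show "lo i \<bullet> b \<le> x \<bullet> b \<and> x \<bullet> b \<le> hi i \<bullet> b"
        proof (cases "b = e")
          case True
          then show ?thesis using inR[of x e] x e by (auto simp: lo_def hi_def)
        next
          case False
          have "x \<bullet> b - u i \<bullet> b = (exit_point \<Omega> e x - u i) \<bullet> b"
            using e b False by (simp add: exit_point_def inner_add_left inner_diff_left inner_Basis)
          then have "\<bar>x \<bullet> b - u i \<bullet> b\<bar> \<le> dist (exit_point \<Omega> e x) (u i)"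
            using Basis_le_norm[OF b] by (simp add: dist_norm)
          also have "\<dots> \<le> diameter (U i)"
            using i u U(2) by (intro diameter_bounded_bound) auto
          finally show ?thesis using False b by (auto simp: lo_def hi_def)
        qed
      qed
      then show "x \<in> (\<Union>i. X i)" using i by (auto simp: X_def)
    qed
    then have "emeasure lborel ?P \<le> emeasure lborel (\<Union>i. X i)"
      using Xb by (intro emeasure_mono) auto
    also have "\<dots> \<le> (\<Sum>i. emeasure lborel (X i))"
      using Xb by (intro emeasure_subadditive_countably) auto
    finally have "ennreal c * emeasure lborel ?P \<le> (\<Sum>i. ennreal c * emeasure lborel (X i))"
      by (simp add: ennreal_suminf_cmult mult_left_mono)
    also have "\<dots> \<le> (\<Sum>i. ennreal (unit_ball_vol (real ?k) * (diameter (U i) / 2) ^ ?k))"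
      by (intro suminf_le vol) auto
    finally show ?thesis .
  qed
  then have "ennreal c * emeasure lborel ?P \<le> hausdorff_content ?k 1 B"
    unfolding hausdorff_content_def by (intro INF_greatest) auto
  also have "\<dots> \<le> hausdorff_outer ?k B"
    unfolding hausdorff_outer_def by (intro SUP_upper) auto
  finally show "ennreal c * emeasure lborel ?P \<le> hausdorff_outer ?k B" .
qed

lemma nn_integral_exit_le:
  assumes ms: "measure_space UNIV (sets borel) (hausdorff_outer (DIM('a) - 1) :: 'a set \<Rightarrow> ennreal)"
  obtains c :: real where "0 < c"
    "\<And>f. f \<in> borel_measurable borel \<Longrightarrow>
      ennreal c * (\<integral>\<^sup>+x. f (exit_point \<Omega> e x) \<partial>restrict_space lborel \<Omega>) \<le> (\<integral>\<^sup>+x. f x \<partial>surface_measure \<Omega>)"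
proof -
  obtain c :: real where "0 < c" and c: "\<And>B. {x \<in> \<Omega>. exit_point \<Omega> e x \<in> B} \<in> sets borel \<Longrightarrow>
      ennreal c * emeasure lborel {x \<in> \<Omega>. exit_point \<Omega> e x \<in> B} \<le> hausdorff_outer (DIM('a) - 1) B"
    using emeasure_exit_le by blast
  let ?L = "restrict_space lborel \<Omega>" and ?S = "surface_measure \<Omega>"
  let ?N = "distr ?L ?S (exit_point \<Omega> e)"
  have "emeasure (scale_measure (ennreal c) ?N) B \<le> emeasure ?S B" if B: "B \<in> sets ?S" for B
  proof -
    have fr: "frontier \<Omega> \<in> sets (hausdorff_measure (DIM('a) - 1))"
      by (simp add: sets_hausdorff_measure)
    have B': "B \<subseteq> frontier \<Omega>" "B \<in> sets borel"
      using B fr by (auto simp: surface_measure_def sets_restrict_space_iff sets_hausdorff_measure)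
    have eq: "exit_point \<Omega> e -` B \<inter> space ?L = {x \<in> \<Omega>. exit_point \<Omega> e x \<in> B}"
        "exit_point \<Omega> e -` B \<inter> \<Omega> = {x \<in> \<Omega>. exit_point \<Omega> e x \<in> B}"
      by (auto simp: space_restrict_space)
    have "{x \<in> \<Omega>. exit_point \<Omega> e x \<in> B} \<in> sets ?L"
      using measurable_sets[OF exit_point_measurable B] by (simp only: eq)
    then have P: "{x \<in> \<Omega>. exit_point \<Omega> e x \<in> B} \<in> sets borel"
      using op by (simp add: sets_restrict_space_iff)
    have "emeasure (scale_measure (ennreal c) ?N) B = ennreal c * emeasure lborel {x \<in> \<Omega>. exit_point \<Omega> e x \<in> B}"
      using op B by (simp add: emeasure_distr[OF exit_point_measurable] eq emeasure_restrict_space)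
    also have "\<dots> \<le> hausdorff_outer (DIM('a) - 1) B"
      by (rule c[OF P])
    also have "\<dots> = emeasure (hausdorff_measure (DIM('a) - 1)) B"
      using ms B'(2) sets.sigma_sets_eq[of "borel :: 'a measure"]
      by (simp add: hausdorff_measure_def emeasure_measure_of_conv)
    also have "\<dots> = emeasure ?S B"
      unfolding surface_measure_def using B' fr by (simp add: emeasure_restrict_space)
    finally show ?thesis .
  qed
  then have "emeasure (scale_measure (ennreal c) ?N) \<le> emeasure ?S"
    by (intro le_funI) (metis emeasure_notin_sets order_refl sets_distr sets_scale_measure)
  then have le: "scale_measure (ennreal c) ?N \<le> ?S"
    by (simp add: le_measure_iff space_scale_measure)
  show ?thesis
  proof (rule that[OF \<open>0 < c\<close>])
    fix f :: "'a \<Rightarrow> ennreal" assume "f \<in> borel_measurable borel"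
    then have f: "f \<in> borel_measurable ?S" by (rule borel_measurable_surface_measure)
    have "ennreal c * (\<integral>\<^sup>+x. f (exit_point \<Omega> e x) \<partial>?L) = ennreal c * (\<integral>\<^sup>+x. f x \<partial>?N)"
      using f by (subst nn_integral_distr[OF exit_point_measurable]) auto
    also have "\<dots> = (\<integral>\<^sup>+x. f x \<partial>scale_measure (ennreal c) ?N)"
      using f by (subst nn_integral_scale_measure) auto
    also have "\<dots> \<le> (\<integral>\<^sup>+x. f x \<partial>?S)"
      by (intro nn_integral_mono_measure le) simp
    finally show "ennreal c * (\<integral>\<^sup>+x. f (exit_point \<Omega> e x) \<partial>?L) \<le> (\<integral>\<^sup>+x. f x \<partial>?S)" .
  qed
qed

lemma smooth_line_bound:
  assumes w: "smooth w" and x: "x \<in> \<Omega>"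
  shows "ennreal ((w x)\<^sup>2) \<le> 2 * ennreal ((w (exit_point \<Omega> e x))\<^sup>2) +
    ennreal (2 * (2 * R + 1)) * (\<integral>\<^sup>+t. indicator {0..2 * R + 1} t *
      (ennreal ((norm (gradient w (x + t *\<^sub>R e)))\<^sup>2) * indicator \<Omega> (x + t *\<^sub>R e)) \<partial>lborel)"
proof -
  define r where "r = exit_time \<Omega> e x"
  note r = exit[OF x, folded r_def]
  let ?g = "\<lambda>t. gradient w (x + t *\<^sub>R e) \<bullet> e" and ?n = "\<lambda>t. (norm (gradient w (x + t *\<^sub>R e)))\<^sup>2"
  have cg: "continuous_on S (\<lambda>t. gradient w (x + t *\<^sub>R e))" for S
    by (intro continuous_on_compose2[OF smooth_gradient_continuous[OF w]] continuous_intros) auto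
  have "((\<lambda>t. w (x + t *\<^sub>R e)) has_vector_derivative ?g t) (at t within {0..r})" for t
  proof -
    have "((\<lambda>t. x + t *\<^sub>R e) has_derivative (\<lambda>h. h *\<^sub>R e)) (at t within {0..r})"
      by (auto intro!: derivative_eq_intros)
    from has_derivative_compose[OF this smooth_has_derivative[OF w]]
    show ?thesis by (simp add: has_vector_derivative_def)
  qed
  then have ftc: "(?g has_integral (w (x + r *\<^sub>R e) - w (x + 0 *\<^sub>R e))) {0..r}"
    using r(1) by (intro fundamental_theorem_of_calculus) auto
  have "(w (x + r *\<^sub>R e) - w x)\<^sup>2 \<le> r * integral {0..r} (\<lambda>t. (?g t)\<^sup>2)"
    using integral_square_le[OF r(1), of ?g] integral_unique[OF ftc]
    by (simp add: continuous_on_inner[OF cg continuous_on_const])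
  also have "integral {0..r} (\<lambda>t. (?g t)\<^sup>2) \<le> integral {0..r} ?n"
  proof (intro integral_le integrable_continuous_real continuous_intros cg)
    fix t
    have "\<bar>?g t\<bar> \<le> norm (gradient w (x + t *\<^sub>R e))" using Basis_le_norm[OF e] by simp
    then have "\<bar>?g t\<bar>\<^sup>2 \<le> (norm (gradient w (x + t *\<^sub>R e)))\<^sup>2" by (intro power_mono) auto
    then show "(?g t)\<^sup>2 \<le> ?n t" by simp
  qed
  finally have sq: "(w (x + r *\<^sub>R e) - w x)\<^sup>2 \<le> r * integral {0..r} ?n"
    using r(1) by (simp add: mult_left_mono)
  have int0: "0 \<le> integral {0..r} ?n" by (intro integral_nonneg integrable_continuous_real continuous_intros cg) auto
  have "(w x)\<^sup>2 \<le> 2 * (w (x + r *\<^sub>R e))\<^sup>2 + 2 * (w (x + r *\<^sub>R e) - w x)\<^sup>2"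
    using norm_add_sq_le[of "w (x + r *\<^sub>R e)" "- (w (x + r *\<^sub>R e) - w x)"] by (simp add: power2_commute)
  also have "\<dots> \<le> 2 * (w (x + r *\<^sub>R e))\<^sup>2 + 2 * ((2 * R + 1) * integral {0..r} ?n)"
    using sq mult_right_mono[OF r(2) int0] by linarith
  finally have "ennreal ((w x)\<^sup>2) \<le> ennreal (2 * (w (x + r *\<^sub>R e))\<^sup>2 + 2 * (2 * R + 1) * integral {0..r} ?n)"
    by (intro ennreal_leI) (simp add: algebra_simps)
  also have "\<dots> = 2 * ennreal ((w (exit_point \<Omega> e x))\<^sup>2) + ennreal (2 * (2 * R + 1)) * ennreal (integral {0..r} ?n)"
    using R int0 by (simp add: ennreal_plus ennreal_mult exit_point_def r_def)
  also have "ennreal (integral {0..r} ?n) = (\<integral>\<^sup>+t. indicator {0..r} t * ennreal (?n t) \<partial>lborel)"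
  proof -
    have "(?n has_integral integral {0..r} ?n) {0..r}"
      by (intro integrable_integral integrable_continuous_real continuous_intros cg)
    from nn_integral_has_integral_lebesgue'[OF _ this] show ?thesis
      by (simp add: mult.commute)
  qed
  also have "\<dots> \<le> (\<integral>\<^sup>+t. indicator {0..2 * R + 1} t *
      (ennreal (?n t) * indicator \<Omega> (x + t *\<^sub>R e)) \<partial>lborel)"
  proof (rule nn_integral_mono_AE)
    show "AE t in lborel. indicator {0..r} t * ennreal (?n t)
        \<le> indicator {0..2 * R + 1} t * (ennreal (?n t) * indicator \<Omega> (x + t *\<^sub>R e))"
      using AE_lborel_singleton[of r]
    proof eventually_elim
      case (elim t)
      then show ?case using r(2) r(4)[of t] by (auto simp: indicator_def)
    qed
  qed
  finally show ?thesis by (simp add: add_left_mono mult_left_mono)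
qed

lemma friedrichs:
  assumes "measure_space UNIV (sets borel) (hausdorff_outer (DIM('a) - 1) :: 'a set \<Rightarrow> ennreal)"
  obtains C :: real where "0 < C"
    "\<And>w. smooth w \<Longrightarrow> L2sq (lebesgue_on \<Omega>) w \<le>
      ennreal C * (L2sq (lebesgue_on \<Omega>) (gradient w) + L2sq (surface_measure \<Omega>) w)"
proof -
  let ?D = "2 * R + 1" and ?L = "restrict_space lborel \<Omega>"
  obtain c :: real where "0 < c" and c: "\<And>f. f \<in> borel_measurable borel \<Longrightarrow>
      ennreal c * (\<integral>\<^sup>+x. f (exit_point \<Omega> e x) \<partial>?L) \<le> (\<integral>\<^sup>+x. f x \<partial>surface_measure \<Omega>)"
    using nn_integral_exit_le[OF assms] by blast
  define C where "C = max (2 / c) (2 * ?D * ?D)"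
  show ?thesis
  proof
    show "0 < C" using \<open>0 < c\<close> by (simp add: C_def less_max_iff_disj)
    fix w :: "'a \<Rightarrow> real" assume w: "smooth w"
    have [measurable]: "w \<in> borel_measurable borel" "gradient w \<in> borel_measurable borel"
      using w by (auto intro: smooth_measurable smooth_gradient_measurable)
    have [measurable]: "\<Omega> \<in> sets borel" using op by simp
    let ?h = "\<lambda>z. ennreal ((norm (gradient w z))\<^sup>2) * indicator \<Omega> z"
    let ?W = "\<lambda>z. ennreal ((w z)\<^sup>2)"
    have [measurable]: "?h \<in> borel_measurable borel" by measurable
    have bd: "(\<integral>\<^sup>+x. ?W (exit_point \<Omega> e x) \<partial>?L) \<le> ennreal (1 / c) * L2sq (surface_measure \<Omega>) w"
    proof -
      have "(\<integral>\<^sup>+x. ?W (exit_point \<Omega> e x) \<partial>?L) =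
          ennreal (1 / c) * (ennreal c * (\<integral>\<^sup>+x. ?W (exit_point \<Omega> e x) \<partial>?L))"
        using \<open>0 < c\<close> by (simp add: mult.assoc[symmetric] flip: ennreal_mult)
      also have "\<dots> \<le> ennreal (1 / c) * L2sq (surface_measure \<Omega>) w"
        using c[of ?W] by (intro mult_left_mono) (auto simp: L2sq_def)
      finally show ?thesis .
    qed
    have inner: "(\<integral>\<^sup>+x. (\<integral>\<^sup>+t. indicator {0..?D} t * ?h (x + t *\<^sub>R e) \<partial>lborel) \<partial>lborel) =
        ennreal ?D * L2sq (lebesgue_on \<Omega>) (gradient w)"
    proof -
      have "(\<integral>\<^sup>+x. (\<integral>\<^sup>+t. indicator {0..?D} t * ?h (x + t *\<^sub>R e) \<partial>lborel) \<partial>lborel) =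
          (\<integral>\<^sup>+t. (\<integral>\<^sup>+x. indicator {0..?D} t * ?h (x + t *\<^sub>R e) \<partial>lborel) \<partial>lborel)"
        by (rule lborel_pair.Fubini'[symmetric]) measurable
      also have "\<dots> = (\<integral>\<^sup>+t. indicator {0..?D} t * (\<integral>\<^sup>+x. ?h x \<partial>lborel) \<partial>lborel)"
        by (simp add: nn_integral_cmult nn_integral_lborel_shift[of ?h])
      also have "\<dots> = ennreal ?D * (\<integral>\<^sup>+x. ?h x \<partial>lborel)"
        using R by (simp add: nn_integral_multc)
      finally show ?thesis
        by (simp add: L2sq_def nn_integral_lebesgue_on_borel[OF op])
    qed
    have "L2sq (lebesgue_on \<Omega>) w = (\<integral>\<^sup>+x. ?W x \<partial>?L)"
      using op by (simp add: L2sq_def nn_integral_restrict_space nn_integral_completion)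
    also have "\<dots> \<le> (\<integral>\<^sup>+x. 2 * ?W (exit_point \<Omega> e x) + ennreal (2 * ?D) *
        (\<integral>\<^sup>+t. indicator {0..?D} t * ?h (x + t *\<^sub>R e) \<partial>lborel) \<partial>?L)"
      using smooth_line_bound[OF w] by (intro nn_integral_mono) (simp add: space_restrict_space)
    also have "\<dots> = (\<integral>\<^sup>+x. 2 * ?W (exit_point \<Omega> e x) \<partial>?L) + (\<integral>\<^sup>+x. ennreal (2 * ?D) *
        (\<integral>\<^sup>+t. indicator {0..?D} t * ?h (x + t *\<^sub>R e) \<partial>lborel) \<partial>?L)"
    proof (rule nn_integral_add)
      have "?W \<in> borel_measurable (surface_measure \<Omega>)"
        by (intro borel_measurable_surface_measure) measurable
      from measurable_compose[OF exit_point_measurable this]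
      show "(\<lambda>x. 2 * ?W (exit_point \<Omega> e x)) \<in> borel_measurable ?L" by measurable
      show "(\<lambda>x. ennreal (2 * ?D) * (\<integral>\<^sup>+t. indicator {0..?D} t * ?h (x + t *\<^sub>R e) \<partial>lborel))
          \<in> borel_measurable ?L"
        by (intro measurable_restrict_space1) measurable
    qed
    also have "(\<integral>\<^sup>+x. 2 * ?W (exit_point \<Omega> e x) \<partial>?L) = 2 * (\<integral>\<^sup>+x. ?W (exit_point \<Omega> e x) \<partial>?L)"
    proof (rule nn_integral_cmult)
      have "?W \<in> borel_measurable (surface_measure \<Omega>)"
        by (intro borel_measurable_surface_measure) measurable
      from measurable_compose[OF exit_point_measurable this]
      show "(\<lambda>x. ?W (exit_point \<Omega> e x)) \<in> borel_measurable ?L" by simp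
    qed
    also have "(\<integral>\<^sup>+x. ennreal (2 * ?D) * (\<integral>\<^sup>+t. indicator {0..?D} t * ?h (x + t *\<^sub>R e) \<partial>lborel) \<partial>?L) \<le>
        (\<integral>\<^sup>+x. ennreal (2 * ?D) * (\<integral>\<^sup>+t. indicator {0..?D} t * ?h (x + t *\<^sub>R e) \<partial>lborel) \<partial>lborel)"
      using op by (subst nn_integral_restrict_space) (auto intro!: nn_integral_mono simp: indicator_def)
    also have "\<dots> = ennreal (2 * ?D) * (ennreal ?D * L2sq (lebesgue_on \<Omega>) (gradient w))"
      by (subst inner[symmetric], rule nn_integral_cmult) measurable
    also have "2 * (\<integral>\<^sup>+x. ?W (exit_point \<Omega> e x) \<partial>?L) \<le> 2 * (ennreal (1 / c) * L2sq (surface_measure \<Omega>) w)"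
      by (intro mult_left_mono bd) auto
    also have "2 * (ennreal (1 / c) * L2sq (surface_measure \<Omega>) w) = ennreal (2 / c) * L2sq (surface_measure \<Omega>) w"
      using \<open>0 < c\<close> ennreal_mult[of 2 "1 / c"] by (simp add: mult.assoc[symmetric])
    also have "ennreal (2 * ?D) * (ennreal ?D * L2sq (lebesgue_on \<Omega>) (gradient w)) =
        ennreal (2 * ?D * ?D) * L2sq (lebesgue_on \<Omega>) (gradient w)"
      using R ennreal_mult[of "2 * ?D" ?D] by (simp add: mult.assoc[symmetric])
    finally have "L2sq (lebesgue_on \<Omega>) w \<le> ennreal (2 / c) * L2sq (surface_measure \<Omega>) w +
        ennreal (2 * ?D * ?D) * L2sq (lebesgue_on \<Omega>) (gradient w)"
      by (simp add: add_mono)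
    also have "\<dots> \<le> ennreal C * L2sq (surface_measure \<Omega>) w + ennreal C * L2sq (lebesgue_on \<Omega>) (gradient w)"
      by (intro add_mono mult_right_mono ennreal_leI) (auto simp: C_def)
    finally show "L2sq (lebesgue_on \<Omega>) w \<le>
        ennreal C * (L2sq (lebesgue_on \<Omega>) (gradient w) + L2sq (surface_measure \<Omega>) w)"
      by (simp add: distrib_left add.commute)
  qed
qed

end

section \<open>Completeness of the gradients with a given trace\<close>

lemma L2_Cauchy_Schwarz:
  assumes f: "f \<in> L2 M" and g: "g \<in> L2 M"
  shows "(LINT x|M. f x \<bullet> g x)\<^sup>2 \<le> (LINT x|M. (norm (f x))\<^sup>2) * (LINT x|M. (norm (g x))\<^sup>2)"
proof -
  define a where "a = (LINT x|M. (norm (f x))\<^sup>2)"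
  define b where "b = (LINT x|M. f x \<bullet> g x)"
  define c where "c = (LINT x|M. (norm (g x))\<^sup>2)"
  note i = L2_integrable[OF f] L2_integrable[OF g] L2_inner_integrable[OF f g]
  have quad: "0 \<le> a - 2 * s * b + s\<^sup>2 * c" for s
  proof -
    have "(norm (f x - s *\<^sub>R g x))\<^sup>2 = (norm (f x))\<^sup>2 - 2 * s * (f x \<bullet> g x) + s\<^sup>2 * (norm (g x))\<^sup>2" for x
      unfolding power2_norm_eq_inner
      by (simp add: inner_diff_left inner_diff_right inner_commute power2_eq_square algebra_simps)
    then have "(LINT x|M. (norm (f x - s *\<^sub>R g x))\<^sup>2) = a - 2 * s * b + s\<^sup>2 * c"
      using i by (simp add: a_def b_def c_def)
    then show ?thesis
      by (metis (no_types, lifting) Bochner_Integration.integral_nonneg zero_le_power2)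
  qed
  have c0: "0 \<le> c" by (simp add: c_def)
  have "b\<^sup>2 \<le> a * c"
  proof (cases "c = 0")
    case True
    have "b = 0"
    proof (rule ccontr)
      assume "b \<noteq> 0"
      then show False using quad[of "(a + 1) / (2 * b)"] True by simp
    qed
    then show ?thesis using True by simp
  next
    case False
    then show ?thesis using quad[of "b / c"] c0 by (simp add: field_simps power2_eq_square)
  qed
  then show ?thesis by (simp add: a_def b_def c_def)
qed

lemma L2_limit_inner:
  assumes lim: "L2_limit M f h" and f: "\<And>k. f k \<in> L2 M" and h: "h \<in> L2 M" and g: "g \<in> L2 M"
  shows "(\<lambda>k. LINT x|M. f k x \<bullet> g x) \<longlonglongrightarrow> (LINT x|M. h x \<bullet> g x)"
proof -
  let ?c = "LINT x|M. (norm (g x))\<^sup>2"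
  have bound: "norm ((LINT x|M. f k x \<bullet> g x) - (LINT x|M. h x \<bullet> g x)) \<le>
      sqrt ((LINT x|M. (norm (f k x - h x))\<^sup>2) * ?c)" for k
  proof -
    have "(LINT x|M. f k x \<bullet> g x) - (LINT x|M. h x \<bullet> g x) = (LINT x|M. (f k x - h x) \<bullet> g x)"
      using L2_inner_integrable[OF f[of k] g] L2_inner_integrable[OF h g]
      by (simp add: inner_diff_left)
    then show ?thesis
      using L2_Cauchy_Schwarz[OF L2_diff[OF f[of k] h] g] by (simp add: real_le_rsqrt)
  qed
  have "(\<lambda>k. sqrt ((LINT x|M. (norm (f k x - h x))\<^sup>2) * ?c)) \<longlonglongrightarrow> sqrt (0 * ?c)"
    by (rule tendsto_real_sqrt[OF tendsto_mult[OF L2_limit_integral[OF lim f h] tendsto_const]])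
  then have "(\<lambda>k. sqrt ((LINT x|M. (norm (f k x - h x))\<^sup>2) * ?c)) \<longlonglongrightarrow> 0"
    by simp
  from Lim_null_comparison[OF always_eventually[OF allI[OF bound]] this]
  show ?thesis by (rule LIM_zero_cancel)
qed

lemma L2_limit_eventually:
  "L2_limit M w u \<Longrightarrow> 0 < (e::real) \<Longrightarrow> \<forall>\<^sub>F k in sequentially. L2sq M (\<lambda>x. w k x - u x) < ennreal e"
  by (auto simp: L2_limit_L2sq intro: order_tendstoD)

lemma trace_zero_poincare:
  fixes \<Omega> :: "'a::euclidean_space set"
  assumes \<Omega>: "open \<Omega>" "bounded \<Omega>"
    and ms: "measure_space UNIV (sets borel) (hausdorff_outer (DIM('a) - 1) :: 'a set \<Rightarrow> ennreal)"
  obtains C :: real where "0 < C"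
    "\<And>v W. has_trace \<Omega> v W (\<lambda>x. 0) \<Longrightarrow>
      L2sq (lebesgue_on \<Omega>) v \<le> ennreal C * L2sq (lebesgue_on \<Omega>) W"
proof -
  obtain R where R: "0 < R" "\<And>x. x \<in> \<Omega> \<Longrightarrow> norm x \<le> R"
    using \<Omega>(2) by (auto simp: bounded_pos)
  obtain e :: 'a where e: "e \<in> Basis" using nonempty_Basis by blast
  have inR: "\<And>x b. x \<in> \<Omega> \<Longrightarrow> b \<in> Basis \<Longrightarrow> \<bar>x \<bullet> b\<bar> \<le> R"
    using R(2) Basis_le_norm order_trans by blast
  let ?M = "lebesgue_on \<Omega>" and ?S = "surface_measure \<Omega>"
  obtain C where "0 < C" and C: "\<And>w. smooth w \<Longrightarrow> L2sq ?M w \<le>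
      ennreal C * (L2sq ?M (gradient w) + L2sq ?S w)"
    using friedrichs[OF \<Omega>(1) e R(1) inR ms] by blast
  show ?thesis
  proof
    show "0 < 4 * C" using \<open>0 < C\<close> by simp
    fix v :: "'a \<Rightarrow> real" and W assume tr: "has_trace \<Omega> v W (\<lambda>x. 0)"
    note [measurable] = has_trace_L2[OF tr, THEN L2_measurable]
    obtain w where sw: "\<And>k. smooth (w k)"
      and w: "L2_limit ?M w v" "L2_limit ?M (\<lambda>k. gradient (w k)) W" "L2_limit ?S w (\<lambda>x. 0)"
      using tr by (auto simp: has_trace_def)
    note [measurable] = smooth_measurable_on[OF sw]
    let ?B = "\<lambda>k. 2 * L2sq ?M (\<lambda>x. w k x - v x) + 2 * (ennreal C *
        (2 * L2sq ?M (\<lambda>x. gradient (w k) x - W x) + 2 * L2sq ?M W + L2sq ?S (\<lambda>x. w k x - 0)))"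
    have "L2sq ?M v \<le> ?B k" for k
    proof -
      have "L2sq ?M v \<le> 2 * L2sq ?M (\<lambda>x. v x - w k x) + 2 * L2sq ?M (w k)"
        using L2sq_add_le[of "\<lambda>x. v x - w k x" ?M "w k"] by simp
      also have "\<dots> \<le> 2 * L2sq ?M (\<lambda>x. w k x - v x) +
          2 * (ennreal C * (L2sq ?M (gradient (w k)) + L2sq ?S (w k)))"
        by (intro add_mono mult_left_mono C sw) (auto simp: L2sq_minus_commute)
      also have "\<dots> \<le> ?B k"
        using L2sq_add_le[of "\<lambda>x. gradient (w k) x - W x" ?M W]
        by (intro add_mono mult_left_mono order_refl) auto
      finally show ?thesis .
    qed
    moreover have "?B \<longlonglongrightarrow> 2 * 0 + 2 * (ennreal C * (2 * 0 + 2 * L2sq ?M W + 0))"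
      using w unfolding L2_limit_L2sq
      by (intro tendsto_add ennreal_tendsto_cmult tendsto_const) auto
    ultimately have "L2sq ?M v \<le> 2 * 0 + 2 * (ennreal C * (2 * 0 + 2 * L2sq ?M W + 0))"
      by (intro LIMSEQ_le_const) auto
    then show "L2sq ?M v \<le> ennreal (4 * C) * L2sq ?M W"
      using \<open>0 < C\<close> by (simp add: ennreal_mult mult.left_commute mult.commute[of _ 4] flip: mult.assoc)
  qed
qed

lemma weak_gradient_closed:
  fixes \<Omega> :: "'a::euclidean_space set"
  assumes \<Omega>: "open \<Omega>" "bounded \<Omega>" and H1: "\<And>k. (u k, G k) \<in> H1 \<Omega>"
    and u: "L2_limit (lebesgue_on \<Omega>) u v" "v \<in> L2 (lebesgue_on \<Omega>)"
    and G: "L2_limit (lebesgue_on \<Omega>) G W" "W \<in> L2 (lebesgue_on \<Omega>)"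
  shows "weak_gradient \<Omega> v W"
  unfolding weak_gradient_def
proof (intro allI impI, rule euclidean_eqI)
  fix \<phi> and b :: 'a assume \<phi>: "test_function \<Omega> \<phi>" and b: "b \<in> Basis"
  let ?M = "lebesgue_on \<Omega>"
  interpret finite_measure ?M using \<Omega> by (rule finite_lebesgue_on)
  have uk: "u k \<in> L2 ?M" "G k \<in> L2 ?M" for k using H1[of k] by (auto simp: H1_def)
  have "smooth \<phi>" using \<phi> by (simp add: test_function_def)
  note [measurable] = smooth_measurable_on[OF this]
  obtain B B' where B: "\<And>x. norm (\<phi> x) \<le> B" and B': "\<And>x. norm (gradient \<phi> x) \<le> B'"
    using test_function_bounded[OF \<phi>] by blast
  have L2: "(\<lambda>x. gradient \<phi> x \<bullet> b) \<in> L2 ?M" "(\<lambda>x. \<phi> x *\<^sub>R b) \<in> L2 ?M"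
    using b B order_trans[OF Basis_le_norm[OF b] B'] by (auto intro!: L2_bounded)
  have comp: "(LINT x|?M. v x *\<^sub>R gradient \<phi> x) \<bullet> b = (LINT x|?M. v x \<bullet> (gradient \<phi> x \<bullet> b))"
      "(LINT x|?M. \<phi> x *\<^sub>R W x) \<bullet> b = (LINT x|?M. W x \<bullet> (\<phi> x *\<^sub>R b))"
    if "v \<in> L2 ?M" "W \<in> L2 ?M" for v W
    using weak_gradient_integrable[OF \<Omega> that \<phi>] by (simp_all flip: integral_inner_left)
  have "(LINT x|?M. u k x \<bullet> (gradient \<phi> x \<bullet> b)) = - (LINT x|?M. G k x \<bullet> (\<phi> x *\<^sub>R b))" for k
  proof -
    have "(LINT x|?M. u k x *\<^sub>R gradient \<phi> x) = - (LINT x|?M. \<phi> x *\<^sub>R G k x)"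
      using H1[of k] \<phi> by (simp add: H1_def weak_gradient_def)
    then show ?thesis
      using comp[OF uk] by (metis inner_minus_left)
  qed
  then have "(\<lambda>k. - (LINT x|?M. G k x \<bullet> (\<phi> x *\<^sub>R b))) \<longlonglongrightarrow> (LINT x|?M. v x \<bullet> (gradient \<phi> x \<bullet> b))"
    using L2_limit_inner[OF u(1) uk(1) u(2) L2(1)] by simp
  moreover have "(\<lambda>k. - (LINT x|?M. G k x \<bullet> (\<phi> x *\<^sub>R b))) \<longlonglongrightarrow> - (LINT x|?M. W x \<bullet> (\<phi> x *\<^sub>R b))"
    by (intro tendsto_minus L2_limit_inner[OF G(1) uk(2) G(2) L2(2)])
  ultimately have "(LINT x|?M. v x \<bullet> (gradient \<phi> x \<bullet> b)) = - (LINT x|?M. W x \<bullet> (\<phi> x *\<^sub>R b))"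
    by (rule LIMSEQ_unique)
  then show "(LINT x|?M. v x *\<^sub>R gradient \<phi> x) \<bullet> b = - (LINT x|?M. \<phi> x *\<^sub>R W x) \<bullet> b"
    using comp[OF u(2) G(2)] by simp
qed

lemma gradient_complete:
  fixes \<Omega> :: "'a::euclidean_space set"
  assumes \<Omega>: "open \<Omega>" "bounded \<Omega>"
    and ms: "measure_space UNIV (sets borel) (hausdorff_outer (DIM('a) - 1) :: 'a set \<Rightarrow> ennreal)"
    and tr: "\<And>k. has_trace \<Omega> (u k) (G k) f"
    and Cauchy: "\<And>e::real. 0 < e \<Longrightarrow>
      \<exists>N. \<forall>k\<ge>N. \<forall>l\<ge>N. L2sq (lebesgue_on \<Omega>) (\<lambda>x. G k x - G l x) < ennreal e"
  obtains v W where "has_trace \<Omega> v W f" "L2_limit (lebesgue_on \<Omega>) G W"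
proof -
  let ?M = "lebesgue_on \<Omega>" and ?S = "surface_measure \<Omega>"
  interpret finite_measure ?M using \<Omega> by (rule finite_lebesgue_on)
  have L2: "u k \<in> L2 ?M" "G k \<in> L2 ?M" for k using has_trace_L2[OF tr] by auto
  obtain W where W: "W \<in> L2 ?M" "L2_limit ?M G W"
    using L2_complete[OF L2(2) Cauchy] by blast
  obtain C where "0 < C" and C: "\<And>v W. has_trace \<Omega> v W (\<lambda>x. 0) \<Longrightarrow> L2sq ?M v \<le> ennreal C * L2sq ?M W"
    using trace_zero_poincare[OF \<Omega> ms] by blast
  have diff: "L2sq ?M (\<lambda>x. u k x - u l x) \<le> ennreal C * L2sq ?M (\<lambda>x. G k x - G l x)" for k l
    using C[of "\<lambda>x. u k x - u l x" "\<lambda>x. G k x - G l x"] has_trace_lincomb[OF \<Omega> tr[of k] tr[of l], of 1 "-1"]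
    by simp
  have "\<exists>N. \<forall>k\<ge>N. \<forall>l\<ge>N. L2sq ?M (\<lambda>x. u k x - u l x) < ennreal e" if "0 < e" for e :: real
  proof -
    obtain N where N: "\<forall>k\<ge>N. \<forall>l\<ge>N. L2sq ?M (\<lambda>x. G k x - G l x) < ennreal (e / C)"
      using Cauchy[of "e / C"] \<open>0 < C\<close> \<open>0 < e\<close> by auto
    have "L2sq ?M (\<lambda>x. u k x - u l x) < ennreal e" if "N \<le> k" "N \<le> l" for k l
    proof -
      have "ennreal C * L2sq ?M (\<lambda>x. G k x - G l x) < ennreal C * ennreal (e / C)"
        using N that \<open>0 < C\<close> by (intro ennreal_mult_strict_left_mono) auto
      also have "\<dots> = ennreal e"
        using \<open>0 < C\<close> \<open>0 < e\<close> by (simp flip: ennreal_mult)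
      finally show ?thesis using diff[of k l] by (rule le_less_trans[rotated])
    qed
    then show ?thesis by blast
  qed
  from L2_complete[OF L2(1) this] obtain v where v: "v \<in> L2 ?M" "L2_limit ?M u v"
    by blast
  note [measurable] = L2_measurable[OF v(1)] L2_measurable[OF W(1)]
    has_trace_L2[OF tr, THEN L2_measurable]
  have "\<exists>w. smooth w \<and> L2sq ?M (\<lambda>x. w x - v x) \<le> ennreal e \<and>
      L2sq ?M (\<lambda>x. gradient w x - W x) \<le> ennreal e \<and> L2sq ?S (\<lambda>x. w x - f x) \<le> ennreal e"
    if "0 < e" for e :: real
  proof -
    have e4: "0 < e / 4" using that by simp
    have "\<forall>\<^sub>F k in sequentially. L2sq ?M (\<lambda>x. u k x - v x) < ennreal (e / 4) \<and>
        L2sq ?M (\<lambda>x. G k x - W x) < ennreal (e / 4)"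
      by (intro eventually_conj L2_limit_eventually v W e4)
    then obtain k where k: "L2sq ?M (\<lambda>x. u k x - v x) < ennreal (e / 4)"
        "L2sq ?M (\<lambda>x. G k x - W x) < ennreal (e / 4)"
      using eventually_happens by fastforce
    obtain y where sy: "\<And>j. smooth (y j)"
      and y: "L2_limit ?M y (u k)" "L2_limit ?M (\<lambda>j. gradient (y j)) (G k)" "L2_limit ?S y f"
      using tr[of k] by (auto simp: has_trace_def)
    note [measurable] = smooth_measurable_on[OF sy]
    have "\<forall>\<^sub>F j in sequentially. L2sq ?M (\<lambda>x. y j x - u k x) < ennreal (e / 4) \<and>
        L2sq ?M (\<lambda>x. gradient (y j) x - G k x) < ennreal (e / 4) \<and>
        L2sq ?S (\<lambda>x. y j x - f x) < ennreal e"
      by (intro eventually_conj L2_limit_eventually y e4 that)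
    then obtain j where j: "L2sq ?M (\<lambda>x. y j x - u k x) < ennreal (e / 4)"
        "L2sq ?M (\<lambda>x. gradient (y j) x - G k x) < ennreal (e / 4)"
        "L2sq ?S (\<lambda>x. y j x - f x) < ennreal e"
      using eventually_happens by fastforce
    have quarter: "2 * a + 2 * b \<le> ennreal e" if "a < ennreal (e / 4)" "b < ennreal (e / 4)" for a b
    proof -
      have "2 * a + 2 * b \<le> 2 * ennreal (e / 4) + 2 * ennreal (e / 4)"
        using that by (intro add_mono mult_left_mono) auto
      also have "2 * ennreal (e / 4) = ennreal (e / 2)"
        using ennreal_mult'[of 2 "e / 4"] by simp
      also have "ennreal (e / 2) + ennreal (e / 2) = ennreal (e / 2 + e / 2)"
        using \<open>0 < e\<close> by (intro ennreal_plus[symmetric]) auto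
      finally show ?thesis by simp
    qed
    show ?thesis
      using order_trans[OF L2sq_triangle quarter[OF j(1) k(1)]]
        order_trans[OF L2sq_triangle quarter[OF j(2) k(2)]] j(3)
      by (intro exI[of _ "y j"] conjI sy) (auto simp: less_imp_le)
  qed
  then have "\<forall>n. \<exists>w. smooth w \<and> L2sq ?M (\<lambda>x. w x - v x) \<le> ennreal (inverse (Suc n)) \<and>
      L2sq ?M (\<lambda>x. gradient w x - W x) \<le> ennreal (inverse (Suc n)) \<and>
      L2sq ?S (\<lambda>x. w x - f x) \<le> ennreal (inverse (Suc n))"
    by simp
  from choice[OF this] obtain w where w: "smooth (w n)"
      "L2sq ?M (\<lambda>x. w n x - v x) \<le> ennreal (inverse (Suc n))"
      "L2sq ?M (\<lambda>x. gradient (w n) x - W x) \<le> ennreal (inverse (Suc n))"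
      "L2sq ?S (\<lambda>x. w n x - f x) \<le> ennreal (inverse (Suc n))" for n
    by blast
  have null: "a \<longlonglongrightarrow> 0" if "\<And>n. a n \<le> ennreal (inverse (Suc n))" for a :: "nat \<Rightarrow> ennreal"
  proof (rule tendsto_sandwich[where f = "\<lambda>_. 0"])
    show "(\<lambda>n. ennreal (inverse (Suc n))) \<longlonglongrightarrow> 0"
      using tendsto_ennrealI[OF LIMSEQ_inverse_real_of_nat] by simp
  qed (use that in auto)
  have "has_trace \<Omega> v W f"
    unfolding has_trace_def L2_limit_L2sq
  proof (intro conjI exI[of _ w] allI null w)
    show "(v, W) \<in> H1 \<Omega>"
      using v W weak_gradient_closed[OF \<Omega> has_trace_H1[OF tr] v(2,1) W(2,1)] by (simp add: H1_def)
  qed (rule has_trace_L2(3)[OF tr])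
  then show ?thesis using W(2) that by blast
qed

section \<open>The potential of a material law\<close>

definition potential :: "(real \<Rightarrow> real) \<Rightarrow> real \<Rightarrow> real" where
  "potential g s = integral {0..s} (\<lambda>r. g r * r)"

lemma potential_0 [simp]: "potential g 0 = 0"
  by (simp add: potential_def)

lemma affine_has_integral:
  fixes p q :: real
  assumes "p \<le> q"
  shows "((\<lambda>r. a + k * (r - s)) has_integral (a * (q - p) + k / 2 * ((q - s)\<^sup>2 - (p - s)\<^sup>2))) {p..q}"
proof -
  have "((\<lambda>r. a + k * (r - s)) has_integral
      ((a * q + k / 2 * (q - s)\<^sup>2) - (a * p + k / 2 * (p - s)\<^sup>2))) {p..q}"
    using assms by (intro fundamental_theorem_of_calculus)
      (auto intro!: derivative_eq_intros simp flip: has_real_derivative_iff_has_vector_derivative)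
  then show ?thesis by (simp add: algebra_simps)
qed

lemma flux_integrable: "continuous_on UNIV g \<Longrightarrow> (\<lambda>r::real. g r * r) integrable_on {p..q}"
  by (intro integrable_continuous_real continuous_intros) (auto intro: continuous_on_subset)

lemma potential_diff:
  assumes "continuous_on UNIV g" "0 \<le> p" "p \<le> q"
  shows "potential g q - potential g p = integral {p..q} (\<lambda>r. g r * r)"
  using Henstock_Kurzweil_Integration.integral_combine[OF assms(2,3) flux_integrable[OF assms(1)]]
  by (simp add: potential_def)

lemma potential_ge:
  assumes "continuous_on UNIV g" "0 \<le> s" "\<And>r. 0 \<le> r \<Longrightarrow> r \<le> s \<Longrightarrow> b \<le> g r"
  shows "b / 2 * s\<^sup>2 \<le> potential g s"
proof -
  have "0 * (s - 0) + b / 2 * ((s - 0)\<^sup>2 - (0 - 0)\<^sup>2) \<le> potential g s"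
    unfolding potential_def
    by (rule has_integral_le[OF affine_has_integral[OF assms(2)]
          integrable_integral[OF flux_integrable[OF assms(1)]]])
      (auto intro!: mult_right_mono assms)
  then show ?thesis by simp
qed

lemma potential_le:
  assumes "continuous_on UNIV g" "0 \<le> s" "\<And>r. 0 \<le> r \<Longrightarrow> r \<le> s \<Longrightarrow> g r \<le> b"
  shows "potential g s \<le> b / 2 * s\<^sup>2"
proof -
  have "potential g s \<le> 0 * (s - 0) + b / 2 * ((s - 0)\<^sup>2 - (0 - 0)\<^sup>2)"
    unfolding potential_def
    by (rule has_integral_le[OF integrable_integral[OF flux_integrable[OF assms(1)]]
          affine_has_integral[OF assms(2)]])
      (auto intro!: mult_right_mono assms)
  then show ?thesis by simp
qed

lemma potential_const:
  assumes "0 \<le> s"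
  shows "potential (\<lambda>_. b) s = b / 2 * s\<^sup>2"
  using assms potential_ge[of "\<lambda>_. b" s b] potential_le[of "\<lambda>_. b" s b] by simp

lemma potential_tangent:
  assumes g: "continuous_on UNIV g" "mono_on {0..} (\<lambda>r. (g r - k) * r)" and st: "0 \<le> s" "0 \<le> t"
  shows "potential g s + g s * s * (t - s) + k / 2 * (t - s)\<^sup>2 \<le> potential g t"
proof (cases "s \<le> t")
  case True
  have "g s * s + k * (r - s) \<le> g r * r" if "s \<le> r" for r
    using mono_onD[OF g(2), of s r] st that by (simp add: algebra_simps)
  then have "g s * s * (t - s) + k / 2 * ((t - s)\<^sup>2 - (s - s)\<^sup>2) \<le> integral {s..t} (\<lambda>r. g r * r)"
    by (intro has_integral_le[OF affine_has_integral[OF True] integrable_integral[OF flux_integrable[OF g(1)]]]) auto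
  then show ?thesis using potential_diff[OF g(1) st(1) True] by simp
next
  case False
  then have ts: "t \<le> s" by simp
  have "g r * r \<le> g s * s + k * (r - s)" if "t \<le> r" "r \<le> s" for r
    using mono_onD[OF g(2), of r s] st that by (simp add: algebra_simps)
  then have "integral {t..s} (\<lambda>r. g r * r) \<le> g s * s * (s - t) + k / 2 * ((s - s)\<^sup>2 - (t - s)\<^sup>2)"
    by (intro has_integral_le[OF integrable_integral[OF flux_integrable[OF g(1)]] affine_has_integral[OF ts]]) auto
  then show ?thesis using potential_diff[OF g(1) st(2) ts] by (simp add: algebra_simps)
qed

lemma potential_tangent_inner:
  fixes a b :: "'b::real_inner"
  assumes g: "continuous_on UNIV g" "mono_on {0..} (\<lambda>r. (g r - k) * r)"
  shows "potential g (norm a) + g (norm a) * (a \<bullet> (b - a)) + k / 2 * (norm (b - a))\<^sup>2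
    \<le> potential g (norm b)"
proof -
  let ?s = "norm a" and ?t = "norm b"
  have pos: "0 \<le> (g ?s - k) * (?s * ?t - a \<bullet> b)"
  proof (cases "a = 0")
    case False
    then have "0 \<le> g ?s - k"
      using mono_onD[OF g(2), of 0 ?s] by (simp add: zero_le_mult_iff)
    then show ?thesis using norm_cauchy_schwarz[of a b] by simp
  qed simp
  have sq: "(norm (b - a))\<^sup>2 = ?t\<^sup>2 - 2 * (a \<bullet> b) + ?s\<^sup>2"
    by (simp add: power2_norm_eq_inner inner_diff_left inner_diff_right inner_commute)
  have "potential g ?s + g ?s * ?s * (?t - ?s) + k / 2 * (?t - ?s)\<^sup>2 -
      (potential g ?s + g ?s * (a \<bullet> (b - a)) + k / 2 * (norm (b - a))\<^sup>2) = (g ?s - k) * (?s * ?t - a \<bullet> b)"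
    unfolding sq by (simp add: inner_diff_right dot_square_norm power2_eq_square field_simps)
  then show ?thesis
    using potential_tangent[OF g, of ?s ?t] pos by simp
qed

lemma potential_eq_lebesgue:
  assumes "continuous_on UNIV g"
  shows "potential g s = (LINT r|lborel. (if 0 \<le> r \<and> r \<le> s then g r * r else 0))"
proof -
  have "set_integrable lborel {0..s} (\<lambda>r. g r * r)"
    by (intro borel_integrable_atLeastAtMost' continuous_intros) (auto intro: continuous_on_subset assms)
  from set_borel_integral_eq_integral(2)[OF this]
  show ?thesis
    by (simp add: potential_def set_lebesgue_integral_def indicator_def of_bool_def if_distrib[of "\<lambda>c. c * _"]
        cong: if_cong)
qed

text \<open>Subgradients are monotone, so Riemann sums suffice and no continuity of \<open>p\<close> is needed.\<close>

lemma subgradient_has_integral: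
  fixes e p :: "real \<Rightarrow> real"
  assumes sub: "\<And>x y. x \<in> {0..1} \<Longrightarrow> y \<in> {0..1} \<Longrightarrow> e x + (y - x) * p x \<le> e y"
  shows "(p has_integral (e 1 - e 0)) {0..1}"
proof -
  have mono: "p x \<le> p y" if "0 \<le> x" "x \<le> y" "y \<le> 1" for x y
  proof (cases "x = y")
    case False
    have "(y - x) * p x \<le> (y - x) * p y"
      using sub[of x y] sub[of y x] that by (simp add: algebra_simps)
    then show ?thesis using False that by simp
  qed simp
  have int: "p integrable_on {x..y}" if "0 \<le> x" "y \<le> 1" for x y
    using that by (intro integrable_on_mono_on mono_onI mono) auto
  define F where "F x = integral {0..x} p - e x" for x
  have F: "\<bar>F y - F x\<bar> \<le> (y - x) * (p y - p x)" if "0 \<le> x" "x \<le> y" "y \<le> 1" for x y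
  proof -
    have "integral {0..y} p - integral {0..x} p = integral {x..y} p"
      using Henstock_Kurzweil_Integration.integral_combine[OF that(1,2) int] that by simp
    moreover have "(y - x) * p x \<le> integral {x..y} p"
      using integral_le[OF integrable_const_ivl int, of x y "p x"] mono that by simp
    moreover have "integral {x..y} p \<le> (y - x) * p y"
      using integral_le[OF int integrable_const_ivl, of x y "p y"] mono that by simp
    moreover have "(y - x) * p x \<le> e y - e x" "e y - e x \<le> (y - x) * p y"
      using sub[of x y] sub[of y x] that by (simp_all add: algebra_simps)
    ultimately show ?thesis unfolding F_def by (simp add: algebra_simps abs_le_iff)
  qed
  have "\<bar>F 1 - F 0\<bar> \<le> inverse (Suc n) * (p 1 - p 0)" for n
  proof -
    let ?N = "real (Suc n)"
    let ?x = "\<lambda>i. real i / ?N"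
    have "F 1 - F 0 = (\<Sum>i<Suc n. F (?x (Suc i)) - F (?x i))"
      unfolding sum_lessThan_telescope[of "\<lambda>i. F (?x i)"] by simp
    also have "\<bar>\<dots>\<bar> \<le> (\<Sum>i<Suc n. (?x (Suc i) - ?x i) * (p (?x (Suc i)) - p (?x i)))"
      by (intro sum_abs[THEN order_trans] sum_mono F) (auto simp: divide_right_mono field_simps)
    also have "\<dots> = (\<Sum>i<Suc n. inverse ?N * (p (?x (Suc i)) - p (?x i)))"
      by (intro sum.cong refl) (simp add: field_simps)
    also have "\<dots> = inverse ?N * (p 1 - p 0)"
      unfolding sum_distrib_left[symmetric] sum_lessThan_telescope[of "\<lambda>i. p (?x i)"] by simp
    finally show ?thesis .
  qed
  moreover have "(\<lambda>n. inverse (real (Suc n)) * (p 1 - p 0)) \<longlonglongrightarrow> 0 * (p 1 - p 0)"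
    by (intro tendsto_mult LIMSEQ_inverse_real_of_nat tendsto_const)
  ultimately have "\<bar>F 1 - F 0\<bar> \<le> 0"
    by (intro LIMSEQ_le_const[of _ "0::real"]) auto
  then have "integral {0..1} p = e 1 - e 0"
    by (simp add: F_def)
  then show ?thesis
    using integrable_integral[OF int[of 0 1]] by simp
qed

section \<open>Weak solutions and the energy\<close>

locale material =
  fixes \<Omega> :: "'a::euclidean_space set" and \<gamma> :: "'a \<Rightarrow> real \<Rightarrow> real" and c C \<kappa> :: real
  assumes \<Omega>: "open \<Omega>" "bounded \<Omega>"
    and hausdorff: "measure_space UNIV (sets borel) (hausdorff_outer (DIM('a) - 1) :: 'a set \<Rightarrow> ennreal)"
    and pos: "0 < c" "0 < \<kappa>"
    and measurable_law: "(\<lambda>(x, s). \<gamma> x s) \<in> borel_measurable (lebesgue_on \<Omega> \<Otimes>\<^sub>M borel)"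
    and continuous_law: "\<And>x. x \<in> \<Omega> \<Longrightarrow> continuous_on UNIV (\<gamma> x)"
    and bounds: "AE x in lebesgue_on \<Omega>. \<forall>s\<ge>0. c \<le> \<gamma> x s \<and> \<gamma> x s \<le> C"
    and monotone: "AE x in lebesgue_on \<Omega>. mono_on {0..} (\<lambda>s. (\<gamma> x s - \<kappa>) * s)"
begin

abbreviation "M \<equiv> lebesgue_on \<Omega>"

definition energy :: "('a \<Rightarrow> 'a) \<Rightarrow> real" where
  "energy G = (LINT x|M. potential (\<gamma> x) (norm (G x)))"

definition form :: "('a \<Rightarrow> 'a) \<Rightarrow> ('a \<Rightarrow> 'a) \<Rightarrow> real" where
  "form G W = (LINT x|M. \<gamma> x (norm (G x)) * (G x \<bullet> W x))"

sublocale finite_measure M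
  using \<Omega> by (rule finite_lebesgue_on)

lemma AE_continuous: "AE x in M. continuous_on UNIV (\<gamma> x)"
  using continuous_law by (intro AE_I2) simp

lemma law_measurable:
  assumes [measurable]: "G \<in> borel_measurable M"
  shows "(\<lambda>x. \<gamma> x (norm (G x))) \<in> borel_measurable M"
proof -
  have "(\<lambda>x. (x, norm (G x))) \<in> M \<rightarrow>\<^sub>M M \<Otimes>\<^sub>M borel" by measurable
  from measurable_compose[OF this measurable_law] show ?thesis by simp
qed

lemma potential_measurable:
  assumes [measurable]: "G \<in> borel_measurable M"
  shows "(\<lambda>x. potential (\<gamma> x) (norm (G x))) \<in> borel_measurable M"
proof -
  have [measurable]: "(\<lambda>p. \<gamma> (fst p) (snd p)) \<in> borel_measurable (M \<Otimes>\<^sub>M lborel)"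
    using measurable_law by (simp add: case_prod_beta' cong: measurable_cong_sets)
  have meas: "(\<lambda>x. LINT r|lborel. (if 0 \<le> r \<and> r \<le> norm (G x) then \<gamma> x r * r else 0)) \<in> borel_measurable M"
    by (intro lborel.borel_measurable_lebesgue_integral) (simp add: case_prod_beta')
  have eq: "potential (\<gamma> x) (norm (G x)) =
      (LINT r|lborel. (if 0 \<le> r \<and> r \<le> norm (G x) then \<gamma> x r * r else 0))" if "x \<in> space M" for x
    using that by (intro potential_eq_lebesgue continuous_law) simp
  show ?thesis
    by (rule measurable_cong[THEN iffD2, OF eq meas])
qed

lemma flux_L2:
  assumes G: "G \<in> L2 M"
  shows "(\<lambda>x. \<gamma> x (norm (G x)) *\<^sub>R G x) \<in> L2 M"
proof -
  have [measurable]: "G \<in> borel_measurable M" "(\<lambda>x. \<gamma> x (norm (G x))) \<in> borel_measurable M"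
    using L2_measurable[OF G] by (auto intro: law_measurable)
  have "integrable M (\<lambda>x. (norm (\<gamma> x (norm (G x)) *\<^sub>R G x))\<^sup>2)"
  proof (rule Bochner_Integration.integrable_bound)
    show "integrable M (\<lambda>x. C\<^sup>2 * (norm (G x))\<^sup>2)"
      using L2_integrable[OF G] by simp
    show "AE x in M. norm ((norm (\<gamma> x (norm (G x)) *\<^sub>R G x))\<^sup>2) \<le> norm (C\<^sup>2 * (norm (G x))\<^sup>2)"
      using bounds
    proof eventually_elim
      case (elim x)
      then have "\<bar>\<gamma> x (norm (G x))\<bar>\<^sup>2 \<le> C\<^sup>2" using pos by (intro power_mono) (auto simp: abs_of_nonneg order_trans[OF less_imp_le])
      then show ?case by (simp add: power_mult_distrib mult_right_mono)
    qed
  qed measurable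
  then show ?thesis by (simp add: L2_def)
qed

lemma form_eq_inner: "form G W = (LINT x|M. W x \<bullet> (\<gamma> x (norm (G x)) *\<^sub>R G x))"
  by (simp add: form_def inner_commute)

lemma form_integrable:
  assumes "G \<in> L2 M" "W \<in> L2 M"
  shows "integrable M (\<lambda>x. \<gamma> x (norm (G x)) * (G x \<bullet> W x))"
  using L2_inner_integrable[OF flux_L2[OF assms(1)] assms(2)] by simp

lemma form_lincomb:
  assumes "G \<in> L2 M" "W \<in> L2 M" "V \<in> L2 M"
  shows "form G (\<lambda>x. a *\<^sub>R W x + b *\<^sub>R V x) = a * form G W + b * form G V"
proof -
  have "form G (\<lambda>x. a *\<^sub>R W x + b *\<^sub>R V x) =
      (LINT x|M. a * (\<gamma> x (norm (G x)) * (G x \<bullet> W x)) + b * (\<gamma> x (norm (G x)) * (G x \<bullet> V x)))"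
    unfolding form_def by (intro Bochner_Integration.integral_cong refl) (simp add: inner_add_right algebra_simps)
  also have "\<dots> = a * form G W + b * form G V"
    using form_integrable[OF assms(1,2)] form_integrable[OF assms(1,3)] by (simp add: form_def)
  finally show ?thesis .
qed

lemma form_diff:
  assumes "G \<in> L2 M" "W \<in> L2 M" "V \<in> L2 M"
  shows "form G (\<lambda>x. W x - V x) = form G W - form G V"
  using form_lincomb[OF assms, of 1 "-1"] by simp

lemma form_scaleR:
  assumes "G \<in> L2 M" "W \<in> L2 M"
  shows "form G (\<lambda>x. a *\<^sub>R W x) = a * form G W"
  using form_lincomb[OF assms assms(2), of a 0] by simp

lemma potential_bounds:
  "AE x in M. \<forall>s\<ge>0. c / 2 * s\<^sup>2 \<le> potential (\<gamma> x) s \<and> potential (\<gamma> x) s \<le> C / 2 * s\<^sup>2"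
  using bounds AE_continuous
proof eventually_elim
  case (elim x)
  then show ?case
    using potential_ge[of "\<gamma> x" _ c] potential_le[of "\<gamma> x" _ C] by blast
qed

lemma potential_integrable:
  assumes G: "G \<in> L2 M"
  shows "integrable M (\<lambda>x. potential (\<gamma> x) (norm (G x)))"
proof (rule Bochner_Integration.integrable_bound)
  show "integrable M (\<lambda>x. C / 2 * (norm (G x))\<^sup>2)"
    using L2_integrable[OF G] by simp
  show "(\<lambda>x. potential (\<gamma> x) (norm (G x))) \<in> borel_measurable M"
    by (intro potential_measurable L2_measurable G)
  show "AE x in M. norm (potential (\<gamma> x) (norm (G x))) \<le> norm (C / 2 * (norm (G x))\<^sup>2)"
    using potential_bounds
  proof eventually_elim
    case (elim x)
    then have "c / 2 * (norm (G x))\<^sup>2 \<le> potential (\<gamma> x) (norm (G x))"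
        "potential (\<gamma> x) (norm (G x)) \<le> C / 2 * (norm (G x))\<^sup>2" by auto
    moreover have "0 \<le> c / 2 * (norm (G x))\<^sup>2" using pos by simp
    ultimately show ?case unfolding real_norm_def by linarith
  qed
qed

lemma energy_bounds:
  assumes G: "G \<in> L2 M"
  shows "c / 2 * (LINT x|M. (norm (G x))\<^sup>2) \<le> energy G" "energy G \<le> C / 2 * (LINT x|M. (norm (G x))\<^sup>2)"
proof -
  have "(LINT x|M. c / 2 * (norm (G x))\<^sup>2) \<le> energy G"
    unfolding energy_def using L2_integrable[OF G] potential_bounds
    by (intro integral_mono_AE potential_integrable G) (auto elim: eventually_mono)
  then show "c / 2 * (LINT x|M. (norm (G x))\<^sup>2) \<le> energy G" by simp
  have "energy G \<le> (LINT x|M. C / 2 * (norm (G x))\<^sup>2)"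
    unfolding energy_def using L2_integrable[OF G] potential_bounds
    by (intro integral_mono_AE potential_integrable G) (auto elim: eventually_mono)
  then show "energy G \<le> C / 2 * (LINT x|M. (norm (G x))\<^sup>2)" by simp
qed

lemma energy_nonneg: "G \<in> L2 M \<Longrightarrow> 0 \<le> energy G"
  using energy_bounds(1)[of G] pos by (intro order_trans[OF _ energy_bounds(1)]) auto

lemma energy_tangent:
  assumes G: "G \<in> L2 M" and W: "W \<in> L2 M"
  shows "energy G + form G (\<lambda>x. W x - G x) + \<kappa> / 2 * (LINT x|M. (norm (W x - G x))\<^sup>2) \<le> energy W"
proof -
  note D = L2_diff[OF W G]
  have "(LINT x|M. potential (\<gamma> x) (norm (G x)) + \<gamma> x (norm (G x)) * (G x \<bullet> (W x - G x)) +
      \<kappa> / 2 * (norm (W x - G x))\<^sup>2) \<le> energy W"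
    unfolding energy_def
  proof (rule integral_mono_AE)
    show "AE x in M. potential (\<gamma> x) (norm (G x)) + \<gamma> x (norm (G x)) * (G x \<bullet> (W x - G x)) +
        \<kappa> / 2 * (norm (W x - G x))\<^sup>2 \<le> potential (\<gamma> x) (norm (W x))"
      using AE_continuous monotone by eventually_elim (rule potential_tangent_inner)
  qed (intro Bochner_Integration.integrable_add integrable_mult_right potential_integrable form_integrable
      L2_integrable G W D)+
  then show ?thesis
    using potential_integrable[OF G] form_integrable[OF G D] L2_integrable[OF D]
    by (simp add: energy_def form_def)
qed

lemma form_cong_AE:
  assumes "AE x in M. G x = G' x" "G \<in> L2 M" "G' \<in> L2 M" "W \<in> L2 M"
  shows "form G W = form G' W"
proof -
  have "form G W = (LINT x|M. \<gamma> x (norm (G x)) * (G x \<bullet> W x))" by (simp add: form_def)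
  also have "\<dots> = (LINT x|M. \<gamma> x (norm (G' x)) * (G' x \<bullet> W x))"
    using assms(1) form_integrable[OF assms(2,4)] form_integrable[OF assms(3,4)]
    by (intro integral_cong_AE) (auto elim: eventually_mono)
  finally show ?thesis by (simp add: form_def)
qed

lemma weak_solution_iff:
  "weak_solution \<Omega> \<gamma> f u G \<longleftrightarrow>
    has_trace \<Omega> u G f \<and> (\<forall>v W. has_trace \<Omega> v W (\<lambda>x. 0) \<longrightarrow> form G W = 0)"
  by (simp add: weak_solution_def form_def)

lemma trace_diff:
  assumes "has_trace \<Omega> u G f" "has_trace \<Omega> v W f"
  shows "has_trace \<Omega> (\<lambda>x. u x - v x) (\<lambda>x. G x - W x) (\<lambda>x. 0)"
  using has_trace_lincomb[OF \<Omega> assms, of 1 "-1"] by simp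

lemma trace_scale:
  assumes "has_trace \<Omega> u G f"
  shows "has_trace \<Omega> (\<lambda>x. a * u x) (\<lambda>x. a *\<^sub>R G x) (\<lambda>x. a * f x)"
  using has_trace_lincomb[OF \<Omega> assms assms, of a 0] by simp

lemma form_eq_of_trace_eq:
  assumes "weak_solution \<Omega> \<gamma> f u G" "has_trace \<Omega> v W g" "has_trace \<Omega> v' W' g"
  shows "form G W = form G W'"
proof -
  have "form G (\<lambda>x. W x - W' x) = 0"
    using trace_diff[OF assms(2,3)] assms(1) by (auto simp: weak_solution_iff)
  moreover have "G \<in> L2 M" "W \<in> L2 M" "W' \<in> L2 M"
    using assms by (auto simp: weak_solution_iff dest: has_trace_L2)
  ultimately show ?thesis by (simp add: form_diff)
qed

lemma weak_solution_minimal: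
  assumes "weak_solution \<Omega> \<gamma> f u G" "has_trace \<Omega> v W f"
  shows "energy G + \<kappa> / 2 * (LINT x|M. (norm (W x - G x))\<^sup>2) \<le> energy W"
proof -
  have tr: "has_trace \<Omega> u G f" using assms(1) by (simp add: weak_solution_iff)
  have "form G (\<lambda>x. W x - G x) = 0"
    using trace_diff[OF assms(2) tr] assms(1) by (auto simp: weak_solution_iff)
  then show ?thesis
    using energy_tangent[OF has_trace_L2(2)[OF tr] has_trace_L2(2)[OF assms(2)]] by simp
qed

lemma weak_solution_energy_le:
  assumes "weak_solution \<Omega> \<gamma> f u G" "has_trace \<Omega> v W f"
  shows "energy G \<le> energy W"
proof -
  have "0 \<le> \<kappa> / 2 * (LINT x|M. (norm (W x - G x))\<^sup>2)" using pos by simp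
  then show ?thesis using weak_solution_minimal[OF assms] by linarith
qed

lemma weak_solution_unique:
  assumes "weak_solution \<Omega> \<gamma> f u G" "weak_solution \<Omega> \<gamma> f u' G'"
  shows "AE x in M. G x = G' x"
proof -
  have tr: "has_trace \<Omega> u G f" "has_trace \<Omega> u' G' f" using assms by (auto simp: weak_solution_iff)
  have D: "(\<lambda>x. G' x - G x) \<in> L2 M" using has_trace_L2[OF tr(1)] has_trace_L2[OF tr(2)] by (intro L2_diff)
  have "\<kappa> / 2 * (LINT x|M. (norm (G' x - G x))\<^sup>2) \<le> 0"
    using weak_solution_minimal[OF assms(1) tr(2)] weak_solution_energy_le[OF assms(2) tr(1)] by simp
  then have "(LINT x|M. (norm (G' x - G x))\<^sup>2) = 0"
    using pos by (intro antisym) (auto simp: mult_le_0_iff)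
  then have "AE x in M. (norm (G' x - G x))\<^sup>2 = 0"
    using L2_integrable[OF D] by (subst (asm) integral_nonneg_eq_0_iff_AE) auto
  then show ?thesis by eventually_elim simp
qed

lemma DtN_eq:
  assumes sol: "weak_solution \<Omega> \<gamma> f u G" and tr: "has_trace \<Omega> v W \<phi>"
  shows "DtN \<Omega> \<gamma> f \<phi> = form G W"
  unfolding DtN_def
proof (rule the_equality)
  show "\<forall>u' G' v' W'. weak_solution \<Omega> \<gamma> f u' G' \<and> has_trace \<Omega> v' W' \<phi> \<longrightarrow>
      form G W = (LINT x|lebesgue_on \<Omega>. \<gamma> x (norm (G' x)) * (G' x \<bullet> W' x))"
  proof (intro allI impI, elim conjE)
    fix u' G' v' W' assume sol': "weak_solution \<Omega> \<gamma> f u' G'" and tr': "has_trace \<Omega> v' W' \<phi>"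
    have "G \<in> L2 M" "G' \<in> L2 M" "W' \<in> L2 M"
      using sol sol' tr' by (auto simp: weak_solution_iff dest: has_trace_L2)
    then have "form G W' = form G' W'"
      using form_cong_AE[OF weak_solution_unique[OF sol sol']] by blast
    then show "form G W = (LINT x|lebesgue_on \<Omega>. \<gamma> x (norm (G' x)) * (G' x \<bullet> W' x))"
      using form_eq_of_trace_eq[OF sol tr tr'] by (simp add: form_def)
  qed
next
  fix r assume "\<forall>u G v W. weak_solution \<Omega> \<gamma> f u G \<and> has_trace \<Omega> v W \<phi> \<longrightarrow>
      r = (LINT x|lebesgue_on \<Omega>. \<gamma> x (norm (G x)) * (G x \<bullet> W x))"
  then show "r = form G W" using sol tr by (simp add: form_def)
qed

lemma minimizer_exists:
  assumes "f \<in> H_half \<Omega>"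
  obtains u G where "has_trace \<Omega> u G f" "\<And>v W. has_trace \<Omega> v W f \<Longrightarrow> energy G \<le> energy W"
proof -
  define S where "S = {energy G | u G. has_trace \<Omega> u G f}"
  define m where "m = Inf S"
  have ne: "S \<noteq> {}" using assms by (auto simp: S_def H_half_def)
  have bdd: "bdd_below S"
    by (intro bdd_belowI[of _ 0]) (auto simp: S_def intro: energy_nonneg has_trace_L2)
  have m_le: "m \<le> energy W" if "has_trace \<Omega> v W f" for v W
    unfolding m_def using that by (intro cInf_lower bdd) (auto simp: S_def)
  have "\<forall>n. \<exists>p. has_trace \<Omega> (fst p) (snd p) f \<and> energy (snd p) < m + inverse (Suc n)"
  proof
    fix n
    obtain z where "z \<in> S" "z < m + inverse (Suc n)"
      using cInf_lessD[OF ne, of "m + inverse (Suc n)"] by (auto simp: m_def)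
    then show "\<exists>p. has_trace \<Omega> (fst p) (snd p) f \<and> energy (snd p) < m + inverse (Suc n)"
      by (auto simp: S_def)
  qed
  from choice[OF this] obtain p where
    p: "has_trace \<Omega> (fst (p n)) (snd (p n)) f" "energy (snd (p n)) < m + inverse (Suc n)" for n
    by blast
  define G where "G n = snd (p n)" for n
  note tr = p(1)[folded G_def] and low = p(2)[folded G_def]
  have L2: "G n \<in> L2 M" for n using has_trace_L2[OF tr] by blast
  have close: "\<kappa> / 4 * (LINT x|M. (norm (G k x - G l x))\<^sup>2) \<le> inverse (Suc k) + inverse (Suc l)" for k l
  proof -
    define Z where "Z x = (1/2) *\<^sub>R G k x + (1/2) *\<^sub>R G l x" for x
    define D where "D x = (1/2) *\<^sub>R (G k x - G l x)" for x
    have Z: "Z \<in> L2 M" and D: "D \<in> L2 M"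
      unfolding Z_def D_def by (intro L2_lincomb L2_scaleR L2_diff L2)+
    have "(\<lambda>x. 1/2 * f x + 1/2 * f x) = f" by (simp add: fun_eq_iff)
    then have "m \<le> energy Z"
      using has_trace_lincomb[OF \<Omega> tr[of k] tr[of l], of "1/2" "1/2"] m_le by (metis (no_types, lifting) Z_def ext)
    have h: "(1/2::real) *\<^sub>R v + (1/2) *\<^sub>R v = v" for v :: 'a
      by (simp flip: scaleR_add_left)
    have eq: "G k x - Z x = D x" "G l x - Z x = - D x" for x
      using h[of "G k x"] h[of "G l x"] by (simp_all add: Z_def D_def algebra_simps)
    have "energy Z + form Z D + \<kappa> / 2 * (LINT x|M. (norm (D x))\<^sup>2) \<le> energy (G k)"
      using energy_tangent[OF Z L2[of k]] by (simp add: eq)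
    moreover have "energy Z - form Z D + \<kappa> / 2 * (LINT x|M. (norm (D x))\<^sup>2) \<le> energy (G l)"
      using energy_tangent[OF Z L2[of l]] form_scaleR[OF Z D, of "-1"] by (simp add: eq)
    moreover have "(LINT x|M. (norm (D x))\<^sup>2) = 1/4 * (LINT x|M. (norm (G k x - G l x))\<^sup>2)"
      by (simp add: D_def power_mult_distrib power_divide)
    ultimately show ?thesis
      using low[of k] low[of l] \<open>m \<le> energy Z\<close> by simp
  qed
  have "\<exists>N. \<forall>k\<ge>N. \<forall>l\<ge>N. L2sq M (\<lambda>x. G k x - G l x) < ennreal e" if "0 < e" for e :: real
  proof -
    obtain N where N: "inverse (real (Suc N)) < \<kappa> / 8 * e"
      using reals_Archimedean[of "\<kappa> / 8 * e"] \<open>0 < e\<close> pos by auto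
    have "L2sq M (\<lambda>x. G k x - G l x) < ennreal e" if "N \<le> k" "N \<le> l" for k l
    proof -
      have "inverse (real (Suc k)) \<le> inverse (real (Suc N))" "inverse (real (Suc l)) \<le> inverse (real (Suc N))"
        using that by (auto intro!: le_imp_inverse_le)
      then have "\<kappa> / 4 * (LINT x|M. (norm (G k x - G l x))\<^sup>2) < \<kappa> / 4 * e"
        using close[of k l] N by linarith
      then have "(LINT x|M. (norm (G k x - G l x))\<^sup>2) < e"
        using pos by (simp add: mult_less_cancel_left_pos)
      then show ?thesis
        using \<open>0 < e\<close> by (simp add: L2sq_eq[OF L2_diff[OF L2 L2]] ennreal_lessI)
    qed
    then show ?thesis by blast
  qed
  from gradient_complete[OF \<Omega> hausdorff, of "\<lambda>k. fst (p k)" G f, OF tr this]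
  obtain v W where tr': "has_trace \<Omega> v W f" and lim: "L2_limit M G W"
    by blast
  note W = has_trace_L2(2)[OF tr']
  let ?F = "\<lambda>x. \<gamma> x (norm (W x)) *\<^sub>R W x"
  have "energy W \<le> m"
  proof (rule LIMSEQ_le_const)
    have "(\<lambda>k. (m + inverse (Suc k)) - ((LINT x|M. G k x \<bullet> ?F x) - (LINT x|M. W x \<bullet> ?F x))) \<longlonglongrightarrow>
        (m + 0) - ((LINT x|M. W x \<bullet> ?F x) - (LINT x|M. W x \<bullet> ?F x))"
      by (rule tendsto_diff[OF tendsto_add[OF tendsto_const LIMSEQ_inverse_real_of_nat]
            tendsto_diff[OF L2_limit_inner[OF lim L2 W flux_L2[OF W]] tendsto_const]])
    then show "(\<lambda>k. (m + inverse (Suc k)) - ((LINT x|M. G k x \<bullet> ?F x) - (LINT x|M. W x \<bullet> ?F x))) \<longlonglongrightarrow> m"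
      by simp
    have "energy W \<le> (m + inverse (Suc k)) - ((LINT x|M. G k x \<bullet> ?F x) - (LINT x|M. W x \<bullet> ?F x))" for k
    proof -
      have "0 \<le> \<kappa> / 2 * (LINT x|M. (norm (G k x - W x))\<^sup>2)" using pos by simp
      then have "energy W + form W (\<lambda>x. G k x - W x) \<le> energy (G k)"
        using energy_tangent[OF W L2[of k]] by linarith
      then show ?thesis
        using low[of k] form_diff[OF W L2[of k] W] unfolding form_eq_inner by linarith
    qed
    then show "\<exists>N. \<forall>k\<ge>N. energy W \<le>
        (m + inverse (Suc k)) - ((LINT x|M. G k x \<bullet> ?F x) - (LINT x|M. W x \<bullet> ?F x))" by blast
  qed
  then show ?thesis using that[OF tr'] m_le order_trans by blast
qed

text \<open>
  The law need not be differentiable, so the Euler--Lagrange equation is obtained from the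
  tangent inequality at the perturbed points \<open>G + \<epsilon> V\<close> rather than at \<open>G\<close>.
\<close>

lemma weak_solution_exists:
  assumes "f \<in> H_half \<Omega>"
  obtains u G where "weak_solution \<Omega> \<gamma> f u G"
proof -
  obtain u G where tr: "has_trace \<Omega> u G f" and min: "\<And>v W. has_trace \<Omega> v W f \<Longrightarrow> energy G \<le> energy W"
    using minimizer_exists[OF assms] by blast
  note G = has_trace_L2(2)[OF tr]
  have nonneg: "0 \<le> form G V" if trV: "has_trace \<Omega> v V (\<lambda>x. 0)" for v V
  proof (rule LIMSEQ_le_const)
    note V = has_trace_L2(2)[OF trV]
    define Z where "Z n x = 1 *\<^sub>R G x + inverse (real (Suc n)) *\<^sub>R V x" for n x
    have Z: "Z n \<in> L2 M" for n unfolding Z_def by (intro L2_lincomb G V)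
    have "0 \<le> form (Z n) V" for n
    proof -
      have "energy G \<le> energy (Z n)"
        using has_trace_lincomb[OF \<Omega> tr trV, of 1 "inverse (Suc n)"] min by (simp add: Z_def[abs_def])
      moreover have "0 \<le> \<kappa> / 2 * (LINT x|M. (norm (G x - Z n x))\<^sup>2)" using pos by simp
      moreover have "form (Z n) (\<lambda>x. G x - Z n x) = - inverse (Suc n) * form (Z n) V"
        using form_scaleR[OF Z V, of n "- inverse (Suc n)"] by (simp add: Z_def)
      ultimately have "- inverse (Suc n) * form (Z n) V \<le> 0"
        using energy_tangent[OF Z G, of n] by linarith
      then show ?thesis by (simp add: zero_le_divide_iff zero_le_mult_iff)
    qed
    then show "\<exists>N. \<forall>n\<ge>N. 0 \<le> form (Z n) V" by blast
    show "(\<lambda>n. form (Z n) V) \<longlonglongrightarrow> form G V"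
      unfolding form_def
    proof (rule integral_dominated_convergence)
      show "(\<lambda>x. \<gamma> x (norm (G x)) * (G x \<bullet> V x)) \<in> borel_measurable M"
        "(\<lambda>x. \<gamma> x (norm (Z n x)) * (Z n x \<bullet> V x)) \<in> borel_measurable M" for n
        using form_integrable[OF G V] form_integrable[OF Z V] by auto
      show "integrable M (\<lambda>x. C * (norm (G x) * norm (V x) + (norm (V x))\<^sup>2))"
        using L2_mult_integrable[OF G V] L2_integrable[OF V] by simp
      show "AE x in M. (\<lambda>n. \<gamma> x (norm (Z n x)) * (Z n x \<bullet> V x)) \<longlonglongrightarrow> \<gamma> x (norm (G x)) * (G x \<bullet> V x)"
        using AE_continuous
      proof eventually_elim
        case (elim x)
        have "(\<lambda>n. Z n x) \<longlonglongrightarrow> 1 *\<^sub>R G x + 0 *\<^sub>R V x"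
          unfolding Z_def by (intro tendsto_intros LIMSEQ_inverse_real_of_nat)
        then have Zx: "(\<lambda>n. Z n x) \<longlonglongrightarrow> G x" by simp
        have "isCont (\<gamma> x) (norm (G x))"
          using elim by (simp add: continuous_on_eq_continuous_at)
        from isCont_tendsto_compose[OF this tendsto_norm[OF Zx]]
        show ?case by (intro tendsto_mult tendsto_inner Zx tendsto_const)
      qed
      show "AE x in M. norm (\<gamma> x (norm (Z n x)) * (Z n x \<bullet> V x)) \<le> C * (norm (G x) * norm (V x) + (norm (V x))\<^sup>2)" for n
        using bounds
      proof eventually_elim
        case (elim x)
        have g: "\<bar>\<gamma> x (norm (Z n x))\<bar> \<le> C" using elim pos by (smt (verit) norm_ge_zero)
        have "norm (Z n x) \<le> norm (G x) + inverse (real (Suc n)) * norm (V x)"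
          unfolding Z_def by (rule order_trans[OF norm_triangle_ineq]) simp
        also have "inverse (real (Suc n)) * norm (V x) \<le> 1 * norm (V x)"
          by (intro mult_right_mono) (auto simp: field_simps)
        finally have "norm (Z n x) * norm (V x) \<le> (norm (G x) + norm (V x)) * norm (V x)"
          by (intro mult_right_mono) auto
        then have "\<bar>Z n x \<bullet> V x\<bar> \<le> norm (G x) * norm (V x) + (norm (V x))\<^sup>2"
          using Cauchy_Schwarz_ineq2[of "Z n x" "V x"] by (simp add: power2_eq_square algebra_simps)
        from mult_mono[OF g this] order_trans[OF abs_ge_zero g] show ?case
          by (simp add: abs_mult)
      qed
    qed
  qed
  have "form G V = 0" if trV: "has_trace \<Omega> v V (\<lambda>x. 0)" for v V
    using nonneg[OF trV] nonneg[of "\<lambda>x. - 1 * v x" "\<lambda>x. - 1 *\<^sub>R V x"] trace_scale[OF trV, of "-1"]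
      form_scaleR[OF G has_trace_L2(2)[OF trV], of "-1"] by simp
  then show ?thesis using tr that by (auto simp: weak_solution_iff)
qed

lemma H_half_scale: "f \<in> H_half \<Omega> \<Longrightarrow> (\<lambda>x. a * f x) \<in> H_half \<Omega>"
  unfolding H_half_def using trace_scale by blast

lemma avg_DtN_eq_energy:
  assumes sol: "weak_solution \<Omega> \<gamma> f u G"
  shows "avg_DtN \<Omega> \<gamma> f f = energy G"
proof -
  have tr: "has_trace \<Omega> u G f" using sol by (simp add: weak_solution_iff)
  then have "f \<in> H_half \<Omega>" by (auto simp: H_half_def)
  then have "\<forall>\<alpha>. \<exists>p. weak_solution \<Omega> \<gamma> (\<lambda>x. \<alpha> * f x) (fst p) (snd p)"
    using weak_solution_exists[OF H_half_scale, of f] by (metis fst_conv snd_conv)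
  from choice[OF this] obtain p where
    p: "weak_solution \<Omega> \<gamma> (\<lambda>x. \<alpha> * f x) (fst (p \<alpha>)) (snd (p \<alpha>))" for \<alpha>
    by blast
  define D where "D \<alpha> = snd (p \<alpha>)" for \<alpha>
  have solD: "weak_solution \<Omega> \<gamma> (\<lambda>x. \<alpha> * f x) (fst (p \<alpha>)) (D \<alpha>)" for \<alpha>
    using p by (simp add: D_def)
  have trD: "has_trace \<Omega> (fst (p \<alpha>)) (D \<alpha>) (\<lambda>x. \<alpha> * f x)" for \<alpha>
    using solD[of \<alpha>] by (simp add: weak_solution_iff)
  note D = has_trace_L2(2)[OF trD]
  have "energy (D \<alpha>) + (\<beta> - \<alpha>) * DtN \<Omega> \<gamma> (\<lambda>x. \<alpha> * f x) f \<le> energy (D \<beta>)" for \<alpha> \<beta>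
  proof -
    have "has_trace \<Omega> (\<lambda>x. 1 * fst (p \<beta>) x + (-1) * fst (p \<alpha>) x) (\<lambda>x. 1 *\<^sub>R D \<beta> x + (-1) *\<^sub>R D \<alpha> x)
        (\<lambda>x. (\<beta> - \<alpha>) * f x)"
      using has_trace_lincomb[OF \<Omega> trD[of \<beta>] trD[of \<alpha>], of 1 "-1"] by (simp add: algebra_simps)
    then have "form (D \<alpha>) (\<lambda>x. D \<beta> x - D \<alpha> x) = form (D \<alpha>) (\<lambda>x. (\<beta> - \<alpha>) *\<^sub>R G x)"
      using form_eq_of_trace_eq[OF solD _ trace_scale[OF tr]] by simp
    also have "\<dots> = (\<beta> - \<alpha>) * DtN \<Omega> \<gamma> (\<lambda>x. \<alpha> * f x) f"
      by (simp add: form_scaleR[OF D has_trace_L2(2)[OF tr]] DtN_eq[OF solD tr])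
    finally have "energy (D \<alpha>) + (\<beta> - \<alpha>) * DtN \<Omega> \<gamma> (\<lambda>x. \<alpha> * f x) f +
        \<kappa> / 2 * (LINT x|M. (norm (D \<beta> x - D \<alpha> x))\<^sup>2) \<le> energy (D \<beta>)"
      using energy_tangent[OF D D, of \<alpha> \<beta>] by simp
    moreover have "0 \<le> \<kappa> / 2 * (LINT x|M. (norm (D \<beta> x - D \<alpha> x))\<^sup>2)" using pos by simp
    ultimately show ?thesis by linarith
  qed
  from subgradient_has_integral[OF this]
  have "avg_DtN \<Omega> \<gamma> f f = energy (D 1) - energy (D 0)"
    unfolding avg_DtN_def by (rule integral_unique)
  moreover have "energy (D 0) = 0"
  proof (rule antisym)
    have "energy (D 0) \<le> energy (\<lambda>x. 0 *\<^sub>R G x)"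
      by (rule weak_solution_energy_le[OF solD trace_scale[OF tr]])
    then show "energy (D 0) \<le> 0" by (simp add: energy_def)
  qed (rule energy_nonneg[OF D])
  moreover have "energy (D 1) = energy G"
    using weak_solution_energy_le[OF sol, of "fst (p 1)" "D 1"] weak_solution_energy_le[OF solD[of 1], of u G] tr trD[of 1]
    by simp
  ultimately show ?thesis by simp
qed

end

section \<open>Linear materials\<close>

locale linear_material = material \<Omega> "\<lambda>x s. g x" c C \<kappa>
  for \<Omega> :: "'a::euclidean_space set" and g c C \<kappa>
begin

lemma form_sym: "form G W = form W G"
  by (simp add: form_def inner_commute)

lemma form_lincomb_left:
  assumes "G \<in> L2 M" "W \<in> L2 M" "V \<in> L2 M"
  shows "form (\<lambda>x. a *\<^sub>R W x + b *\<^sub>R V x) G = a * form W G + b * form V G"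
  using form_lincomb[OF assms] by (simp add: form_sym[of _ G])

lemma weak_solution_lincomb:
  assumes "weak_solution \<Omega> (\<lambda>x s. g x) f u G" "weak_solution \<Omega> (\<lambda>x s. g x) h v W"
  shows "weak_solution \<Omega> (\<lambda>x s. g x) (\<lambda>x. a * f x + b * h x) (\<lambda>x. a * u x + b * v x)
    (\<lambda>x. a *\<^sub>R G x + b *\<^sub>R W x)"
  unfolding weak_solution_iff
proof (intro conjI allI impI)
  have tr: "has_trace \<Omega> u G f" "has_trace \<Omega> v W h" using assms by (auto simp: weak_solution_iff)
  then show "has_trace \<Omega> (\<lambda>x. a * u x + b * v x) (\<lambda>x. a *\<^sub>R G x + b *\<^sub>R W x) (\<lambda>x. a * f x + b * h x)"
    by (rule has_trace_lincomb[OF \<Omega>])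
  fix v' V assume V: "has_trace \<Omega> v' V (\<lambda>x. 0)"
  then show "form (\<lambda>x. a *\<^sub>R G x + b *\<^sub>R W x) V = 0"
    using assms form_lincomb_left[OF has_trace_L2(2)[OF V] has_trace_L2(2)[OF tr(1)] has_trace_L2(2)[OF tr(2)]]
    by (auto simp: weak_solution_iff)
qed

lemma DtN_sym:
  assumes "f \<in> H_half \<Omega>" "h \<in> H_half \<Omega>"
  shows "DtN \<Omega> (\<lambda>x s. g x) f h = DtN \<Omega> (\<lambda>x s. g x) h f"
proof -
  obtain u G where f: "weak_solution \<Omega> (\<lambda>x s. g x) f u G" using weak_solution_exists[OF assms(1)] .
  obtain v W where h: "weak_solution \<Omega> (\<lambda>x s. g x) h v W" using weak_solution_exists[OF assms(2)] .
  have "has_trace \<Omega> u G f" "has_trace \<Omega> v W h" using f h by (auto simp: weak_solution_iff)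
  then show ?thesis using DtN_eq[OF f] DtN_eq[OF h] by (simp add: form_sym[of G])
qed

lemma DtN_lincomb:
  assumes "f \<in> H_half \<Omega>" "h \<in> H_half \<Omega>" "\<psi> \<in> H_half \<Omega>"
  shows "DtN \<Omega> (\<lambda>x s. g x) (\<lambda>x. a * f x + b * h x) \<psi> =
    a * DtN \<Omega> (\<lambda>x s. g x) f \<psi> + b * DtN \<Omega> (\<lambda>x s. g x) h \<psi>"
proof -
  obtain u G where f: "weak_solution \<Omega> (\<lambda>x s. g x) f u G" using weak_solution_exists[OF assms(1)] .
  obtain v W where h: "weak_solution \<Omega> (\<lambda>x s. g x) h v W" using weak_solution_exists[OF assms(2)] .
  obtain z Z where z: "has_trace \<Omega> z Z \<psi>" using assms(3) by (auto simp: H_half_def)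
  have "has_trace \<Omega> u G f" "has_trace \<Omega> v W h" using f h by (auto simp: weak_solution_iff)
  then show ?thesis
    using DtN_eq[OF f z] DtN_eq[OF h z] DtN_eq[OF weak_solution_lincomb[OF f h] z, of a b]
      form_lincomb_left[of Z G W a b] has_trace_L2(2) z by metis
qed

lemma H_half_lincomb:
  "f \<in> H_half \<Omega> \<Longrightarrow> h \<in> H_half \<Omega> \<Longrightarrow> (\<lambda>x. a * f x + b * h x) \<in> H_half \<Omega>"
  unfolding H_half_def using has_trace_lincomb[OF \<Omega>] by blast

lemma DtN_sum:
  assumes "finite S" "S \<subseteq> H_half \<Omega>" "\<psi> \<in> H_half \<Omega>"
  shows "(\<lambda>x. \<Sum>\<phi>\<in>S. a \<phi> * \<phi> x) \<in> H_half \<Omega> \<and>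
    DtN \<Omega> (\<lambda>x s. g x) (\<lambda>x. \<Sum>\<phi>\<in>S. a \<phi> * \<phi> x) \<psi> = (\<Sum>\<phi>\<in>S. a \<phi> * DtN \<Omega> (\<lambda>x s. g x) \<phi> \<psi>)"
  using assms(1,2)
proof induction
  case empty
  then show ?case
    using DtN_lincomb[OF assms(3) assms(3) assms(3), of 0 0] H_half_lincomb[OF assms(3) assms(3), of 0 0]
    by simp
next
  case (insert \<phi> S)
  then show ?case
    using DtN_lincomb[of \<phi> "\<lambda>x. \<Sum>\<phi>\<in>S. a \<phi> * \<phi> x" \<psi> "a \<phi>" 1]
      H_half_lincomb[of \<phi> "\<lambda>x. \<Sum>\<phi>\<in>S. a \<phi> * \<phi> x" "a \<phi>" 1] assms(3)
    by simp
qed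

end

section \<open>The span of the negative eigenfunctions\<close>

text \<open>
  Eigenfunctions of a symmetric form for distinct eigenvalues are orthogonal, so
  \<open>(d\<^sub>i - \<delta>) m\<^sub>i\<^sub>j = - r\<^sub>i r\<^sub>j m\<^sub>i\<^sub>j\<close> for the Gram matrix \<open>m\<close>, the largest eigenvalue \<open>\<delta>\<close> and
  \<open>r\<^sub>i = sqrt (\<delta> - d\<^sub>i)\<close>. Hence \<open>L f f - \<delta> |f|\<^sup>2\<close> is minus a square.
\<close>

lemma negative_on_eigenspan:
  fixes \<Omega> :: "'a::euclidean_space set"
  assumes sum: "\<And>S a \<psi>. finite S \<Longrightarrow> S \<subseteq> H_half \<Omega> \<Longrightarrow> \<psi> \<in> H_half \<Omega> \<Longrightarrow>
      (\<lambda>x. \<Sum>\<phi>\<in>S. a \<phi> * \<phi> x) \<in> H_half \<Omega> \<and>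
      L (\<lambda>x. \<Sum>\<phi>\<in>S. a \<phi> * \<phi> x) \<psi> = (\<Sum>\<phi>\<in>S. a \<phi> * L \<phi> \<psi>)"
    and sym: "\<And>\<phi> \<psi>. \<phi> \<in> H_half \<Omega> \<Longrightarrow> \<psi> \<in> H_half \<Omega> \<Longrightarrow> L \<phi> \<psi> = L \<psi> \<phi>"
    and f: "f \<in> fun_span {\<phi>. \<exists>\<delta><0. eigenfunction \<Omega> L \<delta> \<phi>}" and nz: "bdry_nonzero \<Omega> f"
  shows "f \<in> H_half \<Omega>" "L f f < 0"
proof -
  let ?S = "surface_measure \<Omega>"
  obtain S a where S: "finite S" "S \<subseteq> {\<phi>. \<exists>\<delta><0. eigenfunction \<Omega> L \<delta> \<phi>}"
    and f_eq: "f = (\<lambda>x. \<Sum>\<phi>\<in>S. a \<phi> * \<phi> x)"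
    using f by (auto simp: fun_span_def)
  have "\<forall>\<phi>\<in>S. \<exists>\<delta><0. eigenfunction \<Omega> L \<delta> \<phi>" using S(2) by blast
  from bchoice[OF this] obtain d where d: "\<And>\<phi>. \<phi> \<in> S \<Longrightarrow> d \<phi> < 0 \<and> eigenfunction \<Omega> L (d \<phi>) \<phi>"
    by blast
  have X: "\<phi> \<in> X_diamond \<Omega>" if "\<phi> \<in> S" for \<phi> using d[OF that] by (simp add: eigenfunction_def)
  then have SH: "S \<subseteq> H_half \<Omega>" by (auto simp: X_diamond_def)
  then have L2: "\<phi> \<in> L2 ?S" if "\<phi> \<in> S" for \<phi>
    using that by (auto simp: H_half_def dest: has_trace_L2(3))
  have "S \<noteq> {}" using nz by (auto simp: f_eq bdry_nonzero_def)
  obtain \<phi>0 where "\<phi>0 \<in> S" using \<open>S \<noteq> {}\<close> by blast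
  show fH: "f \<in> H_half \<Omega>"
    unfolding f_eq using sum[OF S(1) SH, of \<phi>0] SH \<open>\<phi>0 \<in> S\<close> by blast
  have fL2: "f \<in> L2 ?S" using fH by (auto simp: H_half_def dest: has_trace_L2(3))
  define m where "m \<phi> \<psi> = (LINT x|?S. \<phi> x * \<psi> x)" for \<phi> \<psi> :: "'a \<Rightarrow> real"
  have m_sym: "m \<phi> \<psi> = m \<psi> \<phi>" for \<phi> \<psi> by (simp add: m_def mult.commute)
  have Lm: "L \<phi> \<psi> = d \<phi> * m \<phi> \<psi>" if "\<phi> \<in> S" "\<psi> \<in> S" for \<phi> \<psi>
    using d[OF that(1)] X[OF that(2)] by (simp add: eigenfunction_def m_def)
  have orth: "d \<phi> = d \<psi> \<or> m \<phi> \<psi> = 0" if "\<phi> \<in> S" "\<psi> \<in> S" for \<phi> \<psi>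
    using Lm[OF that] Lm[OF that(2,1)] sym[of \<phi> \<psi>] SH that m_sym[of \<phi> \<psi>] by auto
  have square: "(LINT x|?S. (\<Sum>\<phi>\<in>S. b \<phi> * \<phi> x)\<^sup>2) = (\<Sum>\<phi>\<in>S. \<Sum>\<psi>\<in>S. b \<phi> * b \<psi> * m \<phi> \<psi>)" for b
  proof -
    have int: "integrable ?S (\<lambda>x. b \<phi> * b \<psi> * (\<phi> x * \<psi> x))" if "\<phi> \<in> S" "\<psi> \<in> S" for \<phi> \<psi>
      using L2_real_mult_integrable[OF L2[OF that(1)] L2[OF that(2)]] by (rule integrable_mult_right)
    have "(\<Sum>\<phi>\<in>S. b \<phi> * \<phi> x)\<^sup>2 = (\<Sum>\<phi>\<in>S. \<Sum>\<psi>\<in>S. b \<phi> * b \<psi> * (\<phi> x * \<psi> x))" for x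
      by (simp add: power2_eq_square sum_product algebra_simps)
    then have "(LINT x|?S. (\<Sum>\<phi>\<in>S. b \<phi> * \<phi> x)\<^sup>2) = (LINT x|?S. (\<Sum>\<phi>\<in>S. \<Sum>\<psi>\<in>S. b \<phi> * b \<psi> * (\<phi> x * \<psi> x)))"
      by simp
    also have "\<dots> = (\<Sum>\<phi>\<in>S. LINT x|?S. (\<Sum>\<psi>\<in>S. b \<phi> * b \<psi> * (\<phi> x * \<psi> x)))"
      by (rule Bochner_Integration.integral_sum) (rule Bochner_Integration.integrable_sum, rule int)
    also have "\<dots> = (\<Sum>\<phi>\<in>S. \<Sum>\<psi>\<in>S. LINT x|?S. b \<phi> * b \<psi> * (\<phi> x * \<psi> x))"
      by (rule sum.cong[OF refl], rule Bochner_Integration.integral_sum, rule int)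
    also have "\<dots> = (\<Sum>\<phi>\<in>S. \<Sum>\<psi>\<in>S. b \<phi> * b \<psi> * m \<phi> \<psi>)"
      by (simp add: m_def)
    finally show ?thesis .
  qed
  define \<delta> where "\<delta> = Max (d ` S)"
  have \<delta>: "\<delta> < 0" "\<And>\<phi>. \<phi> \<in> S \<Longrightarrow> d \<phi> \<le> \<delta>"
    unfolding \<delta>_def using S(1) \<open>S \<noteq> {}\<close> d by (auto simp: Max_less_iff)
  define r where "r \<phi> = sqrt (\<delta> - d \<phi>)" for \<phi>
  have dm: "d \<phi> * m \<phi> \<psi> = \<delta> * m \<phi> \<psi> - r \<phi> * r \<psi> * m \<phi> \<psi>" if "\<phi> \<in> S" "\<psi> \<in> S" for \<phi> \<psi>
  proof -
    have "r \<phi> * r \<phi> = \<delta> - d \<phi>" using \<delta>(2)[OF that(1)] by (simp add: r_def)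
    then show ?thesis using orth[OF that] by (auto simp: r_def algebra_simps)
  qed
  have Lf: "L f \<psi> = (\<Sum>\<phi>\<in>S. a \<phi> * L \<phi> \<psi>)" if "\<psi> \<in> H_half \<Omega>" for \<psi>
    unfolding f_eq using sum[OF S(1) SH that] by blast
  have "L f f = (\<Sum>\<phi>\<in>S. a \<phi> * L \<phi> f)"
    by (rule Lf[OF fH])
  also have "\<dots> = (\<Sum>\<phi>\<in>S. a \<phi> * (\<Sum>\<psi>\<in>S. a \<psi> * L \<psi> \<phi>))"
  proof (intro sum.cong refl arg_cong2[of _ _ _ _ "(*)"])
    fix \<phi> assume "\<phi> \<in> S"
    then have "\<phi> \<in> H_half \<Omega>" using SH by blast
    then show "L \<phi> f = (\<Sum>\<psi>\<in>S. a \<psi> * L \<psi> \<phi>)"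
      using sym[OF _ fH] Lf by simp
  qed
  also have "\<dots> = (\<Sum>\<phi>\<in>S. \<Sum>\<psi>\<in>S. \<delta> * (a \<phi> * a \<psi> * m \<phi> \<psi>) - (a \<phi> * r \<phi>) * (a \<psi> * r \<psi>) * m \<phi> \<psi>)"
    unfolding sum_distrib_left
  proof (intro sum.cong refl)
    fix \<phi> \<psi> assume "\<phi> \<in> S" "\<psi> \<in> S"
    then have L\<psi>: "L \<psi> \<phi> = \<delta> * m \<phi> \<psi> - r \<psi> * r \<phi> * m \<phi> \<psi>"
      using Lm[of \<psi> \<phi>] dm[of \<psi> \<phi>] by (simp add: m_sym[of \<psi> \<phi>])
    show "a \<phi> * (a \<psi> * L \<psi> \<phi>) =
        \<delta> * (a \<phi> * a \<psi> * m \<phi> \<psi>) - (a \<phi> * r \<phi>) * (a \<psi> * r \<psi>) * m \<phi> \<psi>"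
      unfolding L\<psi> by (simp add: algebra_simps)
  qed
  also have "\<dots> = \<delta> * (LINT x|?S. (f x)\<^sup>2) - (LINT x|?S. (\<Sum>\<phi>\<in>S. (a \<phi> * r \<phi>) * \<phi> x)\<^sup>2)"
    unfolding square[of "\<lambda>\<phi>. a \<phi> * r \<phi>"] f_eq square[of a]
    by (simp add: sum_subtractf sum_distrib_left)
  also have "\<dots> \<le> \<delta> * (LINT x|?S. (f x)\<^sup>2)" by simp
  also have "\<dots> < 0"
  proof -
    have "(LINT x|?S. (f x)\<^sup>2) \<noteq> 0"
    proof
      assume "(LINT x|?S. (f x)\<^sup>2) = 0"
      then have "AE x in ?S. (f x)\<^sup>2 = 0"
        using L2_integrable[OF fL2] by (subst (asm) integral_nonneg_eq_0_iff_AE) auto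
      then show False using nz by (simp add: bdry_nonzero_def)
    qed
    then have "0 < (LINT x|?S. (f x)\<^sup>2)"
      by (simp add: less_le)
    then show ?thesis using \<delta>(1) by (simp add: mult_neg_pos)
  qed
  finally show "L f f < 0" .
qed

section \<open>Comparison of nonlinear and linear materials\<close>

lemma avg_DtN_le_linear:
  assumes "material \<Omega> \<gamma> c C \<kappa>" "linear_material \<Omega> g c' C' \<kappa>'"
    and le: "AE x in lebesgue_on \<Omega>. \<forall>s\<ge>0. \<gamma> x s \<le> g x"
    and f: "f \<in> H_half \<Omega>"
  shows "avg_DtN \<Omega> \<gamma> (\<lambda>x. t * f x) (\<lambda>x. t * f x) \<le> t\<^sup>2 / 2 * DtN \<Omega> (\<lambda>x s. g x) f f"
proof -
  interpret N: material \<Omega> \<gamma> c C \<kappa> by fact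
  interpret L: linear_material \<Omega> g c' C' \<kappa>' by fact
  obtain u G where sol: "weak_solution \<Omega> (\<lambda>x s. g x) f u G" using L.weak_solution_exists[OF f] .
  then have tr: "has_trace \<Omega> u G f" by (simp add: L.weak_solution_iff)
  note G = has_trace_L2(2)[OF tr]
  obtain v W where sol': "weak_solution \<Omega> \<gamma> (\<lambda>x. t * f x) v W"
    using N.weak_solution_exists[OF N.H_half_scale[OF f]] .
  have "avg_DtN \<Omega> \<gamma> (\<lambda>x. t * f x) (\<lambda>x. t * f x) = N.energy W"
    by (rule N.avg_DtN_eq_energy[OF sol'])
  also have "\<dots> \<le> N.energy (\<lambda>x. t *\<^sub>R G x)"
    by (rule N.weak_solution_energy_le[OF sol' N.trace_scale[OF tr]])
  also have "\<dots> \<le> (LINT x|lebesgue_on \<Omega>. t\<^sup>2 / 2 * (g x * (G x \<bullet> G x)))"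
    unfolding N.energy_def
  proof (rule integral_mono_AE)
    show "AE x in lebesgue_on \<Omega>. potential (\<gamma> x) (norm (t *\<^sub>R G x)) \<le> t\<^sup>2 / 2 * (g x * (G x \<bullet> G x))"
      using le N.AE_continuous
    proof eventually_elim
      case (elim x)
      then have "potential (\<gamma> x) (norm (t *\<^sub>R G x)) \<le> g x / 2 * (norm (t *\<^sub>R G x))\<^sup>2"
        by (intro potential_le) auto
      then show ?case
        by (simp add: power_mult_distrib mult_ac flip: power2_norm_eq_inner)
    qed
    show "integrable (lebesgue_on \<Omega>) (\<lambda>x. t\<^sup>2 / 2 * (g x * (G x \<bullet> G x)))"
      using L.form_integrable[OF G G] by simp
  qed (intro N.potential_integrable L2_scaleR G)
  also have "\<dots> = t\<^sup>2 / 2 * DtN \<Omega> (\<lambda>x s. g x) f f"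
    using L.DtN_eq[OF sol tr] by (simp add: L.form_def)
  finally show ?thesis .
qed

text \<open>
  Where \<open>|b| \<le> sM\<close>, the tangent of \<open>q s\<^sup>2 / 2\<close> at \<open>|b|\<close> lies below the potential everywhere, also
  beyond \<open>sM\<close>, since there the flux \<open>h s s\<close> keeps increasing.
\<close>

lemma potential_ge_quadratic_tangent:
  fixes a b :: "'b::real_inner"
  assumes cont: "continuous_on UNIV h" and mono: "mono_on {0..} (\<lambda>r. (h r - k) * r)" and k: "0 \<le> k"
    and h: "\<And>r. 0 \<le> r \<Longrightarrow> r \<le> sM \<Longrightarrow> q \<le> h r" and q: "0 \<le> q" and b: "norm b \<le> sM"
  shows "q * (b \<bullet> a - (norm b)\<^sup>2 / 2) \<le> potential h (norm a)"
proof -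
  let ?r = "norm b" and ?s = "norm a"
  have "q * (b \<bullet> a - ?r\<^sup>2 / 2) \<le> q * (?r * ?s - ?r\<^sup>2 / 2)"
    using norm_cauchy_schwarz[of b a] q by (intro mult_left_mono) auto
  also have "\<dots> \<le> potential h ?s"
  proof (cases "?r \<le> ?s")
    case True
    have "q / 2 * ?r\<^sup>2 \<le> potential h ?r" using b by (intro potential_ge[OF cont] h) auto
    moreover have "q * (?r * (?s - ?r)) \<le> h ?r * (?r * (?s - ?r))"
      using True b by (intro mult_right_mono h) auto
    moreover have "0 \<le> k / 2 * (?s - ?r)\<^sup>2" using k by simp
    ultimately show ?thesis
      using potential_tangent[OF cont mono, of ?r ?s] by (simp add: power2_eq_square algebra_simps)
  next
    case False
    have "q / 2 * ?s\<^sup>2 \<le> potential h ?s" using b False by (intro potential_ge[OF cont] h) auto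
    moreover have "0 \<le> q * (?s - ?r)\<^sup>2" using q by simp
    ultimately show ?thesis by (simp add: power2_eq_square algebra_simps)
  qed
  finally show ?thesis .
qed

lemma avg_DtN_ge_linear:
  assumes "material \<Omega> \<gamma> c C \<kappa>" "linear_material \<Omega> g c' C' \<kappa>'"
    and ge: "AE x in lebesgue_on \<Omega>. \<forall>s. 0 \<le> s \<longrightarrow> s \<le> sM \<longrightarrow> g x \<le> \<gamma> x s" and sM: "0 < sM"
    and f: "f \<in> H_half \<Omega>" and \<epsilon>: "0 < \<epsilon>"
  shows "\<exists>t0>0. \<forall>t. 0 < t \<and> t < t0 \<longrightarrow>
    t\<^sup>2 * (DtN \<Omega> (\<lambda>x s. g x) f f / 2 - \<epsilon>) \<le> avg_DtN \<Omega> \<gamma> (\<lambda>x. t * f x) (\<lambda>x. t * f x)"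
proof -
  interpret N: material \<Omega> \<gamma> c C \<kappa> by fact
  interpret L: linear_material \<Omega> g c' C' \<kappa>' by fact
  let ?M = "lebesgue_on \<Omega>"
  obtain u b where sol: "weak_solution \<Omega> (\<lambda>x s. g x) f u b" using L.weak_solution_exists[OF f] .
  then have tr: "has_trace \<Omega> u b f" by (simp add: L.weak_solution_iff)
  note b = has_trace_L2(2)[OF tr]
  note [measurable] = L2_measurable[OF b]
  define D where "D = DtN \<Omega> (\<lambda>x s. g x) f f"
  have D: "D = L.form b b" unfolding D_def by (rule L.DtN_eq[OF sol tr])
  define n where "n = (LINT x|?M. (norm (b x))\<^sup>2)"
  define K where "K = \<bar>C'\<bar> * \<bar>C\<bar> / c * n"
  have K: "0 \<le> K" unfolding K_def n_def using N.pos by simp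
  define \<eta> where "\<eta> = \<epsilon> / (K + 1)"
  have \<eta>: "0 < \<eta>" "K * \<eta> \<le> \<epsilon>" using K \<epsilon> by (auto simp: \<eta>_def field_simps)
  define r where "r t x = (if t * norm (b x) \<le> sM then 0 else b x)" for t x
  have [measurable]: "r t \<in> borel_measurable ?M" for t unfolding r_def by measurable
  have r_le: "norm (r t x) \<le> norm (b x)" for t x by (simp add: r_def)
  have r: "r t \<in> L2 ?M" for t
    unfolding L2_def using L2_integrable[OF b] r_le
    by (auto intro!: Bochner_Integration.integrable_bound[OF L2_integrable[OF b]] power_mono)
  have "(\<lambda>k. LINT x|?M. (norm (r (inverse (real (Suc k))) x))\<^sup>2) \<longlonglongrightarrow> (LINT x|?M. 0)"
  proof (rule integral_dominated_convergence[where w = "\<lambda>x. (norm (b x))\<^sup>2"])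
    show "AE x in ?M. (\<lambda>k. (norm (r (inverse (real (Suc k))) x))\<^sup>2) \<longlonglongrightarrow> 0"
    proof (intro AE_I2 tendsto_eventually)
      fix x
      have "(\<lambda>k. inverse (real (Suc k)) * norm (b x)) \<longlonglongrightarrow> 0 * norm (b x)"
        by (rule tendsto_mult[OF LIMSEQ_inverse_real_of_nat tendsto_const])
      then have "\<forall>\<^sub>F k in sequentially. inverse (real (Suc k)) * norm (b x) < sM"
        using sM by (intro order_tendstoD(2)) auto
      then show "\<forall>\<^sub>F k in sequentially. (norm (r (inverse (real (Suc k))) x))\<^sup>2 = 0"
        by eventually_elim (simp add: r_def)
    qed
  qed (use L2_integrable[OF b] r_le in \<open>auto intro!: power_mono\<close>)
  then have "\<forall>\<^sub>F k in sequentially. (LINT x|?M. (norm (r (inverse (real (Suc k))) x))\<^sup>2) < \<epsilon> * \<eta> / (\<bar>C'\<bar> + 1)"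
    using \<epsilon> \<eta> by (intro order_tendstoD(2)) auto
  then obtain k where k: "(LINT x|?M. (norm (r (inverse (real (Suc k))) x))\<^sup>2) < \<epsilon> * \<eta> / (\<bar>C'\<bar> + 1)"
    using eventually_happens by fastforce
  have "t\<^sup>2 * (D / 2 - \<epsilon>) \<le> avg_DtN \<Omega> \<gamma> (\<lambda>x. t * f x) (\<lambda>x. t * f x)"
    if t: "0 < t" "t < inverse (real (Suc k))" for t
  proof -
    obtain v G where sol': "weak_solution \<Omega> \<gamma> (\<lambda>x. t * f x) v G"
      using N.weak_solution_exists[OF N.H_half_scale[OF f]] .
    then have tr': "has_trace \<Omega> v G (\<lambda>x. t * f x)" by (simp add: N.weak_solution_iff)
    note G = has_trace_L2(2)[OF tr']
    define \<rho> where "\<rho> = (LINT x|?M. (norm (r t x))\<^sup>2)"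
    define \<nu> where "\<nu> = (LINT x|?M. (norm (G x))\<^sup>2)"
    have "\<rho> \<le> (LINT x|?M. (norm (r (inverse (real (Suc k))) x))\<^sup>2)"
      unfolding \<rho>_def
    proof (intro integral_mono L2_integrable r power_mono)
      fix x
      have "t * norm (b x) \<le> inverse (real (Suc k)) * norm (b x)"
        using t by (intro mult_right_mono) auto
      then show "norm (r t x) \<le> norm (r (inverse (real (Suc k))) x)"
        by (auto simp: r_def)
    qed auto
    also have "\<dots> \<le> \<epsilon> * \<eta> / (\<bar>C'\<bar> + 1)"
      using k by (rule less_imp_le)
    finally have "(\<bar>C'\<bar> + 1) * \<rho> \<le> \<epsilon> * \<eta>"
      by (simp add: pos_le_divide_eq mult.commute)
    moreover have "0 \<le> \<rho>" by (simp add: \<rho>_def)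
    ultimately have \<rho>: "\<bar>C'\<bar> * \<rho> \<le> \<epsilon> * \<eta>" by (simp add: algebra_simps)
    have \<nu>: "c * \<nu> \<le> \<bar>C\<bar> * t\<^sup>2 * n"
    proof -
      have "c / 2 * \<nu> \<le> N.energy G" unfolding \<nu>_def by (rule N.energy_bounds[OF G])
      also have "\<dots> \<le> N.energy (\<lambda>x. t *\<^sub>R b x)"
        by (rule N.weak_solution_energy_le[OF sol' N.trace_scale[OF tr]])
      also have "\<dots> \<le> C / 2 * (LINT x|?M. (norm (t *\<^sub>R b x))\<^sup>2)"
        by (rule N.energy_bounds[OF L2_scaleR[OF b]])
      also have "(LINT x|?M. (norm (t *\<^sub>R b x))\<^sup>2) = t\<^sup>2 * n"
        by (simp add: power_mult_distrib n_def)
      also have "C / 2 * (t\<^sup>2 * n) \<le> \<bar>C\<bar> / 2 * (t\<^sup>2 * n)"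
        unfolding n_def by (intro mult_right_mono) auto
      finally show ?thesis by simp
    qed
    let ?low = "\<lambda>x. t * (g x * (b x \<bullet> G x)) - t\<^sup>2 / 2 * (g x * (b x \<bullet> b x)) -
        \<bar>C'\<bar> * \<eta> / 2 * (norm (G x))\<^sup>2 - \<bar>C'\<bar> * t\<^sup>2 / (2 * \<eta>) * (norm (r t x))\<^sup>2"
    have "(LINT x|?M. ?low x) \<le> N.energy G"
      unfolding N.energy_def
    proof (rule integral_mono_AE)
      show "integrable ?M ?low"
        using L.form_integrable[OF b G] L.form_integrable[OF b b] L2_integrable[OF G] L2_integrable[OF r]
        by simp
      show "AE x in ?M. ?low x \<le> potential (\<gamma> x) (norm (G x))"
        using ge L.bounds N.monotone N.AE_continuous
      proof eventually_elim
        case (elim x)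
        have gx: "0 \<le> g x" "g x \<le> \<bar>C'\<bar>" using elim(2) L.pos by (auto dest!: spec[of _ 0])
        define p where "p = t *\<^sub>R (b x - r t x)"
        have "norm p \<le> sM" "norm p \<le> t * norm (b x)" using t(1) sM by (auto simp: p_def r_def)
        have "(norm p)\<^sup>2 \<le> (t * norm (b x))\<^sup>2" using \<open>norm p \<le> t * norm (b x)\<close> by (intro power_mono) auto
        then have 1: "g x * (norm p)\<^sup>2 \<le> g x * (t\<^sup>2 * (norm (b x))\<^sup>2)"
          using gx by (intro mult_left_mono) (auto simp: power_mult_distrib)
        have "t * (r t x \<bullet> G x) \<le> \<eta> / 2 * (norm (G x))\<^sup>2 + t\<^sup>2 / (2 * \<eta>) * (norm (r t x))\<^sup>2"
        proof -
          have "t * (r t x \<bullet> G x) \<le> t * (norm (r t x) * norm (G x))"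
            using t(1) norm_cauchy_schwarz by (intro mult_left_mono) auto
          moreover have "0 \<le> (\<eta> * norm (G x) - t * norm (r t x))\<^sup>2 / (2 * \<eta>)" using \<eta>(1) by simp
          moreover have "(\<eta> * norm (G x) - t * norm (r t x))\<^sup>2 / (2 * \<eta>) = \<eta> / 2 * (norm (G x))\<^sup>2 -
              t * (norm (r t x) * norm (G x)) + t\<^sup>2 / (2 * \<eta>) * (norm (r t x))\<^sup>2"
            using \<eta>(1) by (simp add: power2_eq_square field_simps)
          ultimately show ?thesis by linarith
        qed
        then have "g x * (t * (r t x \<bullet> G x)) \<le> g x * (\<eta> / 2 * (norm (G x))\<^sup>2 + t\<^sup>2 / (2 * \<eta>) * (norm (r t x))\<^sup>2)"
          using gx by (intro mult_left_mono)
        also have "\<dots> \<le> \<bar>C'\<bar> * (\<eta> / 2 * (norm (G x))\<^sup>2 + t\<^sup>2 / (2 * \<eta>) * (norm (r t x))\<^sup>2)"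
          using gx \<eta>(1) by (intro mult_right_mono) auto
        finally have 2: "g x * (t * (r t x \<bullet> G x)) \<le>
            \<bar>C'\<bar> * \<eta> / 2 * (norm (G x))\<^sup>2 + \<bar>C'\<bar> * t\<^sup>2 / (2 * \<eta>) * (norm (r t x))\<^sup>2"
          by (simp add: algebra_simps)
        have 3: "g x * (p \<bullet> G x) = t * (g x * (b x \<bullet> G x)) - g x * (t * (r t x \<bullet> G x))"
          by (simp add: p_def inner_diff_left algebra_simps)
        have 4: "t\<^sup>2 / 2 * (g x * (b x \<bullet> b x)) = g x * (t\<^sup>2 * (norm (b x))\<^sup>2) / 2"
          by (simp add: power2_norm_eq_inner)
        have 5: "g x * (p \<bullet> G x - (norm p)\<^sup>2 / 2) = g x * (p \<bullet> G x) - g x * (norm p)\<^sup>2 / 2"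
          by (simp add: right_diff_distrib)
        have "?low x \<le> g x * (p \<bullet> G x - (norm p)\<^sup>2 / 2)"
          unfolding 3 4 5 using 1 2 by linarith
        also have "\<dots> \<le> potential (\<gamma> x) (norm (G x))"
          using elim N.pos gx \<open>norm p \<le> sM\<close>
          by (intro potential_ge_quadratic_tangent[where k = \<kappa> and sM = sM]) auto
        finally show ?case .
      qed
    qed (rule N.potential_integrable[OF G])
    also have "(LINT x|?M. ?low x) = t * L.form b G - t\<^sup>2 / 2 * L.form b b - \<bar>C'\<bar> * \<eta> / 2 * \<nu> -
        \<bar>C'\<bar> * t\<^sup>2 / (2 * \<eta>) * \<rho>"
      using L.form_integrable[OF b G] L.form_integrable[OF b b] L2_integrable[OF G] L2_integrable[OF r]
      by (simp add: L.form_def \<nu>_def \<rho>_def)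
    also have "L.form b G = t * D"
      using L.form_eq_of_trace_eq[OF sol tr' L.trace_scale[OF tr]] by (simp add: L.form_scaleR[OF b b] D)
    also have "N.energy G = avg_DtN \<Omega> \<gamma> (\<lambda>x. t * f x) (\<lambda>x. t * f x)"
      by (rule N.avg_DtN_eq_energy[OF sol', symmetric])
    finally have main: "t * (t * D) - t\<^sup>2 / 2 * D - \<bar>C'\<bar> * \<eta> / 2 * \<nu> - \<bar>C'\<bar> * t\<^sup>2 / (2 * \<eta>) * \<rho>
        \<le> avg_DtN \<Omega> \<gamma> (\<lambda>x. t * f x) (\<lambda>x. t * f x)"
      by (simp add: D)
    have "\<bar>C'\<bar> * \<eta> / 2 * \<nu> \<le> \<bar>C'\<bar> * \<eta> / 2 * (\<bar>C\<bar> * t\<^sup>2 * n / c)"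
      using \<nu> \<eta>(1) N.pos by (intro mult_left_mono) (auto simp: field_simps)
    also have "\<dots> = t\<^sup>2 / 2 * (K * \<eta>)" by (simp add: K_def)
    also have "\<dots> \<le> t\<^sup>2 / 2 * \<epsilon>" using \<eta>(2) by (intro mult_left_mono) auto
    finally have 1: "\<bar>C'\<bar> * \<eta> / 2 * \<nu> \<le> t\<^sup>2 / 2 * \<epsilon>" .
    have "\<bar>C'\<bar> * t\<^sup>2 / (2 * \<eta>) * \<rho> = t\<^sup>2 / (2 * \<eta>) * (\<bar>C'\<bar> * \<rho>)" by simp
    also have "\<dots> \<le> t\<^sup>2 / (2 * \<eta>) * (\<epsilon> * \<eta>)" using \<rho> \<eta>(1) by (intro mult_left_mono) auto
    also have "\<dots> = t\<^sup>2 / 2 * \<epsilon>" using \<eta>(1) by simp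
    finally have 2: "\<bar>C'\<bar> * t\<^sup>2 / (2 * \<eta>) * \<rho> \<le> t\<^sup>2 / 2 * \<epsilon>" .
    have "t\<^sup>2 * (D / 2 - \<epsilon>) = t * (t * D) - t\<^sup>2 / 2 * D - t\<^sup>2 / 2 * \<epsilon> - t\<^sup>2 / 2 * \<epsilon>"
      by (simp add: power2_eq_square field_simps)
    then show ?thesis using main 1 2 by linarith
  qed
  then show ?thesis
    unfolding D_def by (intro exI[of _ "inverse (real (Suc k))"]) auto
qed

section \<open>The materials of the theorem\<close>

text \<open>Replaces a law that is only continuous on \<open>{0..}\<close> by one that is continuous on the whole line.\<close>

lemma DtN_nonneg_arguments: "DtN \<Omega> \<gamma> = DtN \<Omega> (\<lambda>x s. \<gamma> x (max 0 s))"
  by (intro ext) (simp add: DtN_def weak_solution_def)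

lemma mono_flux_weaken:
  fixes h :: "real \<Rightarrow> real"
  assumes "mono_on {0..} (\<lambda>s. (h s - k) * s)" "k' \<le> k"
  shows "mono_on {0..} (\<lambda>s. (h s - k') * s)"
proof (rule mono_onI)
  fix r s :: real assume rs: "r \<in> {0..}" "s \<in> {0..}" "r \<le> s"
  have "(h r - k) * r + (k - k') * r \<le> (h s - k) * s + (k - k') * s"
    using assms rs by (intro add_mono mono_onD[OF assms(1)] mult_left_mono) auto
  then show "(h r - k') * r \<le> (h s - k') * s" by (simp add: algebra_simps)
qed

lemma material_if:
  assumes "material \<Omega> \<gamma>1 c1 C1 \<kappa>1" "material \<Omega> \<gamma>2 c2 C2 \<kappa>2" and A: "A \<in> sets (lebesgue_on \<Omega>)"
  shows "material \<Omega> (\<lambda>x s. if x \<in> A then \<gamma>1 x s else \<gamma>2 x s) (min c1 c2) (max C1 C2) (min \<kappa>1 \<kappa>2)"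
proof -
  interpret m1: material \<Omega> \<gamma>1 c1 C1 \<kappa>1 by fact
  interpret m2: material \<Omega> \<gamma>2 c2 C2 \<kappa>2 by fact
  show ?thesis
  proof
    note [measurable] = m1.measurable_law[unfolded case_prod_beta'] m2.measurable_law[unfolded case_prod_beta'] A
    show "(\<lambda>(x, s). if x \<in> A then \<gamma>1 x s else \<gamma>2 x s) \<in> borel_measurable (lebesgue_on \<Omega> \<Otimes>\<^sub>M borel)"
      unfolding case_prod_beta' by measurable
    show "continuous_on UNIV (\<lambda>s. if x \<in> A then \<gamma>1 x s else \<gamma>2 x s)" if "x \<in> \<Omega>" for x
      using m1.continuous_law[OF that] m2.continuous_law[OF that] by (cases "x \<in> A") auto
    show "AE x in lebesgue_on \<Omega>. \<forall>s\<ge>0. min c1 c2 \<le> (if x \<in> A then \<gamma>1 x s else \<gamma>2 x s) \<and>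
        (if x \<in> A then \<gamma>1 x s else \<gamma>2 x s) \<le> max C1 C2"
      using m1.bounds m2.bounds by eventually_elim (auto simp: min_le_iff_disj le_max_iff_disj)
    show "AE x in lebesgue_on \<Omega>. mono_on {0..} (\<lambda>s. ((if x \<in> A then \<gamma>1 x s else \<gamma>2 x s) - min \<kappa>1 \<kappa>2) * s)"
      using m1.monotone m2.monotone
    proof eventually_elim
      case (elim x)
      then show ?case
        using mono_flux_weaken[of "\<gamma>1 x" \<kappa>1 "min \<kappa>1 \<kappa>2"] mono_flux_weaken[of "\<gamma>2 x" \<kappa>2 "min \<kappa>1 \<kappa>2"]
        by (cases "x \<in> A") simp_all
    qed
  qed (use m1.\<Omega> m1.hausdorff m1.pos m2.pos in auto)
qed

lemma material_min:
  assumes "material \<Omega> \<gamma>1 c1 C1 \<kappa>1" "material \<Omega> \<gamma>2 c2 C2 \<kappa>2"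
  shows "material \<Omega> (\<lambda>x s. min (\<gamma>1 x s) (\<gamma>2 x s)) (min c1 c2) (max C1 C2) (min \<kappa>1 \<kappa>2)"
proof -
  interpret m1: material \<Omega> \<gamma>1 c1 C1 \<kappa>1 by fact
  interpret m2: material \<Omega> \<gamma>2 c2 C2 \<kappa>2 by fact
  show ?thesis
  proof
    note [measurable] = m1.measurable_law[unfolded case_prod_beta'] m2.measurable_law[unfolded case_prod_beta']
    show "(\<lambda>(x, s). min (\<gamma>1 x s) (\<gamma>2 x s)) \<in> borel_measurable (lebesgue_on \<Omega> \<Otimes>\<^sub>M borel)"
      unfolding case_prod_beta' by measurable
    show "continuous_on UNIV (\<lambda>s. min (\<gamma>1 x s) (\<gamma>2 x s))" if "x \<in> \<Omega>" for x
      using m1.continuous_law[OF that] m2.continuous_law[OF that] by (rule continuous_on_min)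
    show "AE x in lebesgue_on \<Omega>. \<forall>s\<ge>0. min c1 c2 \<le> min (\<gamma>1 x s) (\<gamma>2 x s) \<and>
        min (\<gamma>1 x s) (\<gamma>2 x s) \<le> max C1 C2"
      using m1.bounds m2.bounds by eventually_elim (auto simp: min_le_iff_disj le_max_iff_disj)
    show "AE x in lebesgue_on \<Omega>. mono_on {0..} (\<lambda>s. (min (\<gamma>1 x s) (\<gamma>2 x s) - min \<kappa>1 \<kappa>2) * s)"
      using m1.monotone m2.monotone
    proof eventually_elim
      case (elim x)
      let ?k = "min \<kappa>1 \<kappa>2"
      have m: "mono_on {0..} (\<lambda>s. (\<gamma>1 x s - ?k) * s)" "mono_on {0..} (\<lambda>s. (\<gamma>2 x s - ?k) * s)"
        using elim by (auto intro: mono_flux_weaken)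
      have eq: "(min (\<gamma>1 x s) (\<gamma>2 x s) - ?k) * s = min ((\<gamma>1 x s - ?k) * s) ((\<gamma>2 x s - ?k) * s)"
        if "0 \<le> s" for s
        using mult_right_mono[OF _ that, of "\<gamma>1 x s - ?k" "\<gamma>2 x s - ?k"]
          mult_right_mono[OF _ that, of "\<gamma>2 x s - ?k" "\<gamma>1 x s - ?k"]
        by (cases "\<gamma>1 x s \<le> \<gamma>2 x s") (simp_all add: min_absorb1 min_absorb2)
      show ?case
      proof (rule mono_onI)
        fix r s :: real assume rs: "r \<in> {0..}" "s \<in> {0..}" "r \<le> s"
        show "(min (\<gamma>1 x r) (\<gamma>2 x r) - ?k) * r \<le> (min (\<gamma>1 x s) (\<gamma>2 x s) - ?k) * s"
          using mono_onD[OF m(1) rs] mono_onD[OF m(2) rs] rs by (simp only: eq atLeast_iff min.mono)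
      qed
    qed
  qed (use m1.\<Omega> m1.hausdorff m1.pos m2.pos in auto)
qed

lemma linear_materialI:
  fixes \<Omega> :: "'a::euclidean_space set"
  assumes "open \<Omega>" "bounded \<Omega>"
    and "measure_space UNIV (sets borel) (hausdorff_outer (DIM('a) - 1) :: 'a set \<Rightarrow> ennreal)"
    and "0 < c" and [measurable]: "g \<in> borel_measurable (lebesgue_on \<Omega>)"
    and bounds: "AE x in lebesgue_on \<Omega>. c \<le> g x \<and> g x \<le> C"
  shows "linear_material \<Omega> g c C c"
proof
  show "(\<lambda>(x, s). g x) \<in> borel_measurable (lebesgue_on \<Omega> \<Otimes>\<^sub>M (borel :: real measure))"
    unfolding case_prod_beta' by measurable
  show "AE x in lebesgue_on \<Omega>. \<forall>s\<ge>(0::real). c \<le> g x \<and> g x \<le> C"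
    using bounds by eventually_elim simp
  show "AE x in lebesgue_on \<Omega>. mono_on {0..} (\<lambda>s. (g x - c) * s)"
    using bounds by eventually_elim (auto intro!: mono_onI mult_left_mono)
qed (use assms in auto)

lemma nonlinear_material:
  fixes \<Omega> :: "'a::euclidean_space set" and h :: "real \<Rightarrow> real"
  assumes "open \<Omega>" "bounded \<Omega>"
    and "measure_space UNIV (sets borel) (hausdorff_outer (DIM('a) - 1) :: 'a set \<Rightarrow> ennreal)"
    and "0 < c" "0 < \<kappa>" and h: "continuous_on {0..} h"
    and bounds: "\<And>s. 0 \<le> s \<Longrightarrow> c \<le> h s \<and> h s \<le> C"
    and mono: "\<And>s1 s2 :: 'a. (h (norm s2) *\<^sub>R s2 - h (norm s1) *\<^sub>R s1) \<bullet> (s2 - s1) \<ge> \<kappa> * (norm (s2 - s1))\<^sup>2"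
  shows "material \<Omega> (\<lambda>x s. h (max 0 s)) c C \<kappa>"
proof
  have cont: "continuous_on UNIV (\<lambda>s. h (max 0 s))"
    by (intro continuous_on_compose2[OF h] continuous_intros) auto
  then show "continuous_on UNIV (\<lambda>s. h (max 0 s))" .
  have [measurable]: "(\<lambda>s. h (max 0 s)) \<in> borel_measurable borel"
    by (rule borel_measurable_continuous_onI[OF cont])
  show "(\<lambda>(x, s). h (max 0 s)) \<in> borel_measurable (lebesgue_on \<Omega> \<Otimes>\<^sub>M borel)"
    unfolding case_prod_beta' by measurable
  have "mono_on {0..} (\<lambda>s. (h (max 0 s) - \<kappa>) * s)"
  proof (rule mono_onI)
    fix r s :: real assume rs: "r \<in> {0..}" "s \<in> {0..}" "r \<le> s"
    obtain e :: 'a where e: "norm e = 1" using vector_choose_size[of 1] by auto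
    then have ee: "e \<bullet> e = 1" by (simp add: norm_eq_1)
    have "\<kappa> * (norm (s *\<^sub>R e - r *\<^sub>R e))\<^sup>2 \<le>
        (h (norm (s *\<^sub>R e)) *\<^sub>R (s *\<^sub>R e) - h (norm (r *\<^sub>R e)) *\<^sub>R (r *\<^sub>R e)) \<bullet> (s *\<^sub>R e - r *\<^sub>R e)"
      by (rule mono)
    also have "\<dots> = (h s * s - h r * r) * (s - r)"
      using rs e ee by (simp add: inner_diff_left inner_diff_right algebra_simps)
    also have "(norm (s *\<^sub>R e - r *\<^sub>R e))\<^sup>2 = (s - r) * (s - r)"
      using e by (simp add: power2_eq_square flip: scaleR_diff_left)
    finally have "(\<kappa> * (s - r)) * (s - r) \<le> (h s * s - h r * r) * (s - r)" by (simp add: mult.assoc)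
    then have "r = s \<or> \<kappa> * (s - r) \<le> h s * s - h r * r"
      using rs by (cases "r = s") auto
    then show "(h (max 0 r) - \<kappa>) * r \<le> (h (max 0 s) - \<kappa>) * s"
      using rs by (auto simp: algebra_simps max_absorb2)
  qed
  then show "AE x in lebesgue_on \<Omega>. mono_on {0..} (\<lambda>s. (h (max 0 s) - \<kappa>) * s)" by simp
qed (use assms in auto)

text \<open>
  If the Hausdorff outer measure were not countably additive on the Borel sets, \<^const>\<open>measure_of\<close>
  would return the null measure, for which every boundary function vanishes almost everywhere. So
  additivity needs no separate proof here.
\<close>

lemma measure_space_hausdorff:
  assumes "bdry_nonzero (\<Omega> :: 'a::euclidean_space set) f"
  shows "measure_space UNIV (sets borel) (hausdorff_outer (DIM('a) - 1) :: 'a set \<Rightarrow> ennreal)"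
proof (rule ccontr)
  assume "\<not> ?thesis"
  then have "emeasure (hausdorff_measure (DIM('a) - 1)) B = 0" for B :: "'a set"
    using sets.sigma_sets_eq[of "borel :: 'a measure"]
    by (simp add: hausdorff_measure_def emeasure_measure_of_conv)
  then have "emeasure (surface_measure \<Omega>) (space (surface_measure \<Omega>)) = 0"
    by (simp add: surface_measure_def emeasure_restrict_space sets_hausdorff_measure space_restrict_space)
  then have "AE x in surface_measure \<Omega>. f x = 0"
    by (intro AE_I[of _ _ "space (surface_measure \<Omega>)"]) auto
  then show False using assms by (simp add: bdry_nonzero_def)
qed

theorem proposition4p5:
  fixes \<Omega> A T F :: "'a::euclidean_space set"
    and \<gamma>bg :: "'a \<Rightarrow> real" and \<gamma>nl :: "real \<Rightarrow> real"
    and cbgl cbgu cnll cnlu \<kappa> s0 sM \<gamma>l :: real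
    and \<gamma>A \<gamma>T \<gamma>Fu \<gamma>Tl :: "'a \<Rightarrow> real \<Rightarrow> real"
    and L :: "('a \<Rightarrow> real) \<Rightarrow> ('a \<Rightarrow> real) \<Rightarrow> real"
  assumes dim: "2 \<le> DIM('a)"
    and domain: "open \<Omega>" "bounded \<Omega>" "connected \<Omega>" "\<Omega> \<noteq> {}" "lipschitz_boundary \<Omega>"
    and bg_pos: "0 < cbgl" "0 < cbgu"
    and bg_meas: "\<gamma>bg \<in> borel_measurable (lebesgue_on \<Omega>)"
    and bg_bounds: "AE x in lebesgue_on \<Omega>. cbgl \<le> \<gamma>bg x \<and> \<gamma>bg x \<le> cbgu"
    and nl_H1: "continuous_on {0..} \<gamma>nl"
    and nl_H2: "strict_mono_on {0..} (\<lambda>s. \<gamma>nl s * s)"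
    and nl_H3: "0 < cnll" "cnll < cnlu" "\<And>s. 0 \<le> s \<Longrightarrow> cnll \<le> \<gamma>nl s \<and> \<gamma>nl s \<le> cnlu"
    and nl_H4: "0 < \<kappa>"
      "\<And>s1 s2 :: 'a. (\<gamma>nl (norm s2) *\<^sub>R s2 - \<gamma>nl (norm s1) *\<^sub>R s1) \<bullet> (s2 - s1)
                        \<ge> \<kappa> * (norm (s2 - s1))\<^sup>2"
    and order: "cnll < cbgu" "cbgu < cnlu" "cbgu < \<gamma>nl 0"
    and s0: "0 < s0" "\<gamma>nl s0 = cbgu" "\<And>s. 0 \<le> s \<Longrightarrow> \<gamma>nl s = cbgu \<Longrightarrow> s0 \<le> s"
    and sM: "0 < sM" "sM < s0"
    and \<gamma>l_min: "\<gamma>l \<in> \<gamma>nl ` {0..sM}" "\<And>s. s \<in> {0..sM} \<Longrightarrow> \<gamma>l \<le> \<gamma>nl s"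
    and A: "A \<subseteq> \<Omega>" "A \<in> sets lebesgue"
    and T: "T \<subseteq> \<Omega>" "T \<in> sets lebesgue"
    and F: "F \<subseteq> \<Omega>" "F \<in> sets lebesgue" "A \<subseteq> F" "\<not> T \<subseteq> F"
    and \<gamma>A: "\<gamma>A = (\<lambda>x s. if x \<in> A then \<gamma>nl s else \<gamma>bg x)"
    and \<gamma>T: "\<gamma>T = (\<lambda>x s. if x \<in> T then \<gamma>nl s else min (\<gamma>bg x) (\<gamma>nl s))"
    and \<gamma>Fu: "\<gamma>Fu = (\<lambda>x s. if x \<in> F then cnlu else \<gamma>bg x)"
    and \<gamma>Tl: "\<gamma>Tl = (\<lambda>x s. if x \<in> T then \<gamma>l else \<gamma>bg x)"
    and L: "L = (\<lambda>f \<phi>. DtN \<Omega> \<gamma>Fu f \<phi> - DtN \<Omega> \<gamma>Tl f \<phi>)"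
    and neg_eigenvalue: "\<exists>\<delta><0. eigenvalue \<Omega> L \<delta>"
  shows "\<forall>f \<in> fun_span {\<phi>. \<exists>\<delta><0. eigenfunction \<Omega> L \<delta> \<phi>}. bdry_nonzero \<Omega> f \<longrightarrow>
    (\<exists>t0>0. \<forall>t. 0 < t \<and> t < t0 \<longrightarrow>
       avg_DtN \<Omega> \<gamma>A (\<lambda>x. t * f x) (\<lambda>x. t * f x)
       - avg_DtN \<Omega> \<gamma>T (\<lambda>x. t * f x) (\<lambda>x. t * f x) < 0)"
proof (intro ballI impI)
  fix f
  assume f: "f \<in> fun_span {\<phi>. \<exists>\<delta><0. eigenfunction \<Omega> L \<delta> \<phi>}" and nz: "bdry_nonzero \<Omega> f"
  note dom = domain(1,2) measure_space_hausdorff[OF nz]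
  have A': "A \<in> sets (lebesgue_on \<Omega>)" and T': "T \<in> sets (lebesgue_on \<Omega>)"
    and F': "F \<in> sets (lebesgue_on \<Omega>)"
    using A T F domain(1) by (auto simp: sets_restrict_space_iff)
  note [measurable] = bg_meas A' T' F'
  have nl_high: "cbgu < \<gamma>nl s" if s: "0 \<le> s" "s < s0" for s
  proof (rule ccontr)
    assume "\<not> cbgu < \<gamma>nl s"
    moreover have "continuous_on {0..s} \<gamma>nl"
      using nl_H1 by (rule continuous_on_subset) auto
    ultimately obtain r where "0 \<le> r" "r \<le> s" "\<gamma>nl r = cbgu"
      using IVT2'[of \<gamma>nl s cbgu 0] order(3) s by auto
    then show False using s0(3)[of r] s by simp
  qed
  obtain s1 where s1: "s1 \<in> {0..sM}" "\<gamma>l = \<gamma>nl s1" using \<gamma>l_min(1) by blast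
  have \<gamma>l: "cnll \<le> \<gamma>l" "\<gamma>l \<le> cnlu" using nl_H3(3)[of s1] s1 by auto

  define gF where "gF x = (if x \<in> F then cnlu else \<gamma>bg x)" for x
  define gT where "gT x = (if x \<in> T then \<gamma>l else \<gamma>bg x)" for x
  let ?A = "\<lambda>x s. if x \<in> A then \<gamma>nl (max 0 s) else \<gamma>bg x"
  let ?T = "\<lambda>x s. if x \<in> T then \<gamma>nl (max 0 s) else min (\<gamma>bg x) (\<gamma>nl (max 0 s))"
  have bg: "linear_material \<Omega> \<gamma>bg cbgl cbgu cbgl"
    by (intro linear_materialI dom bg_pos bg_meas bg_bounds)
  have nl: "material \<Omega> (\<lambda>x s. \<gamma>nl (max 0 s)) cnll cnlu \<kappa>"
    by (rule nonlinear_material[OF dom nl_H3(1) nl_H4(1) nl_H1 nl_H3(3) nl_H4(2)])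
  note bg' = bg[unfolded linear_material_def]
  note mA = material_if[OF nl bg' A']
  note mT = material_if[OF nl material_min[OF bg' nl] T']
  have bF: "AE x in lebesgue_on \<Omega>. min cnll cbgl \<le> gF x \<and> gF x \<le> cnlu"
    using bg_bounds by eventually_elim (use nl_H3(2) order(2) in \<open>auto simp: gF_def\<close>)
  have bT: "AE x in lebesgue_on \<Omega>. min cnll cbgl \<le> gT x \<and> gT x \<le> cnlu"
    using bg_bounds by eventually_elim (use \<gamma>l order(2) in \<open>auto simp: gT_def\<close>)
  have lF: "linear_material \<Omega> gF (min cnll cbgl) cnlu (min cnll cbgl)"
    by (rule linear_materialI[OF dom _ _ bF]) (use nl_H3(1) bg_pos in \<open>auto simp: gF_def[abs_def]\<close>)
  have lT: "linear_material \<Omega> gT (min cnll cbgl) cnlu (min cnll cbgl)"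
    by (rule linear_materialI[OF dom _ _ bT]) (use nl_H3(1) bg_pos in \<open>auto simp: gT_def[abs_def]\<close>)

  have L_eq: "L = (\<lambda>f \<phi>. DtN \<Omega> (\<lambda>x s. gF x) f \<phi> - DtN \<Omega> (\<lambda>x s. gT x) f \<phi>)"
    by (simp add: L \<gamma>Fu \<gamma>Tl gF_def gT_def)
  have L_sum: "(\<lambda>x. \<Sum>\<phi>\<in>S. a \<phi> * \<phi> x) \<in> H_half \<Omega> \<and>
      L (\<lambda>x. \<Sum>\<phi>\<in>S. a \<phi> * \<phi> x) \<psi> = (\<Sum>\<phi>\<in>S. a \<phi> * L \<phi> \<psi>)"
    if "finite S" "S \<subseteq> H_half \<Omega>" "\<psi> \<in> H_half \<Omega>" for S a \<psi>
    using linear_material.DtN_sum[OF lF that, of a] linear_material.DtN_sum[OF lT that, of a]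
    by (simp add: L_eq right_diff_distrib sum_subtractf)
  have L_sym: "L \<phi> \<psi> = L \<psi> \<phi>" if "\<phi> \<in> H_half \<Omega>" "\<psi> \<in> H_half \<Omega>" for \<phi> \<psi>
    using linear_material.DtN_sym[OF lF that] linear_material.DtN_sym[OF lT that] by (simp add: L_eq)
  note fH = negative_on_eigenspan(1)[OF L_sum L_sym f nz]
  note Lneg = negative_on_eigenspan(2)[OF L_sum L_sym f nz]

  have le: "AE x in lebesgue_on \<Omega>. \<forall>s\<ge>0. ?A x s \<le> gF x"
    using bg_bounds by eventually_elim (use nl_H3(3) F(3) order(2) in \<open>auto simp: gF_def\<close>)
  have ge: "AE x in lebesgue_on \<Omega>. \<forall>s. 0 \<le> s \<longrightarrow> s \<le> sM \<longrightarrow> gT x \<le> ?T x s"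
    using bg_bounds
  proof eventually_elim
    case (elim x)
    show ?case
    proof (intro allI impI)
      fix s assume "0 \<le> s" "s \<le> sM"
      then show "gT x \<le> ?T x s"
        using \<gamma>l_min(2)[of s] nl_high[of s] sM(2) elim by (auto simp: gT_def)
    qed
  qed

  define \<epsilon> where "\<epsilon> = - L f f / 4"
  have "0 < \<epsilon>" using Lneg by (simp add: \<epsilon>_def)
  obtain t0 where "0 < t0" and t0: "\<And>t. 0 < t \<Longrightarrow> t < t0 \<Longrightarrow>
      t\<^sup>2 * (DtN \<Omega> (\<lambda>x s. gT x) f f / 2 - \<epsilon>) \<le> avg_DtN \<Omega> ?T (\<lambda>x. t * f x) (\<lambda>x. t * f x)"
    using avg_DtN_ge_linear[OF mT lT ge sM(1) fH \<open>0 < \<epsilon>\<close>] by blast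
  have avgA: "avg_DtN \<Omega> \<gamma>A = avg_DtN \<Omega> ?A" and avgT: "avg_DtN \<Omega> \<gamma>T = avg_DtN \<Omega> ?T"
    using DtN_nonneg_arguments[of \<Omega> \<gamma>A] DtN_nonneg_arguments[of \<Omega> \<gamma>T]
    by (simp_all add: avg_DtN_def[abs_def] \<gamma>A \<gamma>T)
  have "avg_DtN \<Omega> \<gamma>A (\<lambda>x. t * f x) (\<lambda>x. t * f x) - avg_DtN \<Omega> \<gamma>T (\<lambda>x. t * f x) (\<lambda>x. t * f x) < 0"
    if "0 < t" "t < t0" for t
  proof -
    have "avg_DtN \<Omega> \<gamma>A (\<lambda>x. t * f x) (\<lambda>x. t * f x) - avg_DtN \<Omega> \<gamma>T (\<lambda>x. t * f x) (\<lambda>x. t * f x) \<le>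
        t\<^sup>2 / 2 * DtN \<Omega> (\<lambda>x s. gF x) f f - t\<^sup>2 * (DtN \<Omega> (\<lambda>x s. gT x) f f / 2 - \<epsilon>)"
      unfolding avgA avgT using avg_DtN_le_linear[OF mA lF le fH, of t] t0[OF that] by linarith
    also have "\<dots> = - (t\<^sup>2 * \<epsilon>)"
      by (simp add: \<epsilon>_def L_eq field_simps)
    also have "\<dots> < 0" using \<open>0 < \<epsilon>\<close> that(1) by simp
    finally show ?thesis .
  qed
  then show "\<exists>t0>0. \<forall>t. 0 < t \<and> t < t0 \<longrightarrow>
      avg_DtN \<Omega> \<gamma>A (\<lambda>x. t * f x) (\<lambda>x. t * f x) - avg_DtN \<Omega> \<gamma>T (\<lambda>x. t * f x) (\<lambda>x. t * f x) < 0"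
    using \<open>0 < t0\<close> by blast
qed

end
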